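(* Let $m,n,l\in\mathbb{N}$, $x_0\in\mathbb{R}^n$, and let $L=(L_1,\dots,L_m)\colon[0,1]\times\mathbb{R}^n\times\mathbb{R}^l\to\mathbb{R}^m$, $\varphi\colon[0,1]\times\mathbb{R}^n\times\mathbb{R}^l\to\mathbb{R}^n$, $g\colon[0,1]\times\mathbb{R}^n\times\mathbb{R}^l\to\mathbb{R}$. Consider the multi-objective optimal control problem (MCP): minimize, with respect to the order cone $\mathbb{R}^m_+$, the vector $I(x,u)=(I_1(x,u),\dots,I_m(x,u))$, $I_j(x,u)=\int_0^1 L_j(t,x(t),u(t))\,dt$, over pairs $(x,u)\in X\times U$, $X=C([0,1],\mathbb{R}^n)$ (sup norm), $U=L^\infty([0,1],\mathbb{R}^l)$, subject to $x(t)=x_0+\int_0^t\varphi(s,x(s),u(s))\,ds$ for a.e. $t\in[0,1]$ and $g(t,x(t),u(t))\le 0$ for a.e. $t\in[0,1]$; let $\Phi$ denote the set of such feasible pairs. Assume: (H1) $L$ is a Carathéodory function (measurable in $t$, continuous in $(x,u)$) and $\phi:=(\varphi,g)$ is continuous; for a.e. $t$, $L(t,\cdot,\cdot)$ is of class $C^2$, and for all $t$, $\phi(t,\cdot,\cdot)$ is of class $C^2$; for every $M>0$ there exist $k_{LM}>0$, $k_{\phi M}>0$ with $|L(t,x_1,u_1)-L(t,x_2,u_2)|+|\nabla L(t,x_1,u_1)-\nabla L(t,x_2,u_2)|+|\nabla^2L(t,x_1,u_1)-\nabla^2L(t,x_2,u_2)|\le k_{LM}(|x_1-x_2|+|u_1-u_2|)$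 for a.e. $t$ and $|\phi(t,x_1,u_1)-\phi(t,x_2,u_2)|+|\nabla \phi(t,x_1,u_1)-\nabla \phi(t,x_2,u_2)|+|\nabla^2\phi(t,x_1,u_1)-\nabla^2\phi(t,x_2,u_2)|\le k_{\phi M}(|x_1-x_2|+|u_1-u_2|)$ for all $t$, whenever $|x_i|\le M$, $|u_i|\le M$ ($i=1,2$); moreover $L(t,0,0)$, $|\nabla L(t,0,0)|$, $|\nabla^2L(t,0,0)|$, $\phi(t,0,0)$, $|\nabla\phi(t,0,0)|$, $|\nabla^2\phi(t,0,0)|$ belong to $L^\infty([0,1],\mathbb{R})$ (gradients and Hessians are with respect to $(x,u)$). (H2) For the pair $\bar z=(\bar x,\bar u)\in\Phi$ under consideration there exist $i_0\in\{1,\dots,l\}$ and $\alpha>0$ such that $|g_{u_{i_0}}(t,\bar x(t),\bar u(t))|\ge\alpha$ for a.e. $t\in[0,1]$. Suppose $\bar z=(\bar x,\bar u)$ is a locally weak Pareto solution of (MCP). Then for each $z=(x,u)\in\mathcal{C}(\bar z)$ there exist $\lambda\in\mathbb{R}^m_+$ with $|\lambda|=1$, an absolutely continuous function $\bar p\colon[0,1]\to\mathbb{R}^n$ and $\theta\in L^1([0,1],\mathbb{R})$ such that: (i) $\theta\in N(Q;g[\cdot])$; (ii) $\dot{\bar p}(t)=-\sum_{j=1}^m\lambda_j\nabla_x L_j[t]-\varphi_x[t]^T\bar p(t)-\theta(t)\nabla_x g[t]$ for a.e. $t\in[0,1]$, and $\bar p(1)=0$; (iii) $\sum_{j=1}^m\lambda_j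 L_{ju}[t]+\bar p(t)^T\varphi_u[t]+\theta(t)g_u[t]=0$ for a.e. $t\in[0,1]$; (iv) $\int_0^1\Big(\sum_{j=1}^m\lambda_j\nabla^2L_j[t]z(t),z(t)\Big)dt+\int_0^1\Big(\sum_{i=1}^n\bar p_i(t)\nabla^2\varphi_i[t]z(t),z(t)\Big)dt+\int_0^1\big(\theta(t)\nabla^2g[t]z(t),z(t)\big)dt\ge 0$.
   Context: Notation: $L[t],\varphi[t],g[t],L_x[t],\varphi_u[t],g_u[t]$, etc. denote the corresponding functions or partial derivatives evaluated at $(t,\bar x(t),\bar u(t))$; $\nabla^2$ denotes the Hessian with respect to $(x,u)\in\mathbb{R}^{n+l}$, $z(t)=(x(t),u(t))$, and $(\cdot,\cdot)$ is the Euclidean inner product. $Q=\{v\in L^\infty([0,1],\mathbb{R}): v(t)\le0 \text{ a.e.}\}$. For a convex set $Q$ in a Banach space $E$ and $\bar e\in Q$, $N(Q;\bar e)=\{e^*\in E^*:\langle e^*,e-\bar e\rangle\le0\ \forall e\in Q\}$; $\theta\in N(Q;g[\cdot])$ means that the functional $v\mapsto\int_0^1\theta(t)v(t)dt$ on $L^\infty([0,1],\mathbb{R})$ belongs to $N(Q;g[\cdot])$. A feasible $\bar z$ is a locally weak Pareto solution if there is $\epsilon>0$ such that $I(x,u)-I(\bar x,\bar u)\notin-\mathrm{int}\,\mathbb{R}^m_+$ for all $(x,u)\in\Phi$ with $\|x-\bar x\|_X\le\epsilon$, $\|u-\bar u\|_\infty\le\epsilon$. For a set $A$ and point $a$, $\mathrm{cone}(A-a)=\{\mu(h-a):h\in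 A,\mu>0\}$. The critical cone $\mathcal{C}(\bar z)$ is the closure in $X\times U$ of the set $\mathcal{C}_0(\bar z)$ of $(x,u)\in X\times U$ with: ($c_1$) $\int_0^1(L_x[t]x(t)+L_u[t]u(t))dt\in-\mathbb{R}^m_+$; ($c_2$) $x(t)=\int_0^t(\varphi_x[s]x(s)+\varphi_u[s]u(s))ds$ for all $t$; ($c_3$) $g_x[\cdot]x+g_u[\cdot]u\in\mathrm{cone}(Q-g(\cdot,\bar x,\bar u))$. *)

theory Defs
  imports "HOL-Analysis.Analysis"
begin

abbreviation I01 :: "real measure" where
  "I01 \<equiv> lebesgue_on {0..1}"

definition Linf :: "(real \<Rightarrow> 'a::real_normed_vector) \<Rightarrow> bool" where
  "Linf f \<longleftrightarrow> f \<in> borel_measurable I01 \<and> (\<exists>C. AE t in I01. norm (f t) \<le> C)"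

definition supnorm :: "(real \<Rightarrow> 'a::real_normed_vector) \<Rightarrow> real" where
  "supnorm x = Sup ((\<lambda>t. norm (x t)) ` {0..1})"

definition abs_cont_01 :: "(real \<Rightarrow> 'a::real_normed_vector) \<Rightarrow> bool" where
  "abs_cont_01 p \<longleftrightarrow> (\<forall>\<epsilon>>0. \<exists>\<delta>>0. \<forall>(N::nat) a b.
     (\<forall>k<N. 0 \<le> a k \<and> a k \<le> b k \<and> b k \<le> 1) \<and>
     (\<forall>i<N. \<forall>j<N. i \<noteq> j \<longrightarrow> b i \<le> a j \<or> b j \<le> a i) \<and>
     (\<Sum>k<N. b k - a k) < \<delta> \<longrightarrow> (\<Sum>k<N. norm (p (b k) - p (a k))) < \<epsilon>)"

definition nonneg_orthant :: "(real^'m) set" where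
  "nonneg_orthant = {v. \<forall>j. 0 \<le> v $ j}"

definition feasible ::
  "real^'n \<Rightarrow> (real \<Rightarrow> ((real^'n) \<times> (real^'l)) \<Rightarrow> real^'n) \<Rightarrow> (real \<Rightarrow> ((real^'n) \<times> (real^'l)) \<Rightarrow> real)
   \<Rightarrow> (real \<Rightarrow> real^'n) \<Rightarrow> (real \<Rightarrow> real^'l) \<Rightarrow> bool" where
  "feasible x0 \<phi> g x u \<longleftrightarrow> continuous_on {0..1} x \<and> Linf u \<and>
     (AE t in I01. integrable (lebesgue_on {0..t}) (\<lambda>s. \<phi> s (x s, u s)) \<and>
        x t = x0 + integral\<^sup>L (lebesgue_on {0..t}) (\<lambda>s. \<phi> s (x s, u s))) \<and>
     (AE t in I01. g t (x t, u t) \<le> 0)"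

definition cost :: "(real \<Rightarrow> ((real^'n) \<times> (real^'l)) \<Rightarrow> real^'m)
   \<Rightarrow> (real \<Rightarrow> real^'n) \<Rightarrow> (real \<Rightarrow> real^'l) \<Rightarrow> real^'m" where
  "cost L x u = (\<chi> j. integral\<^sup>L I01 (\<lambda>t. L t (x t, u t) $ j))"

definition loc_weak_pareto ::
  "(real \<Rightarrow> ((real^'n) \<times> (real^'l)) \<Rightarrow> real^'m) \<Rightarrow> real^'n \<Rightarrow> (real \<Rightarrow> ((real^'n) \<times> (real^'l)) \<Rightarrow> real^'n)
   \<Rightarrow> (real \<Rightarrow> ((real^'n) \<times> (real^'l)) \<Rightarrow> real) \<Rightarrow> (real \<Rightarrow> real^'n) \<Rightarrow> (real \<Rightarrow> real^'l) \<Rightarrow> bool" where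
  "loc_weak_pareto L x0 \<phi> g xb ub \<longleftrightarrow> feasible x0 \<phi> g xb ub \<and>
     (\<exists>\<epsilon>>0. \<forall>x u. feasible x0 \<phi> g x u \<and> supnorm (\<lambda>t. x t - xb t) \<le> \<epsilon> \<and>
        (AE t in I01. norm (u t - ub t) \<le> \<epsilon>) \<longrightarrow>
        cost L x u - cost L xb ub \<notin> uminus ` interior nonneg_orthant)"

definition Qset :: "(real \<Rightarrow> real) set" where
  "Qset = {v. Linf v \<and> (AE t in I01. v t \<le> 0)}"

text \<open>The set C_0(zbar); DL, Dphi, Dg are the Frechet derivatives of L, phi, g in (x,u).\<close>
definition crit0 ::
  "(real \<Rightarrow> ((real^'n) \<times> (real^'l)) \<Rightarrow> ((real^'n) \<times> (real^'l)) \<Rightarrow>\<^sub>L (real^'m))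
   \<Rightarrow> (real \<Rightarrow> ((real^'n) \<times> (real^'l)) \<Rightarrow> ((real^'n) \<times> (real^'l)) \<Rightarrow>\<^sub>L (real^'n))
   \<Rightarrow> (real \<Rightarrow> ((real^'n) \<times> (real^'l)) \<Rightarrow> real)
   \<Rightarrow> (real \<Rightarrow> ((real^'n) \<times> (real^'l)) \<Rightarrow> ((real^'n) \<times> (real^'l)) \<Rightarrow>\<^sub>L real)
   \<Rightarrow> (real \<Rightarrow> real^'n) \<Rightarrow> (real \<Rightarrow> real^'l)
   \<Rightarrow> (real \<Rightarrow> real^'n) \<Rightarrow> (real \<Rightarrow> real^'l) \<Rightarrow> bool" where
  "crit0 DL D\<phi> g Dg xb ub x u \<longleftrightarrow> continuous_on {0..1} x \<and> Linf u \<and>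
     (\<chi> j. integral\<^sup>L I01 (\<lambda>t. blinfun_apply (DL t (xb t, ub t)) (x t, u t) $ j))
        \<in> uminus ` nonneg_orthant \<and>
     (\<forall>t\<in>{0..1}. x t = integral\<^sup>L (lebesgue_on {0..t})
                          (\<lambda>s. blinfun_apply (D\<phi> s (xb s, ub s)) (x s, u s))) \<and>
     (\<exists>\<mu>>0. \<exists>h\<in>Qset. AE t in I01.
        blinfun_apply (Dg t (xb t, ub t)) (x t, u t) = \<mu> * (h t - g t (xb t, ub t)))"

definition crit ::
  "(real \<Rightarrow> ((real^'n) \<times> (real^'l)) \<Rightarrow> ((real^'n) \<times> (real^'l)) \<Rightarrow>\<^sub>L (real^'m))
   \<Rightarrow> (real \<Rightarrow> ((real^'n) \<times> (real^'l)) \<Rightarrow> ((real^'n) \<times> (real^'l)) \<Rightarrow>\<^sub>L (real^'n))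
   \<Rightarrow> (real \<Rightarrow> ((real^'n) \<times> (real^'l)) \<Rightarrow> real)
   \<Rightarrow> (real \<Rightarrow> ((real^'n) \<times> (real^'l)) \<Rightarrow> ((real^'n) \<times> (real^'l)) \<Rightarrow>\<^sub>L real)
   \<Rightarrow> (real \<Rightarrow> real^'n) \<Rightarrow> (real \<Rightarrow> real^'l)
   \<Rightarrow> (real \<Rightarrow> real^'n) \<Rightarrow> (real \<Rightarrow> real^'l) \<Rightarrow> bool" where
  "crit DL D\<phi> g Dg xb ub x u \<longleftrightarrow> continuous_on {0..1} x \<and> Linf u \<and>
     (\<forall>\<epsilon>>0. \<exists>x' u'. crit0 DL D\<phi> g Dg xb ub x' u' \<and>
        supnorm (\<lambda>t. x' t - x t) \<le> \<epsilon> \<and> (AE t in I01. norm (u' t - u t) \<le> \<epsilon>))"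

end

theory Submission
  imports Defs
begin

text \<open>
  Since \<open>g\<^sub>u\<close> does not vanish in the direction \<open>i0\<close>, every prescribed value of the constraint
  function can be reached by adjusting the control component \<open>i0\<close> alone, while the state follows
  the differential equation. For each single objective \<open>k\<close> define \<open>\<theta>\<^sub>k\<close> and the adjoint state \<open>p\<^sub>k\<close> by the
  adjoint equation together with the requirement that the Lagrangian
  \<open>H\<^sub>k = L\<^sub>k + p\<^sub>k \<bullet> \<phi> + \<theta>\<^sub>k * g\<close> has zero derivative in the control component \<open>i0\<close>. For a critical
  direction \<open>d\<close>, a control variation \<open>w\<close> and an admissible \<open>e\<close>, there are feasible pairs within \<open>O(\<epsilon>\<^sup>2)\<close> of
  \<open>zb + \<epsilon> d\<close> on which the constraint takes the value \<open>g[t] + \<epsilon> Dg[t] d + \<epsilon>\<^sup>2 e\<close>, and integration by parts against \<open>p\<^sub>k\<close> shows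
  that the \<open>k\<close>-th cost changes by at most \<open>\<epsilon>\<^sup>2 V\<^sub>k(w, e) + O(\<epsilon>\<^sup>3)\<close>, where \<open>V\<^sub>k\<close> is affine in \<open>(w, e)\<close> with
  constant term \<open>\<integral> D\<^sup>2H\<^sub>k d d / 2\<close>. Weak Pareto optimality keeps the convex set of all vectors \<open>V(w, e)\<close>
  away from the open negative orthant of the finite-dimensional objective space, and a separating
  hyperplane there yields \<open>\<lambda>\<close>. The multipliers depend linearly on \<open>\<lambda>\<close>, so compactness of the unit
  sphere extends the result to the closure of the critical directions.
\<close>

section \<open>Integration on the unit interval\<close>

text \<open>Separating in the space of constraint functions would a priori give a multiplier in the
  dual of L-infinity, possibly with a singular part, and leave \<lambda> = 0 open. Here nothing is
  separated there: (H2) lets the inequality be replaced by an equation with prescribed value, solved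
  exactly together with the state equation, so that only the m cost values remain. The multiplier is
  a quotient whose denominator has modulus at least \<alpha>, hence a bounded function, and
  \<lambda> is the nonzero normal of a hyperplane in the objective space. First-order conditions are
  not proved beforehand. They come out of the same inequality \<lambda> \<bullet> V(w, e) \<ge> 0:
  its value at (0, 0) is the second-order condition, and arbitrarily large multiples of w or e give
  the stationarity and normal cone conditions. The correction that restores feasibility has order
  \<epsilon>^2, the very order at which V is read off. It leaves no trace because its state part
  cancels through the adjoint equation and its control part lies along the direction in which the
  Hamiltonian is stationary.\<close>

lemma finite_measure_I01: "finite_measure I01"
  by (rule finite_measure_lebesgue_on) simp

text \<open>Rests on completeness of Lebesgue measure; both functions are extended by zero to the
  whole line to use it there.\<close>

lemma borel_measurable_I01_AE:
  fixes f g :: "real \<Rightarrow> 'b::euclidean_space"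
  assumes f: "f \<in> borel_measurable I01" and ae: "AE t in I01. f t = g t"
  shows "g \<in> borel_measurable I01"
proof -
  have "(\<lambda>t. if t \<in> {0..1} then f t else 0) \<in> borel_measurable lebesgue"
    using f by (subst borel_measurable_if) auto
  moreover have "AE t in lebesgue. (if t \<in> {0..1} then f t else 0) = (if t \<in> {0..1} then g t else 0)"
    using ae by (subst (asm) AE_restrict_space_iff) auto
  ultimately have "(\<lambda>t. if t \<in> {0..1} then g t else 0) \<in> borel_measurable lebesgue"
    by (rule borel_measurable_AE)
  then show ?thesis by (subst (asm) borel_measurable_if) auto
qed

lemma borel_measurable_I01_AE_LIMSEQ:
  fixes f :: "nat \<Rightarrow> real \<Rightarrow> 'b::euclidean_space"
  assumes f: "\<And>n. f n \<in> borel_measurable I01" and ae: "AE t in I01. (\<lambda>n. f n t) \<longlonglongrightarrow> h t"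
  shows "h \<in> borel_measurable I01"
proof -
  have 1: "(\<lambda>t. lim (\<lambda>n. f n t)) \<in> borel_measurable I01"
    using f by measurable
  have 2: "AE t in I01. lim (\<lambda>n. f n t) = h t"
    using ae by eventually_elim (rule limI)
  show ?thesis using borel_measurable_I01_AE[OF 1 2] .
qed

text \<open>A simple function takes finitely many values, so \<open>f t (s i t)\<close> is pieced
  together from finitely many slices; continuity in the second variable carries measurability to the
  limit.\<close>

lemma caratheodory_measurable:
  fixes f :: "real \<Rightarrow> 'a::euclidean_space \<Rightarrow> 'b::euclidean_space"
  assumes f: "\<And>z. (\<lambda>t. f t z) \<in> borel_measurable I01"
    and c: "AE t in I01. continuous_on UNIV (f t)"
    and z: "z \<in> borel_measurable I01"
  shows "(\<lambda>t. f t (z t)) \<in> borel_measurable I01"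
proof -
  obtain s where s: "\<And>i. simple_function I01 (s i)" "\<And>t. t \<in> space I01 \<Longrightarrow> (\<lambda>i. s i t) \<longlonglongrightarrow> z t"
    using borel_measurable_implies_sequence_metric[OF z] by metis
  have m: "(\<lambda>t. f t (s i t)) \<in> borel_measurable I01" for i
  proof (rule measurable_compose_countable'[where f="\<lambda>z t. f t z" and I="s i ` space I01"])
    show "s i \<in> I01 \<rightarrow>\<^sub>M count_space (s i ` space I01)"
      using s(1)[of i] by (simp add: measurable_simple_function simple_function_def measurable_count_space_eq2)
    show "countable (s i ` space I01)"
      using simple_functionD(1)[OF s(1)[of i]] by (rule countable_finite)
  qed (use f in auto)
  have "AE t in I01. (\<lambda>i. f t (s i t)) \<longlonglongrightarrow> f t (z t)"
    using c AE_space
  proof eventually_elim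
    case (elim t)
    then have "isCont (f t) (z t)" by (simp add: continuous_on_eq_continuous_at)
    then show ?case using s(2)[OF elim(2)] isCont_tendsto_compose by blast
  qed
  with m show ?thesis by (rule borel_measurable_I01_AE_LIMSEQ)
qed

lemma integrable_I01_bounded:
  fixes f :: "real \<Rightarrow> 'b::euclidean_space"
  assumes "f \<in> borel_measurable I01" "AE t in I01. norm (f t) \<le> C"
  shows "integrable I01 f"
  using finite_measure.integrable_const_bound[OF finite_measure_I01] assms by blast

lemma measure_I01: "measure I01 {0..1} = 1"
  by (simp add: measure_restrict_space)

text \<open>A nonintegrable function has integral 0 by convention; \<open>0 \<le> C\<close> covers
  that case.\<close>

lemma integral_I01_norm_le:
  fixes f :: "real \<Rightarrow> 'b::euclidean_space"
  assumes "AE t in I01. norm (f t) \<le> C" "0 \<le> C"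
  shows "norm (integral\<^sup>L I01 f) \<le> C"
proof (cases "integrable I01 f")
  case True
  have "norm (integral\<^sup>L I01 f) \<le> integral\<^sup>L I01 (\<lambda>t. norm (f t))" by simp
  also have "\<dots> \<le> integral\<^sup>L I01 (\<lambda>t. C)"
    using assms True by (intro integral_mono_AE) auto
  finally show ?thesis by (simp add: measure_I01)
qed (use assms in \<open>simp add: not_integrable_integral_eq\<close>)

text \<open>The control problem integrates over \<open>lebesgue_on {0..t}\<close>, a measure
  depending on t. With an indicator all these integrals live on the single measure
  \<open>I01\<close>, where Fubini's theorem and linearity apply directly.\<close>

lemma lebesgue_on_initial:
  fixes f :: "real \<Rightarrow> 'b::euclidean_space"
  assumes "t \<in> {0..1}"
  shows "integral\<^sup>L (lebesgue_on {0..t}) f = integral\<^sup>L I01 (\<lambda>s. indicator {0..t} s *\<^sub>R f s)"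
    and "integrable (lebesgue_on {0..t}) f \<longleftrightarrow> integrable I01 (\<lambda>s. indicator {0..t} s *\<^sub>R f s)"
proof -
  have e: "(\<lambda>s. indicator {0..1} s *\<^sub>R indicator {0..t} s *\<^sub>R f s) = (\<lambda>s. indicator {0..t} s *\<^sub>R f s)"
    using assms by (auto simp: fun_eq_iff indicator_def)
  show "integral\<^sup>L (lebesgue_on {0..t}) f = integral\<^sup>L I01 (\<lambda>s. indicator {0..t} s *\<^sub>R f s)"
    by (subst (1 2) integral_restrict_space) (simp_all add: e del: scaleR_scaleR)
  show "integrable (lebesgue_on {0..t}) f \<longleftrightarrow> integrable I01 (\<lambda>s. indicator {0..t} s *\<^sub>R f s)"
    by (subst (1 2) integrable_restrict_space) (simp_all add: e del: scaleR_scaleR)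
qed

lemma measurable_ident_I01 [measurable]: "(\<lambda>x::real. x) \<in> borel_measurable I01"
  using id_borel_measurable_lebesgue_on[of "{0..1::real}"] by (simp add: id_def)

lemma integrable_I01_interval:
  fixes f :: "real \<Rightarrow> 'b::euclidean_space"
  assumes "integrable I01 f"
  shows "integrable I01 (\<lambda>s. indicator {a..b} s *\<^sub>R f s)"
proof -
  have "integrable I01 (\<lambda>s. indicator ({a..b} \<inter> {0..1}) s *\<^sub>R f s)"
    using assms by (intro integrable_mult_indicator) (auto simp: sets_restrict_space_iff)
  also have "?this \<longleftrightarrow> ?thesis"
    by (intro Bochner_Integration.integrable_cong) (auto simp: indicator_def)
  finally show ?thesis .
qed

text \<open>Fubini on the triangle t \<le> s. It is integration by parts for the tail integral of
  \<open>c\<close> and the initial integral of \<open>b\<close>; the boundary terms vanish because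
  the former is 0 at 1 and the latter is 0 at 0.\<close>

lemma integral_by_parts_I01:
  fixes b c :: "real \<Rightarrow> 'a::euclidean_space"
  assumes b[measurable]: "b \<in> borel_measurable I01" and c[measurable]: "c \<in> borel_measurable I01"
    and B: "AE t in I01. norm (b t) \<le> B" and C: "AE t in I01. norm (c t) \<le> C"
  shows "(\<integral>t. (\<integral>s. indicator {t..1} s *\<^sub>R c s \<partial>I01) \<bullet> b t \<partial>I01)
       = (\<integral>s. c s \<bullet> (\<integral>t. indicator {0..s} t *\<^sub>R b t \<partial>I01) \<partial>I01)"
proof -
  interpret finite_measure I01 by (rule finite_measure_I01)
  interpret P: pair_sigma_finite I01 I01 ..
  have ind[measurable]: "(\<lambda>(s,t). indicator {t..1} s :: real) \<in> borel_measurable (I01 \<Otimes>\<^sub>M I01)"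
  proof -
    have [measurable]: "fst \<in> borel_measurable (I01 \<Otimes>\<^sub>M I01)" "snd \<in> borel_measurable (I01 \<Otimes>\<^sub>M I01)"
      using measurable_compose[OF measurable_fst measurable_ident_I01]
        measurable_compose[OF measurable_snd measurable_ident_I01] by auto
    have "(\<lambda>x. if snd x \<le> fst x \<and> fst x \<le> 1 then 1 else 0 :: real) \<in> borel_measurable (I01 \<Otimes>\<^sub>M I01)"
      by measurable
    then show ?thesis by (simp add: indicator_def case_prod_beta' of_bool_def)
  qed
  define f where "f s t = indicator {t..1} s * (c s \<bullet> b t)" for s t :: real
  have fm: "case_prod f \<in> borel_measurable (I01 \<Otimes>\<^sub>M I01)"
  proof -
    have "(\<lambda>x. (\<lambda>(s,t). indicator {t..1} s :: real) x * (c (fst x) \<bullet> b (snd x)))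
        \<in> borel_measurable (I01 \<Otimes>\<^sub>M I01)"
      by (intro borel_measurable_times ind borel_measurable_inner measurable_compose[OF measurable_fst c] measurable_compose[OF measurable_snd b])
    then show ?thesis by (simp add: f_def case_prod_beta')
  qed
  have "AE s in I01. AE t in I01. norm (f s t) \<le> C * B"
    using C
  proof eventually_elim
    case (elim s)
    show ?case using B
    proof eventually_elim
      case e2: (elim t)
      have "norm (f s t) \<le> \<bar>c s \<bullet> b t\<bar>" by (auto simp: f_def indicator_def)
      also have "\<dots> \<le> norm (c s) * norm (b t)" by (rule Cauchy_Schwarz_ineq2)
      also have "\<dots> \<le> C * B" using elim e2 by (intro mult_mono) (auto intro: order_trans[OF norm_ge_zero])
      finally show ?case .
    qed
  qed
  then have "AE x in I01 \<Otimes>\<^sub>M I01. norm (f (fst x) (snd x)) \<le> C * B"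
    using fm by (intro P.AE_pair_measure) (auto simp: case_prod_beta')
  then have ae: "AE x in I01 \<Otimes>\<^sub>M I01. norm (case_prod f x) \<le> C * B"
    by (simp add: case_prod_beta')
  have int: "integrable (I01 \<Otimes>\<^sub>M I01) (case_prod f)"
    using finite_measure.integrable_const_bound[OF finite_measure_pair_measure[OF finite_measure_I01 finite_measure_I01] ae fm] .
  have ic: "integrable I01 c" "integrable I01 b" using integrable_I01_bounded assms by blast+
  have 1: "(\<integral>s. f s t \<partial>I01) = (\<integral>s. indicator {t..1} s *\<^sub>R c s \<partial>I01) \<bullet> b t" for t
  proof -
    have "integrable I01 (\<lambda>s. indicator {t..1} s *\<^sub>R c s)"
      using ic(1) by (rule integrable_I01_interval)
    then have "(\<integral>s. (indicator {t..1} s *\<^sub>R c s) \<bullet> b t \<partial>I01) = (\<integral>s. indicator {t..1} s *\<^sub>R c s \<partial>I01) \<bullet> b t"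
      by (rule integral_inner_left)
    then show ?thesis by (simp add: f_def)
  qed
  have 2: "(\<integral>t. f s t \<partial>I01) = c s \<bullet> (\<integral>t. indicator {0..s} t *\<^sub>R b t \<partial>I01)" if "s \<in> {0..1}" for s
  proof -
    have "integrable I01 (\<lambda>t. indicator {0..s} t *\<^sub>R b t)"
      using ic(2) by (rule integrable_I01_interval)
    then have "(\<integral>t. c s \<bullet> (indicator {0..s} t *\<^sub>R b t) \<partial>I01) = c s \<bullet> (\<integral>t. indicator {0..s} t *\<^sub>R b t \<partial>I01)"
      by (rule integral_inner_right)
    moreover have "(\<integral>t. f s t \<partial>I01) = (\<integral>t. c s \<bullet> (indicator {0..s} t *\<^sub>R b t) \<partial>I01)"
      using that by (intro Bochner_Integration.integral_cong) (auto simp: f_def indicator_def)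
    ultimately show ?thesis by simp
  qed
  have "(\<integral>t. (\<integral>s. f s t \<partial>I01) \<partial>I01) = (\<integral>s. (\<integral>t. f s t \<partial>I01) \<partial>I01)"
    using P.Fubini_integral[OF int] .
  also have "\<dots> = (\<integral>s. c s \<bullet> (\<integral>t. indicator {0..s} t *\<^sub>R b t \<partial>I01) \<partial>I01)"
    by (intro Bochner_Integration.integral_cong) (auto simp: 2)
  finally show ?thesis by (simp add: 1)
qed

section \<open>Exponential weights and fixed points of integral operators\<close>

lemma integral_interval_I01:
  fixes f :: "real \<Rightarrow> real"
  assumes "0 \<le> a" "a \<le> b" "b \<le> 1" and F: "\<And>s. (F has_real_derivative f s) (at s)"
    and f: "continuous_on UNIV f"
  shows "integral\<^sup>L I01 (\<lambda>s. indicator {a..b} s *\<^sub>R f s) = F b - F a"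
    and "integrable I01 (\<lambda>s. indicator {a..b} s *\<^sub>R f s)"
proof -
  have e: "(\<lambda>s. indicator {0..1} s *\<^sub>R indicator {a..b} s *\<^sub>R f s) = (\<lambda>s. indicator {a..b} s *\<^sub>R f s)"
    using assms by (auto simp: fun_eq_iff indicator_def)
  have i: "integrable (lebesgue_on {a..b}) f"
    using continuous_imp_integrable_real[OF continuous_on_subset[OF f]] by auto
  have "integral\<^sup>L I01 (\<lambda>s. indicator {a..b} s *\<^sub>R f s) = integral\<^sup>L (lebesgue_on {a..b}) f"
    by (subst (1 2) integral_restrict_space) (simp_all add: e del: scaleR_scaleR real_scaleR_def)
  also have "\<dots> = integral {a..b} f" using i by (rule lebesgue_integral_eq_integral) auto
  also have "\<dots> = F b - F a"
    using F assms by (intro integral_unique fundamental_theorem_of_calculus)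
      (auto simp flip: has_real_derivative_iff_has_vector_derivative intro: DERIV_subset)
  finally show "integral\<^sup>L I01 (\<lambda>s. indicator {a..b} s *\<^sub>R f s) = F b - F a" .
  show "integrable I01 (\<lambda>s. indicator {a..b} s *\<^sub>R f s)"
    using i integrable_restrict_space[of "{a..b}" lebesgue f]
    by (subst integrable_restrict_space) (simp_all add: e del: scaleR_scaleR real_scaleR_def)
qed

text \<open>Integration gains a factor 1 / K against the weight \<open>exp (K * s)\<close>. With K
  large relative to a Lipschitz constant, an integral operator contracts on all of [0,1] at once,
  with no subdivision of the interval. The backward version serves the adjoint equation.\<close>

lemma integral_exp_bound_forward:
  fixes f :: "real \<Rightarrow> 'b::euclidean_space"
  assumes f: "\<And>s. s \<in> {0..1} \<Longrightarrow> norm (f s) \<le> c * exp (K * s)" and "K > 0" "t \<in> {0..1}" "0 \<le> c"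
  shows "norm (\<integral>s. indicator {0..t} s *\<^sub>R f s \<partial>I01) \<le> c / K * exp (K * t)"
proof (cases "integrable I01 (\<lambda>s. indicator {0..t} s *\<^sub>R f s)")
  case True
  have D: "((\<lambda>s. c / K * exp (K * s)) has_real_derivative c * exp (K * s)) (at s)" for s
    using \<open>K > 0\<close> by (auto intro!: derivative_eq_intros)
  note I = integral_interval_I01[OF _ _ _ D, of 0 t]
  have "norm (\<integral>s. indicator {0..t} s *\<^sub>R f s \<partial>I01) \<le> (\<integral>s. norm (indicator {0..t} s *\<^sub>R f s) \<partial>I01)" by (rule integral_norm_bound)
  also have "\<dots> \<le> (\<integral>s. indicator {0..t} s *\<^sub>R (c * exp (K * s)) \<partial>I01)"
    using assms by (intro integral_mono[OF integrable_norm[OF True] I(2)]) (auto simp: indicator_def intro!: continuous_intros)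
  also have "\<dots> = c / K * exp (K * t) - c / K * exp (K * 0)"
    using assms by (intro I(1)) (auto intro!: continuous_intros)
  also have "\<dots> \<le> c / K * exp (K * t)" using assms by auto
  finally show ?thesis .
qed (use assms in \<open>simp add: not_integrable_integral_eq\<close>)

lemma integral_exp_bound_backward:
  fixes f :: "real \<Rightarrow> 'b::euclidean_space"
  assumes f: "\<And>s. s \<in> {0..1} \<Longrightarrow> norm (f s) \<le> c * exp (K * (1 - s))" and "K > 0" "t \<in> {0..1}" "0 \<le> c"
  shows "norm (\<integral>s. indicator {t..1} s *\<^sub>R f s \<partial>I01) \<le> c / K * exp (K * (1 - t))"
proof (cases "integrable I01 (\<lambda>s. indicator {t..1} s *\<^sub>R f s)")
  case True
  have D: "((\<lambda>s. - (c / K * exp (K * (1 - s)))) has_real_derivative c * exp (K * (1 - s))) (at s)" for s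
    using \<open>K > 0\<close> by (auto intro!: derivative_eq_intros)
  note I = integral_interval_I01[OF _ _ _ D, of t 1]
  have "norm (\<integral>s. indicator {t..1} s *\<^sub>R f s \<partial>I01) \<le> (\<integral>s. norm (indicator {t..1} s *\<^sub>R f s) \<partial>I01)" by (rule integral_norm_bound)
  also have "\<dots> \<le> (\<integral>s. indicator {t..1} s *\<^sub>R (c * exp (K * (1 - s))) \<partial>I01)"
    using assms by (intro integral_mono[OF integrable_norm[OF True] I(2)]) (auto simp: indicator_def intro!: continuous_intros)
  also have "\<dots> = - (c / K * exp (K * (1 - 1))) - (- (c / K * exp (K * (1 - t))))"
    using assms by (intro I(1)) (auto intro!: continuous_intros)
  also have "\<dots> \<le> c / K * exp (K * (1 - t))" using assms by auto
  finally show ?thesis .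
qed (use assms in \<open>simp add: not_integrable_integral_eq\<close>)

text \<open>Contraction by 1/2 is assumed on the tube of radius
  \<open>2 * \<rho> * \<omega> t\<close> around 0; the first iterate has size at most
  \<open>\<rho> * \<omega> t\<close>, so the geometric series never leaves the tube. Bounds and
  convergence are pointwise, and \<open>P\<close> (measurability in the applications) passes to
  pointwise limits, so the fixed point is a genuine function rather than a class modulo null
  sets.\<close>

lemma weighted_contraction_fixpoint:
  fixes T :: "('a \<Rightarrow> 'b::banach) \<Rightarrow> 'a \<Rightarrow> 'b"
  assumes P0: "P (\<lambda>t. 0)"
    and PT: "\<And>f. \<lbrakk>P f; \<And>t. norm (f t) \<le> 2 * \<rho> * \<omega> t\<rbrakk> \<Longrightarrow> P (T f)"
    and Plim: "\<And>F f. \<lbrakk>\<And>k::nat. P (F k); \<And>t. (\<lambda>k. F k t) \<longlonglongrightarrow> f t\<rbrakk> \<Longrightarrow> P f"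
    and lip: "\<And>f h c. \<lbrakk>P f; P h; \<And>t. norm (f t) \<le> 2 * \<rho> * \<omega> t; \<And>t. norm (h t) \<le> 2 * \<rho> * \<omega> t; 0 \<le> c;
          \<And>t. norm (f t - h t) \<le> c * \<omega> t\<rbrakk> \<Longrightarrow> (\<And>t. norm (T f t - T h t) \<le> c / 2 * \<omega> t)"
    and T0: "\<And>t. norm (T (\<lambda>t. 0) t) \<le> \<rho> * \<omega> t" and \<omega>: "\<And>t. 0 \<le> \<omega> t" and \<rho>: "0 \<le> \<rho>"
  obtains f where "P f" "\<And>t. norm (f t) \<le> 2 * \<rho> * \<omega> t" "T f = f"
proof -
  define F where "F k = (T ^^ k) (\<lambda>t. 0)" for k
  have F0: "F 0 = (\<lambda>t. 0)" and FS: "F (Suc k) = T (F k)" for k by (auto simp: F_def)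
  \<comment> \<open>The sum of \<rho> (1/2)^j over j < k is 2 \<rho> (1 - (1/2)^k); this partial sum
    keeps each iterate where \<open>lip\<close> applies.\<close>
  have main: "P (F k) \<and> (\<forall>t. norm (F k t) \<le> 2 * \<rho> * (1 - (1/2)^k) * \<omega> t) \<and>
     (\<forall>t. norm (F (Suc k) t - F k t) \<le> \<rho> * (1/2)^k * \<omega> t)" for k
  proof (induction k)
    case 0
    then show ?case using P0 T0 by (auto simp: F0 FS)
  next
    case (Suc k)
    have le: "2 * \<rho> * (1 - (1/2)^k) * \<omega> t \<le> 2 * \<rho> * \<omega> t" for k t
      using \<omega>[of t] \<rho> by (simp add: mult_left_le mult_right_mono)
    have bk: "norm (F k t) \<le> 2 * \<rho> * \<omega> t" for t using Suc le by (meson order_trans)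
    have b: "norm (F (Suc k) t) \<le> 2 * \<rho> * (1 - (1/2)^Suc k) * \<omega> t" for t
    proof -
      have "norm (F (Suc k) t) \<le> norm (F k t) + norm (F (Suc k) t - F k t)"
        using norm_triangle_sub by blast
      also have "\<dots> \<le> 2 * \<rho> * (1 - (1/2)^k) * \<omega> t + \<rho> * (1/2)^k * \<omega> t"
        using Suc by (intro add_mono) auto
      finally show ?thesis by (simp add: algebra_simps)
    qed
    have bS: "norm (F (Suc k) t) \<le> 2 * \<rho> * \<omega> t" for t using b le by (meson order_trans)
    have pS: "P (F (Suc k))" using PT[of "F k"] Suc bk by (simp add: FS)
    have "norm (T (F (Suc k)) t - T (F k) t) \<le> (\<rho> * (1/2)^k) / 2 * \<omega> t" for t
      using Suc bk bS pS \<rho> by (intro lip) auto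
    then show ?case using pS b by (auto simp: FS)
  qed
  have nb: "norm (F k t) \<le> 2 * \<rho> * \<omega> t" for k t
  proof -
    have "2 * \<rho> * (1 - (1/2)^k) * \<omega> t \<le> 2 * \<rho> * \<omega> t"
      using \<omega>[of t] \<rho> by (simp add: mult_left_le mult_right_mono)
    then show ?thesis using main[of k] by (meson order_trans)
  qed
  have gap: "norm (F (k + n) t - F k t) \<le> 2 * \<rho> * (1/2)^k * (1 - (1/2)^n) * \<omega> t" for k n t
  proof (induction n)
    case (Suc n)
    have "norm (F (k + Suc n) t - F k t) \<le> norm (F (k + n) t - F k t) + norm (F (Suc (k + n)) t - F (k+n) t)"
      using norm_triangle_ineq[of "F (k + n) t - F k t" "F (Suc (k + n)) t - F (k+n) t"] by simp
    also have "\<dots> \<le> 2 * \<rho> * (1/2)^k * (1 - (1/2)^n) * \<omega> t + \<rho> * (1/2)^(k+n) * \<omega> t"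
      using main[of "k+n"] Suc by (intro add_mono) auto
    finally show ?case by (simp add: algebra_simps power_add)
  qed simp
  have gap': "norm (F (k + n) t - F k t) \<le> 2 * \<rho> * \<omega> t * (1/2)^k" for k n t
  proof -
    have "2 * \<rho> * (1/2)^k * (1 - (1/2)^n) * \<omega> t \<le> 2 * \<rho> * (1/2)^k * 1 * \<omega> t"
      using \<omega>[of t] \<rho> by (intro mult_right_mono mult_left_mono) auto
    then show ?thesis using gap[of k n t] by (simp add: algebra_simps)
  qed
  have z: "(\<lambda>k. C * (1/2::real)^k) \<longlonglongrightarrow> 0" for C
    by (intro tendsto_mult_right_zero LIMSEQ_power_zero) auto
  have cau: "Cauchy (\<lambda>k. F k t)" for t
  proof (rule CauchyI')
    fix e :: real assume "0 < e"
    then have "\<forall>\<^sub>F k in sequentially. 2 * \<rho> * \<omega> t * (1/2)^k < e"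
      using order_tendstoD(2)[OF z] by blast
    then obtain M where M: "\<And>k. k \<ge> M \<Longrightarrow> 2 * \<rho> * \<omega> t * (1/2)^k < e"
      by (auto simp: eventually_sequentially)
    show "\<exists>M. \<forall>m\<ge>M. \<forall>n>m. dist (F m t) (F n t) < e"
    proof (intro exI allI impI)
      fix m n assume "M \<le> m" "m < n"
      then show "dist (F m t) (F n t) < e"
        using gap'[of m "n - m" t] M[of m] by (simp add: dist_norm norm_minus_commute)
    qed
  qed
  define f where "f t = lim (\<lambda>k. F k t)" for t
  have lim: "(\<lambda>k. F k t) \<longlonglongrightarrow> f t" for t
    using cau[of t] unfolding f_def by (simp add: Cauchy_convergent_iff convergent_LIMSEQ_iff)
  have Pf: "P f" using Plim[of F f] main lim by blast
  have fb: "norm (f t) \<le> 2 * \<rho> * \<omega> t" for t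
    using LIMSEQ_le_const2[OF tendsto_norm[OF lim[of t]]] nb by blast
  have d: "norm (f t - F k t) \<le> (2 * \<rho> * (1/2)^k) * \<omega> t" for k t
  proof -
    have "(\<lambda>n. norm (F (k+n) t - F k t)) \<longlonglongrightarrow> norm (f t - F k t)"
      using LIMSEQ_ignore_initial_segment[OF lim[of t], of k]
      by (intro tendsto_norm tendsto_diff tendsto_const) (simp add: add.commute)
    then have "norm (f t - F k t) \<le> 2 * \<rho> * \<omega> t * (1/2)^k"
      using LIMSEQ_le_const2 gap'[of k _ t] by blast
    then show ?thesis by (simp add: algebra_simps)
  qed
  have "T f t = f t" for t
  proof -
    have n: "norm (T f t - F (Suc k) t) \<le> (\<rho> * \<omega> t) * (1/2)^k" for k
    proof -
      have "norm (T f t - T (F k) t) \<le> (2 * \<rho> * (1/2)^k) / 2 * \<omega> t"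
        by (rule lip[OF Pf _ fb nb _ d]) (use main \<rho> in auto)
      then show ?thesis by (simp add: FS algebra_simps)
    qed
    have "(\<lambda>k. F (Suc k) t) \<longlonglongrightarrow> T f t"
      by (rule LIM_zero_cancel, rule Lim_null_comparison[OF _ z[of "\<rho> * \<omega> t"]])
        (use n in \<open>auto simp: norm_minus_commute\<close>)
    then show ?thesis using lim[of t] LIMSEQ_Suc LIMSEQ_unique by blast
  qed
  with Pf fb show ?thesis by (intro that[of f]) auto
qed

lemma abs_cont_01_lipschitz:
  assumes "\<And>s t. \<lbrakk>0 \<le> s; s \<le> t; t \<le> 1\<rbrakk> \<Longrightarrow> norm (p t - p s) \<le> C * (t - s)"
  shows "abs_cont_01 p"
  unfolding abs_cont_01_def
proof (intro allI impI)
  fix \<epsilon> :: real assume "\<epsilon> > 0"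
  define C' where "C' = \<bar>C\<bar> + 1"
  show "\<exists>\<delta>>0. \<forall>(N::nat) a b.
     (\<forall>k<N. 0 \<le> a k \<and> a k \<le> b k \<and> b k \<le> 1) \<and>
     (\<forall>i<N. \<forall>j<N. i \<noteq> j \<longrightarrow> b i \<le> a j \<or> b j \<le> a i) \<and>
     (\<Sum>k<N. b k - a k) < \<delta> \<longrightarrow> (\<Sum>k<N. norm (p (b k) - p (a k))) < \<epsilon>"
  proof (intro exI[of _ "\<epsilon> / C'"] conjI allI impI)
    show "\<epsilon> / C' > 0" using \<open>\<epsilon> > 0\<close> by (auto simp: C'_def)
    fix N :: nat and a b :: "nat \<Rightarrow> real"
    assume A: "(\<forall>k<N. 0 \<le> a k \<and> a k \<le> b k \<and> b k \<le> 1) \<and>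
       (\<forall>i<N. \<forall>j<N. i \<noteq> j \<longrightarrow> b i \<le> a j \<or> b j \<le> a i) \<and> (\<Sum>k<N. b k - a k) < \<epsilon> / C'"
    have "(\<Sum>k<N. norm (p (b k) - p (a k))) \<le> (\<Sum>k<N. C' * (b k - a k))"
    proof (rule sum_mono)
      fix k assume "k \<in> {..<N}"
      then have "norm (p (b k) - p (a k)) \<le> C * (b k - a k)" using A assms by auto
      also have "\<dots> \<le> C' * (b k - a k)" using A \<open>k \<in> _\<close> by (intro mult_right_mono) (auto simp: C'_def)
      finally show "norm (p (b k) - p (a k)) \<le> C' * (b k - a k)" .
    qed
    also have "\<dots> = C' * (\<Sum>k<N. b k - a k)" by (simp add: sum_distrib_left)
    also have "\<dots> < \<epsilon>" using A by (simp add: C'_def field_simps)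
    finally show "(\<Sum>k<N. norm (p (b k) - p (a k))) < \<epsilon>" .
  qed
qed

section \<open>Lebesgue differentiation\<close>

lemma set_integrable_bounded_lebesgue:
  fixes h :: "real \<Rightarrow> real"
  assumes [measurable]: "h \<in> borel_measurable lebesgue" and B: "\<And>x. \<bar>h x\<bar> \<le> B" and A: "A \<in> lmeasurable"
  shows "set_integrable lebesgue A h"
proof -
  have [measurable]: "A \<in> sets lebesgue" using A by auto
  have i: "integrable lebesgue (\<lambda>x. B * indicator A x)" using A by (auto simp: fmeasurable_def)
  show ?thesis unfolding set_integrable_def
    by (rule Bochner_Integration.integrable_bound[OF i])
      (use B in \<open>auto simp: indicator_def intro!: AE_I2 intro: order_trans[OF _ abs_ge_self]\<close>)
qed

text \<open>Cover the exceptional set by disjoint intervals on which the average exceeds \<open>b\<close>, inside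
  an open set only slightly larger than it; almost all of their union carries the values \<open>c < a\<close>.\<close>
lemma average_exceeds_null:
  fixes c :: "real \<Rightarrow> real"
  assumes cm[measurable]: "c \<in> borel_measurable lebesgue" and cB: "\<And>x. \<bar>c x\<bar> \<le> B" and ab: "a < b"
  defines "J \<equiv> \<lambda>s t. LINT x:{s..t}|lebesgue. c x"
  shows "{x\<in>{0<..<1}. c x < a \<and> (\<forall>n::nat. \<exists>s t. s < x \<and> x < t \<and> t - s < 1 / (real n + 1) \<and> b * (t - s) < J s t)}
           \<in> null_sets lebesgue"
proof -
  \<comment> \<open>Each \<open>O' n\<close> is a union of open intervals, hence open. This makes
    the exceptional set measurable although its description quantifies over uncountably many
    intervals.\<close>
  define O' where "O' n = \<Union>((\<lambda>(s,t). {s<..<t}) ` {(s,t). t - s < 1 / (real n + 1) \<and> b * (t - s) < J s t})" for n :: nat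
  define E where "E = {0<..<1} \<inter> {x. c x < a} \<inter> (\<Inter>n. O' n)"
  have Oeq: "x \<in> O' n \<longleftrightarrow> (\<exists>s t. s < x \<and> x < t \<and> t - s < 1 / (real n + 1) \<and> b * (t - s) < J s t)" for x n
    unfolding O'_def by auto
  have "open (O' n)" for n unfolding O'_def by (rule open_Union) auto
  then have Om: "O' n \<in> sets lebesgue" for n by (simp add: borel_open)
  have "{x. c x < a} \<in> sets lebesgue" using measurable_sets[OF cm, of "{..<a}"] by (simp add: vimage_def)
  with Om have Em[measurable]: "E \<in> sets lebesgue" unfolding E_def by (intro sets.Int sets.countable_INT) auto
  have "bounded E" by (rule bounded_subset[of "{0<..<1}"]) (auto simp: E_def)
  then have Efin: "E \<in> lmeasurable" using Em by (rule bounded_set_imp_lmeasurable)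
  define h where "h x = c x - b" for x
  have hm[measurable]: "h \<in> borel_measurable lebesgue" unfolding h_def by measurable
  have hB: "\<bar>h x\<bar> \<le> B + \<bar>b\<bar>" for x using cB[of x] by (auto simp: h_def)
  have B0: "0 \<le> B" using cB[of 0] by linarith
  have key: "(b - a) * measure lebesgue E \<le> (B + \<bar>b\<bar>) * \<delta>" if "\<delta> > 0" for \<delta>
  proof -
    obtain U where U: "open U" "E \<subseteq> U" "U - E \<in> lmeasurable" "emeasure lebesgue (U - E) < ennreal \<delta>"
      using sets_lebesgue_outer_open[OF Em \<open>\<delta> > 0\<close>] by metis
    have Ufin: "U \<in> lmeasurable" using fmeasurable_Diff_D[OF U(3) Efin U(2)] .
    have mUE: "measure lebesgue (U - E) \<le> \<delta>"
      using U(4) \<open>\<delta> > 0\<close> U(3) by (metis emeasure_eq_measure2 ennreal_less_iff less_eq_real_def measure_nonneg)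
    define K where "K = {(s,t). s < t \<and> {s..t} \<subseteq> U \<and> b * (t - s) < J s t}"
    define I where "I = (\<lambda>(s,t). {s..t::real})"
    define ce where "ce = (\<lambda>(s,t). (s + t) / 2 :: real)"
    define ra where "ra = (\<lambda>(s,t). (t - s) / 2 :: real)"
    have cb: "cball (ce i) (ra i) = I i" for i
      by (auto simp: I_def ce_def ra_def cball_eq_atLeastAtMost field_simps split: prod.splits)
    have "\<exists>i. i \<in> K \<and> x \<in> cball (ce i) (ra i) \<and> ra i < d" if x: "x \<in> E" and "0 < d" for x d
    proof -
      obtain \<rho> where \<rho>: "\<rho> > 0" "ball x \<rho> \<subseteq> U" using U x by (meson in_mono openE)
      have "0 < min \<rho> d" using \<rho> \<open>0 < d\<close> by auto
      then obtain n where n: "1 / (real n + 1) < min \<rho> d"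
        using nat_approx_posE by (metis Suc_eq_plus1 of_nat_Suc add.commute)
      have "x \<in> O' n" using x by (auto simp: E_def)
      then obtain s t where st: "s < x" "x < t" "t - s < 1 / (real n + 1)" "b * (t - s) < J s t"
        using Oeq by auto
      have "{s..t} \<subseteq> ball x \<rho>" using st n by (auto simp: dist_real_def)
      then have "(s,t) \<in> K" using st \<rho> by (auto simp: K_def)
      moreover have "x \<in> I (s,t)" "ra (s,t) < d" using st n by (auto simp: I_def ra_def)
      ultimately show ?thesis unfolding cb by blast
    qed
    moreover have "0 < ra i" if "i \<in> K" for i using that by (auto simp: K_def ra_def)
    ultimately obtain C where C: "countable C" "C \<subseteq> K" "pairwise (\<lambda>i j. disjnt (I i) (I j)) C"
       "negligible (E - (\<Union>i\<in>C. I i))"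
      using Vitali_covering_theorem_cballs[of K ra E ce] unfolding cb by metis
    define W where "W = (\<Union>i\<in>C. I i)"
    have Im: "I i \<in> sets lebesgue" for i by (auto simp: I_def split: prod.splits)
    have WU: "W \<subseteq> U" using C(2) by (auto simp: W_def K_def I_def)
    have Wm[measurable]: "W \<in> sets lebesgue" unfolding W_def using C(1) Im by blast
    have Wfin: "W \<in> lmeasurable" using Ufin WU Wm by (rule fmeasurableI2)
    have Wint: "set_integrable lebesgue W h" using set_integrable_bounded_lebesgue[OF hm hB Wfin] .
    \<comment> \<open>Finite subfamilies exhaust the countable family \<open>C\<close>: additivity
      is applied to them, and the integral over \<open>W\<close> is the limit.\<close>
    define A where "A n = (\<Union>i\<in>{i\<in>C. to_nat_on C i \<le> n}. I i)" for n
    have fin: "finite {i\<in>C. to_nat_on C i \<le> n}" for n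
      by (rule finite_imageD[of "to_nat_on C"])
        (auto intro: finite_subset[of _ "{..n}"] inj_on_subset[OF inj_on_to_nat_on[OF C(1)]])
    have posi: "0 \<le> (LINT x:I i|lebesgue. h x)" and inti: "set_integrable lebesgue (I i) h" if "i \<in> C" for i
    proof -
      obtain s t where i: "i = (s,t)" by force
      have st: "s < t" "b * (t - s) < J s t" using that C(2) i by (auto simp: K_def)
      have f: "{s..t} \<in> lmeasurable" by simp
      show "set_integrable lebesgue (I i) h"
        using set_integrable_bounded_lebesgue[OF hm hB f] by (simp add: i I_def)
      have "(LINT x:{s..t}|lebesgue. h x) = J s t - (LINT x:{s..t}|lebesgue. b)"
        unfolding h_def J_def
        by (intro set_integral_diff set_integrable_bounded_lebesgue[OF cm cB f] set_integrable_bounded_lebesgue[OF _ _ f, of _ "\<bar>b\<bar>"]) auto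
      also have "(LINT x:{s..t}|lebesgue. b) = b * (t - s)"
        using st by (simp add: set_lebesgue_integral_def mult.commute)
      finally show "0 \<le> (LINT x:I i|lebesgue. h x)" using st by (simp add: i I_def)
    qed
    have "0 \<le> (LINT x:A n|lebesgue. h x)" for n
    proof -
      have "(LINT x:A n|lebesgue. h x) = (\<Sum>i\<in>{i\<in>C. to_nat_on C i \<le> n}. LINT x:I i|lebesgue. h x)"
        unfolding A_def using fin inti Im C(3)
        by (intro set_integral_finite_Union) (auto simp: disjoint_family_on_def pairwise_def disjnt_def)
      also have "\<dots> \<ge> 0" using posi by (intro sum_nonneg) auto
      finally show ?thesis .
    qed
    moreover have "(\<lambda>n. LINT x:A n|lebesgue. h x) \<longlonglongrightarrow> (LINT x:(\<Union>n. A n)|lebesgue. h x)"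
    proof (rule set_integral_cont_up)
      show "A n \<in> sets lebesgue" for n unfolding A_def using fin Im by blast
      show "incseq A" by (auto simp: incseq_def A_def)
      show "set_integrable lebesgue (\<Union>n. A n) h"
        by (rule set_integrable_subset[OF Wint]) (auto simp: A_def W_def intro!: sets.countable_UN sets.finite_UN fin Im)
    qed
    moreover have "(\<Union>n. A n) = W" by (auto simp: A_def W_def)
    ultimately have pos: "0 \<le> (LINT x:W|lebesgue. h x)" using LIMSEQ_le_const by (metis (no_types, lifting))
    have i1: "integrable lebesgue (\<lambda>x. indicator (W \<inter> E) x :: real)"
      using fmeasurableI2[OF Efin, of "W \<inter> E"] by (auto simp: fmeasurable_def)
    have i2: "integrable lebesgue (\<lambda>x. indicator (U - E) x :: real)"
      using U(3) by (auto simp: fmeasurable_def)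
    \<comment> \<open>On E the integrand is below a - b, and on the rest of W, which lies in U - E,
      it is at most B + |b|. As the integral over W is nonnegative, (b - a) times the measure of E
      is at most (B + |b|) \<delta>.\<close>
    have "(LINT x:W|lebesgue. h x) \<le> (\<integral>x. (a - b) * indicator (W \<inter> E) x + (B + \<bar>b\<bar>) * indicator (U - E) x \<partial>lebesgue)"
      unfolding set_lebesgue_integral_def
    proof (rule integral_mono)
      show "integrable lebesgue (\<lambda>x. indicator W x *\<^sub>R h x)" using Wint by (simp add: set_integrable_def)
      show "integrable lebesgue (\<lambda>x. (a - b) * indicator (W \<inter> E) x + (B + \<bar>b\<bar>) * indicator (U - E) x)"
        using i1 i2 by simp
      show "indicator W x *\<^sub>R h x \<le> (a - b) * indicator (W \<inter> E) x + (B + \<bar>b\<bar>) * indicator (U - E) x" for x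
        using hB[of x] WU B0 by (auto simp: indicator_def h_def E_def)
    qed
    also have "\<dots> = (a - b) * measure lebesgue (W \<inter> E) + (B + \<bar>b\<bar>) * measure lebesgue (U - E)"
      using i1 i2 by simp
    also have "measure lebesgue (W \<inter> E) = measure lebesgue E"
    proof -
      have "E - W \<in> null_sets lebesgue" using C(4) by (simp add: negligible_iff_null_sets W_def)
      then have "measure lebesgue (E - (E - W)) = measure lebesgue E" using Em measure_Diff_null_set by blast
      moreover have "E - (E - W) = W \<inter> E" by auto
      ultimately show ?thesis by simp
    qed
    finally have "(b - a) * measure lebesgue E \<le> (B + \<bar>b\<bar>) * measure lebesgue (U - E)"
      using pos by (simp add: algebra_simps)
    also have "\<dots> \<le> (B + \<bar>b\<bar>) * \<delta>" using mUE B0 by (intro mult_left_mono) auto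
    finally show ?thesis .
  qed
  have "(b - a) * measure lebesgue E \<le> 0"
  proof (rule field_le_epsilon)
    fix e :: real assume "0 < e"
    have "(B + \<bar>b\<bar>) * (e / (B + \<bar>b\<bar> + 1)) \<le> e" using \<open>0 < e\<close> B0 by (simp add: field_simps)
    then show "(b - a) * measure lebesgue E \<le> 0 + e" using key[of "e / (B + \<bar>b\<bar> + 1)"] \<open>0 < e\<close> B0 by (simp add: add_nonneg_pos)
  qed
  then have "measure lebesgue E = 0" using ab by (metis diff_gt_0_iff_gt measure_nonneg mult_le_0_iff not_le order_antisym)
  then have "E \<in> null_sets lebesgue" using Efin negligible_iff_measure negligible_iff_null_sets by blast
  moreover have "{x\<in>{0<..<1}. c x < a \<and> (\<forall>n::nat. \<exists>s t. s < x \<and> x < t \<and> t - s < 1 / (real n + 1) \<and> b * (t - s) < J s t)} = E"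
    unfolding E_def by (intro set_eqI) (simp add: Oeq)
  ultimately show ?thesis by simp
qed

text \<open>If averages over intervals shrinking to x stayed above c x by a fixed amount, a rational
  pair a < b would fit in between; the null sets for all rational pairs therefore contain every
  failure. Applying this to c and to - c bounds the difference quotients from both sides.\<close>

lemma lebesgue_differentiation_real:
  fixes c :: "real \<Rightarrow> real"
  assumes cm[measurable]: "c \<in> borel_measurable lebesgue" and cB: "\<And>x. \<bar>c x\<bar> \<le> B"
  shows "AE x in lebesgue. x \<in> {0<..<1} \<longrightarrow>
           ((\<lambda>y. LINT s:{0..y}|lebesgue. c s) has_real_derivative c x) (at x)"
proof -
  define J where "J d s t = (LINT x:{s..t}|lebesgue. d x)" for d :: "real \<Rightarrow> real" and s t
  define E where "E d a b = {x\<in>{0<..<1}. d x < a \<and> (\<forall>n::nat. \<exists>s t. s < x \<and> x < t \<and> t - s < 1 / (real n + 1) \<and> b * (t - s) < J d s t)}"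
    for d :: "real \<Rightarrow> real" and a b
  have null: "AE x in lebesgue. \<forall>a b::rat. a < b \<longrightarrow> x \<notin> E d (of_rat a) (of_rat b)"
    if "d \<in> borel_measurable lebesgue" "\<And>x. \<bar>d x\<bar> \<le> B" for d :: "real \<Rightarrow> real"
    unfolding AE_all_countable
  proof (intro allI AE_impI)
    fix a b :: rat assume "a < b"
    then show "AE x in lebesgue. x \<notin> E d (of_rat a) (of_rat b)"
      using average_exceeds_null[OF that, of "of_rat a" "of_rat b"] unfolding E_def J_def
      by (intro AE_not_in) (auto simp: of_rat_less)
  qed
  have si: "set_integrable lebesgue {s..t} d" if "d \<in> borel_measurable lebesgue" "\<And>x. \<bar>d x\<bar> \<le> B" for d :: "real \<Rightarrow> real" and s t
    using set_integrable_bounded_lebesgue[OF that] by simp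
  have Jadd: "J d r t = J d r s + J d s t" if "d \<in> borel_measurable lebesgue" "\<And>x. \<bar>d x\<bar> \<le> B" "r \<le> s" "s \<le> t" for d :: "real \<Rightarrow> real" and r s t
  proof -
    have "{r..t} = {r..s} \<union> {s..t}" using that by auto
    moreover have "AE x in lebesgue. \<not> (x \<in> {r..s} \<and> x \<in> {s..t})"
    proof -
      have "AE x in lebesgue. x \<notin> {s}" by (intro AE_not_in) auto
      then show ?thesis by eventually_elim auto
    qed
    ultimately show ?thesis unfolding J_def using si[OF that(1,2)]
      by (simp add: set_integral_Un_AE)
  qed
  have Jb: "\<bar>J d s t\<bar> \<le> B * (t - s)" if "d \<in> borel_measurable lebesgue" "\<And>x. \<bar>d x\<bar> \<le> B" "s \<le> t" for d :: "real \<Rightarrow> real" and s t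
  proof -
    have "\<bar>J d s t\<bar> \<le> (LINT x:{s..t}|lebesgue. \<bar>d x\<bar>)"
      unfolding J_def set_lebesgue_integral_def using integral_norm_bound[of lebesgue "\<lambda>x. indicator {s..t} x *\<^sub>R d x"]
      by (simp add: abs_mult)
    also have "\<dots> \<le> (LINT x:{s..t}|lebesgue. B)"
      using that by (intro set_integral_mono set_integrable_bounded_lebesgue[of _ B]) (auto intro: order_trans[OF abs_ge_zero])
    also have "\<dots> = B * (t - s)" using that by (simp add: set_lebesgue_integral_def mult.commute)
    finally show ?thesis .
  qed
  have up: "\<exists>\<delta>>0. \<forall>s t. s \<le> x \<and> x \<le> t \<and> t - s < \<delta> \<longrightarrow> J d s t \<le> (d x + e) * (t - s)"
    if d: "d \<in> borel_measurable lebesgue" "\<And>x. \<bar>d x\<bar> \<le> B" and x: "x \<in> {0<..<1}"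
      and n: "\<forall>a b::rat. a < b \<longrightarrow> x \<notin> E d (of_rat a) (of_rat b)" and e: "e > 0" for d :: "real \<Rightarrow> real" and x e
  proof -
    obtain b where b: "d x < of_rat b" "of_rat b < d x + e" using of_rat_dense[of "d x" "d x + e"] e by auto
    obtain a where a: "d x < of_rat a" "of_rat a < (of_rat b :: real)" using of_rat_dense b by blast
    then have "x \<notin> E d (of_rat a) (of_rat b)" using n by (simp add: of_rat_less)
    then have "\<not> (\<forall>n::nat. \<exists>s t. s < x \<and> x < t \<and> t - s < 1 / (real n + 1) \<and> of_rat b * (t - s) < J d s t)"
      using x a unfolding E_def by simp
    then obtain n :: nat where n: "\<And>s t. s < x \<Longrightarrow> x < t \<Longrightarrow> t - s < 1 / (real n + 1) \<Longrightarrow> J d s t \<le> of_rat b * (t - s)"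
      by (meson not_le)
    define \<beta> :: real where "\<beta> = of_rat b"
    note n = n[folded \<beta>_def] and b = b[folded \<beta>_def]
    show ?thesis
    proof (intro exI[of _ "1 / (real n + 1)"] conjI allI impI)
      fix s t assume st: "s \<le> x \<and> x \<le> t \<and> t - s < 1 / (real n + 1)"
      have "J d s t \<le> \<beta> * (t - s)"
      proof (rule field_le_epsilon)
        fix \<epsilon> :: real assume "0 < \<epsilon>"
        \<comment> \<open>The estimate \<open>n\<close> has x strictly inside the interval, whereas
          difference quotients have x as an endpoint. Widening by \<eta> on both sides costs at most
          2 \<eta> (|\<beta>| + B); \<eta> keeps this below \<epsilon> and the widened length below
          1 / (n + 1).\<close>
        define \<eta> where "\<eta> = min (\<epsilon> / (2 * (\<bar>\<beta>\<bar> + B + 1))) ((1 / (real n + 1) - (t - s)) / 4)"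
        have B0: "B \<ge> 0" using d(2)[of 0] by linarith
        then have bp: "0 < 2 * (\<bar>\<beta>\<bar> + B + 1)"
          by (intro mult_pos_pos add_nonneg_pos add_nonneg_nonneg) auto
        then have "0 < \<epsilon> / (2 * (\<bar>\<beta>\<bar> + B + 1))" using \<open>0 < \<epsilon>\<close> by (rule divide_pos_pos[rotated])
        moreover have "0 < (1 / (real n + 1) - (t - s)) / 4" using st by simp
        ultimately have \<eta>: "\<eta> > 0" unfolding \<eta>_def min_less_iff_conj by blast
        have \<eta>2: "\<eta> * (2 * (\<bar>\<beta>\<bar> + B + 1)) \<le> \<epsilon>"
        proof -
          have "\<eta> \<le> \<epsilon> / (2 * (\<bar>\<beta>\<bar> + B + 1))" by (simp add: \<eta>_def)
          then show ?thesis by (simp only: pos_le_divide_eq[OF bp])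
        qed
        have \<eta>4: "4 * \<eta> \<le> 1 / (real n + 1) - (t - s)"
proof -
          have "\<eta> \<le> (1 / (real n + 1) - (t - s)) / 4" unfolding \<eta>_def by (rule min.cobounded2)
          from mult_left_mono[OF this, of 4] show ?thesis by simp
        qed
        have lt: "(t + \<eta>) - (s - \<eta>) < 1 / (real n + 1)"
          using \<eta> \<eta>4 st by linarith
        have "J d (s - \<eta>) (t + \<eta>) = J d (s - \<eta>) s + (J d s t + J d t (t + \<eta>))"
          using Jadd[OF d, of "s - \<eta>" s "t + \<eta>"] Jadd[OF d, of s t "t + \<eta>"] st \<eta> by simp
        then have "J d s t \<le> J d (s - \<eta>) (t + \<eta>) + B * \<eta> + B * \<eta>"
          using Jb[OF d, of "s - \<eta>" s] Jb[OF d, of t "t + \<eta>"] \<eta> by auto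
        also have "J d (s - \<eta>) (t + \<eta>) \<le> \<beta> * ((t + \<eta>) - (s - \<eta>))"
          using lt st \<eta> by (intro n) auto
        also have "\<dots> = \<beta> * (t - s) + \<beta> * (2 * \<eta>)" by (simp add: algebra_simps)
        also have "\<beta> * (2 * \<eta>) \<le> \<bar>\<beta>\<bar> * (2 * \<eta>)" using \<eta> by (intro mult_right_mono) auto
        finally have "J d s t \<le> \<beta> * (t - s) + (\<eta> * (2 * (\<bar>\<beta>\<bar> + B + 1)) - 2 * \<eta>)" by (simp add: algebra_simps)
        then show "J d s t \<le> \<beta> * (t - s) + \<epsilon>" using \<eta>2 \<eta> by linarith
      qed
      also have "\<dots> \<le> (d x + e) * (t - s)" using b st by (intro mult_right_mono) auto
      finally show "J d s t \<le> (d x + e) * (t - s)" .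
    qed auto
  qed
  have Jneg: "J (\<lambda>x. - c x) s t = - J c s t" for s t
    using si[OF cm cB] by (simp add: J_def set_integral_uminus)
  have n1: "(\<lambda>x. - c x) \<in> borel_measurable lebesgue" "\<And>x. \<bar>- c x\<bar> \<le> B" using cm cB by auto
  show ?thesis using null[OF cm cB] null[OF n1]
  proof eventually_elim
    case (elim x)
    show ?case
    proof
      assume x: "x \<in> {0<..<1}"
      show "((\<lambda>y. LINT s:{0..y}|lebesgue. c s) has_real_derivative c x) (at x)"
        unfolding has_field_derivative_def has_derivative_at_alt
      proof (intro conjI allI impI)
        show "bounded_linear ((*) (c x))" by (rule bounded_linear_mult_right)
        fix e :: real assume e: "0 < e"
        obtain d1 where d1: "d1 > 0" "\<And>s t. s \<le> x \<and> x \<le> t \<and> t - s < d1 \<Longrightarrow> J c s t \<le> (c x + e) * (t - s)"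
          using up[OF cm cB x elim(1) e] by blast
        obtain d2 where d2: "d2 > 0" "\<And>s t. s \<le> x \<and> x \<le> t \<and> t - s < d2 \<Longrightarrow> J c s t \<ge> (c x - e) * (t - s)"
          using up[OF n1 x elim(2) e] by (auto simp: Jneg algebra_simps)
        show "\<exists>d>0. \<forall>y. norm (y - x) < d \<longrightarrow>
           norm ((LINT s:{0..y}|lebesgue. c s) - (LINT s:{0..x}|lebesgue. c s) - c x * (y - x)) \<le> e * norm (y - x)"
        proof (intro exI[of _ "min (min d1 d2) x"] conjI allI impI)
          fix y assume y: "norm (y - x) < min (min d1 d2) x"
          show "norm ((LINT s:{0..y}|lebesgue. c s) - (LINT s:{0..x}|lebesgue. c s) - c x * (y - x)) \<le> e * norm (y - x)"
          proof (cases "x \<le> y")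
            case True
            have "J c 0 y - J c 0 x = J c x y" using Jadd[OF cm cB, of 0 x y] x True by auto
            then show ?thesis using d1(2)[of x y] d2(2)[of x y] y True unfolding J_def[symmetric]
              by (auto simp: abs_le_iff algebra_simps)
          next
            case False
            then have "J c 0 x - J c 0 y = J c y x" using Jadd[OF cm cB, of 0 y x] x y by auto
            then show ?thesis using d1(2)[of y x] d2(2)[of y x] y False unfolding J_def[symmetric]
              by (auto simp: abs_le_iff algebra_simps)
          qed
        qed (use d1 d2 x in auto)
      qed
    qed
  qed
qed

text \<open>Lebesgue differentiation, coordinate by coordinate, for \<open>c\<close> extended by
  zero. It turns the adjoint equation from its integral form into its differential form; the minus
  sign stems from the variable lower limit.\<close>

lemma has_vector_derivative_tail_integral_I01:
  fixes c :: "real \<Rightarrow> 'a::euclidean_space"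
  assumes cm: "c \<in> borel_measurable I01" and cB: "\<And>t. t \<in> {0..1} \<Longrightarrow> norm (c t) \<le> B"
  shows "AE t in I01. ((\<lambda>t. \<integral>s. indicator {t..1} s *\<^sub>R c s \<partial>I01) has_vector_derivative - c t) (at t)"
proof -
  define p where "p t = (\<integral>s. indicator {t..1} s *\<^sub>R c s \<partial>I01)" for t
  define d where "d i x = (if x \<in> {0..1} then c x \<bullet> i else 0)" for i x
  have ic: "integrable I01 c" using cm cB by (intro integrable_I01_bounded[of _ B]) auto
  have dm: "d i \<in> borel_measurable lebesgue" for i
    unfolding d_def by (subst borel_measurable_if) (use cm in auto)
  have dB: "\<bar>d i x\<bar> \<le> \<bar>B\<bar>" if "i \<in> Basis" for i x
    using cB[of x] Basis_le_norm[OF that, of "c x"] by (auto simp: d_def)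
  have p: "p t \<bullet> i = (LINT s:{0..1}|lebesgue. d i s) - (LINT s:{0..t}|lebesgue. d i s)"
    if "t \<in> {0<..<1}" "i \<in> Basis" for t i
  proof -
    have ii: "set_integrable lebesgue {a..b} (d i)" for a b
      using set_integrable_bounded_lebesgue[OF dm dB[OF that(2)]] by simp
    have "p t \<bullet> i = (\<integral>s. (indicator {t..1} s *\<^sub>R c s) \<bullet> i \<partial>I01)"
      unfolding p_def by (rule integral_inner_left[symmetric]) (rule integrable_I01_interval[OF ic])
    also have "\<dots> = (LINT s:{t..1}|lebesgue. d i s)"
      unfolding set_lebesgue_integral_def
      by (subst integral_restrict_space)
        (use that in \<open>auto simp: d_def indicator_def intro!: Bochner_Integration.integral_cong\<close>)
    also have "(LINT s:{0..1}|lebesgue. d i s) = (LINT s:{0..t}|lebesgue. d i s) + (LINT s:{t..1}|lebesgue. d i s)"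
    proof -
      have "{0..1} = {0..t} \<union> {t..1}" using that by auto
      moreover have "AE x in lebesgue. \<not> (x \<in> {0..t} \<and> x \<in> {t..1})"
      proof -
        have "AE x in lebesgue. x \<notin> {t}" by (intro AE_not_in) auto
        then show ?thesis by eventually_elim auto
      qed
      ultimately show ?thesis using ii by (simp add: set_integral_Un_AE)
    qed
    ultimately show ?thesis by simp
  qed
  have "AE x in lebesgue. \<forall>i\<in>Basis. x \<in> {0<..<1} \<longrightarrow>
      ((\<lambda>y. LINT s:{0..y}|lebesgue. d i s) has_real_derivative d i x) (at x)"
    using lebesgue_differentiation_real[OF dm dB] by (intro AE_finite_allI) auto
  moreover have "AE x in lebesgue. x \<notin> {0,1::real}" by (intro AE_not_in) auto
  ultimately have "AE x in lebesgue. x \<in> {0..1} \<longrightarrow> (p has_vector_derivative - c x) (at x)"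
  proof eventually_elim
    case (elim x)
    show ?case
    proof
      assume "x \<in> {0..1}"
      then have x: "x \<in> {0<..<1}" using elim(2) by auto
      have "((\<lambda>t. p t \<bullet> i) has_derivative (\<lambda>h. (h *\<^sub>R - c x) \<bullet> i)) (at x)" if i: "i \<in> Basis" for i
      proof -
        have "((\<lambda>t. (LINT s:{0..1}|lebesgue. d i s) - (LINT s:{0..t}|lebesgue. d i s)) has_real_derivative - d i x) (at x)"
          using elim(1) x i by (auto intro!: derivative_eq_intros)
        then have "((\<lambda>t. p t \<bullet> i) has_real_derivative - d i x) (at x)"
          by (rule has_field_derivative_transform_within_open[where S="{0<..<1}"]) (use x p i in auto)
        moreover have "(\<lambda>h. (h *\<^sub>R - c x) \<bullet> i) = (*) (- d i x)" using x by (auto simp: d_def)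
        ultimately show ?thesis by (simp add: has_field_derivative_def)
      qed
      then show "(p has_vector_derivative - c x) (at x)"
        unfolding has_vector_derivative_def by (subst has_derivative_componentwise_within) auto
    qed
  qed
  then show ?thesis unfolding p_def by (subst AE_restrict_space_iff) auto
qed

section \<open>Integral equations and Taylor estimates\<close>

lemma initial_integral_lipschitz:
  fixes h :: "real \<Rightarrow> 'a::euclidean_space"
  assumes h: "h \<in> borel_measurable I01" "AE t in I01. norm (h t) \<le> C" and st: "0 \<le> s" "s \<le> t" "t \<le> 1"
  shows "norm ((\<integral>r. indicator {0..t} r *\<^sub>R h r \<partial>I01) - (\<integral>r. indicator {0..s} r *\<^sub>R h r \<partial>I01)) \<le> C * (t - s)"
    and "norm ((\<integral>r. indicator {t..1} r *\<^sub>R h r \<partial>I01) - (\<integral>r. indicator {s..1} r *\<^sub>R h r \<partial>I01)) \<le> C * (t - s)"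
proof -
  have ih: "integrable I01 h" using h by (rule integrable_I01_bounded)
  note ii = integrable_I01_interval[OF ih]
  have I: "(\<integral>r. indicator {s..t} r *\<^sub>R C \<partial>I01) = C * t - C * s" "integrable I01 (\<lambda>r. indicator {s..t} r *\<^sub>R C)"
    using integral_interval_I01[of s t "\<lambda>x. C * x" "\<lambda>_. C"] st by (auto intro!: derivative_eq_intros)
  have gen: "norm (integral\<^sup>L I01 u - integral\<^sup>L I01 v) \<le> C * (t - s)"
    if "integrable I01 u" "integrable I01 v" "\<And>r. norm (h r) \<le> C \<Longrightarrow> norm (u r - v r) \<le> indicator {s..t} r *\<^sub>R C" for u v :: "real \<Rightarrow> 'a"
  proof -
    have "norm (integral\<^sup>L I01 u - integral\<^sup>L I01 v) = norm (\<integral>r. u r - v r \<partial>I01)" using that by simp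
    also have "\<dots> \<le> (\<integral>r. norm (u r - v r) \<partial>I01)" by (rule integral_norm_bound)
    also have "\<dots> \<le> (\<integral>r. indicator {s..t} r *\<^sub>R C \<partial>I01)"
      using that h(2) by (intro integral_mono_AE I integrable_norm Bochner_Integration.integrable_diff) auto
    also note I(1)
    finally show ?thesis by (simp add: algebra_simps)
  qed
  show "norm ((\<integral>r. indicator {0..t} r *\<^sub>R h r \<partial>I01) - (\<integral>r. indicator {0..s} r *\<^sub>R h r \<partial>I01)) \<le> C * (t - s)"
    by (rule gen[OF ii ii]) (use st in \<open>auto simp: indicator_def intro: order_trans[OF norm_ge_zero]\<close>)
  show "norm ((\<integral>r. indicator {t..1} r *\<^sub>R h r \<partial>I01) - (\<integral>r. indicator {s..1} r *\<^sub>R h r \<partial>I01)) \<le> C * (t - s)"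
    by (rule gen[OF ii ii]) (use st in \<open>auto simp: indicator_def intro: order_trans[OF norm_ge_zero]\<close>)
qed

lemma continuous_on_lipschitz_01:
  fixes f :: "real \<Rightarrow> 'a::real_normed_vector"
  assumes "\<And>s t. \<lbrakk>0 \<le> s; s \<le> t; t \<le> 1\<rbrakk> \<Longrightarrow> norm (f t - f s) \<le> C * (t - s)"
  shows "continuous_on {0..1} f"
proof (rule continuous_on_iff[THEN iffD2], intro ballI allI impI)
  fix x e :: real assume x: "x \<in> {0..1}" and e: "0 < e"
  show "\<exists>d>0. \<forall>x'\<in>{0..1}. dist x' x < d \<longrightarrow> dist (f x') (f x) < e"
  proof (intro exI[of _ "e / (\<bar>C\<bar> + 1)"] conjI ballI impI)
    show "0 < e / (\<bar>C\<bar> + 1)" using e by (simp add: add_nonneg_pos)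
    fix y assume y: "y \<in> {0..1}" "dist y x < e / (\<bar>C\<bar> + 1)"
    have "norm (f y - f x) \<le> C * \<bar>y - x\<bar>"
      using assms[of x y] assms[of y x] x y by (cases "x \<le> y") (auto simp: norm_minus_commute)
    also have "\<dots> \<le> (\<bar>C\<bar> + 1) * \<bar>y - x\<bar>" by (intro mult_right_mono) auto
    also have "\<dots> < e" using y by (simp add: dist_real_def field_simps add_pos_nonneg)
    finally show "dist (f y) (f x) < e" by (simp add: dist_norm)
  qed
qed

lemma continuous_on_measurable_I01:
  fixes f :: "real \<Rightarrow> 'a::euclidean_space"
  shows "continuous_on {0..1} f \<Longrightarrow> f \<in> borel_measurable I01"
  by (rule continuous_imp_measurable_on_sets_lebesgue) auto

lemma initial_integral_measurable:
  fixes h :: "real \<Rightarrow> 'a::euclidean_space"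
  assumes h: "h \<in> borel_measurable I01" "AE t in I01. norm (h t) \<le> C"
  shows "continuous_on {0..1} (\<lambda>t. \<integral>r. indicator {0..t} r *\<^sub>R h r \<partial>I01)"
    "(\<lambda>t. \<integral>r. indicator {0..t} r *\<^sub>R h r \<partial>I01) \<in> borel_measurable I01"
    "(\<lambda>t. \<integral>r. indicator {t..1} r *\<^sub>R h r \<partial>I01) \<in> borel_measurable I01"
  using continuous_on_lipschitz_01[OF initial_integral_lipschitz(1)[OF h]]
    continuous_on_lipschitz_01[OF initial_integral_lipschitz(2)[OF h]] by (auto intro: continuous_on_measurable_I01)

text \<open>Picard iteration backwards from t = 1. Under the weight
  \<open>exp (2 * K * (1 - t))\<close> an operator with Lipschitz constant K contracts with factor K
  / (2 K) = 1/2.\<close>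

lemma backward_integral_equation:
  fixes F :: "real \<Rightarrow> 'a::euclidean_space \<Rightarrow> 'a"
  assumes meas: "\<And>p. p \<in> borel_measurable I01 \<Longrightarrow> (\<lambda>t. F t (p t)) \<in> borel_measurable I01"
    and lip: "\<And>t p q. t \<in> {0..1} \<Longrightarrow> norm (F t p - F t q) \<le> K * norm (p - q)"
    and F0: "\<And>t. t \<in> {0..1} \<Longrightarrow> norm (F t 0) \<le> B" and K: "K > 0"
  obtains p C where "p \<in> borel_measurable I01" "\<And>t. norm (p t) \<le> C"
    "\<And>t. t \<in> {0..1} \<Longrightarrow> p t = (\<integral>s. indicator {t..1} s *\<^sub>R F s (p s) \<partial>I01)"
proof -
  have B: "B \<ge> 0" using F0[of 0] by (auto intro: order_trans[OF norm_ge_zero])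
  \<comment> \<open>Weight and operator vanish off [0,1], so the bounds required at every real t
    hold trivially there.\<close>
  define \<omega> where "\<omega> t = (if t \<in> {0..1} then exp (2 * K * (1 - t)) else 0)" for t
  define T where "T p t = (if t \<in> {0..1} then \<integral>s. indicator {t..1} s *\<^sub>R F s (p s) \<partial>I01 else 0)" for p t
  have \<omega>: "0 \<le> \<omega> t" "\<omega> t \<le> exp (2 * K)" for t using K by (auto simp: \<omega>_def mult_left_le)
  have Fb: "norm (F t (p t)) \<le> B + K * (2 * B * exp (2 * K))"
    if "\<And>t. norm (p t) \<le> 2 * B * \<omega> t" "t \<in> {0..1}" for p t
  proof -
    have "norm (F t (p t)) \<le> norm (F t 0) + norm (F t (p t) - F t 0)" by (rule norm_triangle_sub)
    also have "\<dots> \<le> B + K * norm (p t)" using F0[OF that(2)] lip[OF that(2), of "p t" 0] by simp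
    also have "norm (p t) \<le> 2 * B * exp (2 * K)" using that(1)[of t] \<omega>(2)[of t] B
      by (meson mult_left_mono order_trans mult_nonneg_nonneg zero_le_numeral)
    finally show ?thesis using K by simp
  qed
  obtain p where p: "p \<in> borel_measurable I01" "\<And>t. norm (p t) \<le> 2 * B * \<omega> t" "T p = p"
  proof (rule weighted_contraction_fixpoint[of "\<lambda>p. p \<in> borel_measurable I01" B \<omega> T])
    show "T p \<in> borel_measurable I01" if "p \<in> borel_measurable I01" "\<And>t. norm (p t) \<le> 2 * B * \<omega> t" for p
    proof -
      have "(\<lambda>t. \<integral>s. indicator {t..1} s *\<^sub>R F s (p s) \<partial>I01) \<in> borel_measurable I01"
        using meas[OF that(1)] Fb[OF that(2)] by (intro initial_integral_measurable(3)[where C="B + K * (2 * B * exp (2 * K))"]) auto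
      then show ?thesis by (subst measurable_lebesgue_cong[where g="\<lambda>t. \<integral>s. indicator {t..1} s *\<^sub>R F s (p s) \<partial>I01"]) (auto simp: T_def)
    qed
    show "f \<in> borel_measurable I01" if "\<And>k::nat. U k \<in> borel_measurable I01" "\<And>t. (\<lambda>k. U k t) \<longlonglongrightarrow> f t" for U and f :: "real \<Rightarrow> 'a"
      using borel_measurable_LIMSEQ_metric[of U I01 f] that by auto
    show "norm (T f t - T h t) \<le> c / 2 * \<omega> t"
      if f: "f \<in> borel_measurable I01" and h: "h \<in> borel_measurable I01"
        and fb: "\<And>t. norm (f t) \<le> 2 * B * \<omega> t" and hb: "\<And>t. norm (h t) \<le> 2 * B * \<omega> t" and "0 \<le> c"
        and d: "\<And>t. norm (f t - h t) \<le> c * \<omega> t" for f h c t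
    proof (cases "t \<in> {0..1}")
      case True
      have ii: "integrable I01 (\<lambda>s. F s (f s))" "integrable I01 (\<lambda>s. F s (h s))"
        using integrable_I01_bounded[OF meas[OF f]] integrable_I01_bounded[OF meas[OF h]] Fb[OF fb] Fb[OF hb]
        by (metis (no_types, lifting) AE_I2 space_lebesgue_on)+
      have "T f t - T h t = (\<integral>s. indicator {t..1} s *\<^sub>R (F s (f s) - F s (h s)) \<partial>I01)"
        using True integrable_I01_interval[OF ii(1)] integrable_I01_interval[OF ii(2)]
        by (simp add: T_def scaleR_diff_right)
      also have "norm \<dots> \<le> (K * c) / (2 * K) * exp (2 * K * (1 - t))"
      proof (rule integral_exp_bound_backward)
        fix s :: real assume s: "s \<in> {0..1}"
        have "norm (F s (f s) - F s (h s)) \<le> K * norm (f s - h s)" using lip[OF s] .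
        also have "\<dots> \<le> K * (c * \<omega> s)" using d K by (intro mult_left_mono) auto
        finally show "norm (F s (f s) - F s (h s)) \<le> (K * c) * exp (2 * K * (1 - s))" using s by (simp add: \<omega>_def)
      qed (use True K \<open>0 \<le> c\<close> in auto)
      finally show ?thesis using True K by (simp add: \<omega>_def)
    qed (auto simp: T_def \<omega>_def)
    show "norm (T (\<lambda>t. 0) t) \<le> B * \<omega> t" for t
    proof (cases "t \<in> {0..1}")
      case True
      have "norm (T (\<lambda>t. 0) t) \<le> B"
        unfolding T_def using True F0 B by (auto simp: indicator_def intro!: integral_I01_norm_le)
      also have "\<dots> \<le> B * \<omega> t" using B True K by (simp add: \<omega>_def mult_le_cancel_left1)
      finally show ?thesis .
    qed (auto simp: T_def \<omega>_def)
  qed (use \<omega> B in auto)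
  show ?thesis
  proof (rule that[OF p(1)])
    show "norm (p t) \<le> 2 * B * exp (2 * K)" for t
      using p(2)[of t] \<omega>(2)[of t] B by (meson mult_left_mono order_trans mult_nonneg_nonneg zero_le_numeral)
    show "p t = (\<integral>s. indicator {t..1} s *\<^sub>R F s (p s) \<partial>I01)" if "t \<in> {0..1}" for t
      using fun_cong[OF p(3), of t] that by (simp add: T_def)
  qed
qed

section \<open>Measurability of derivatives and Taylor estimates on a ball\<close>

lemma directional_derivative_LIMSEQ:
  fixes F :: "'a::real_normed_vector \<Rightarrow> 'b::real_normed_vector"
  assumes "(F has_derivative F') (at z)"
  shows "(\<lambda>n. real (Suc n) *\<^sub>R (F (z + (1 / real (Suc n)) *\<^sub>R d) - F z)) \<longlonglongrightarrow> F' d"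
proof -
  have lin: "linear F'" using assms has_derivative_linear by blast
  have "((\<lambda>h. z + h *\<^sub>R d) has_derivative (\<lambda>h. h *\<^sub>R d)) (at 0)" by (auto intro!: derivative_eq_intros)
  then have "((\<lambda>h. F (z + h *\<^sub>R d)) has_derivative (\<lambda>h. F' (h *\<^sub>R d))) (at 0)"
    using has_derivative_compose[of "\<lambda>h. z + h *\<^sub>R d" "\<lambda>h. h *\<^sub>R d" 0 UNIV F F'] assms by simp
  then have "(\<lambda>h. norm (F (z + h *\<^sub>R d) - F z - F' (h *\<^sub>R d)) / norm h) \<midarrow>0\<rightarrow> 0"
    by (simp add: has_derivative_at)
  moreover have "filterlim (\<lambda>n. 1 / real (Suc n)) (at 0) sequentially"
    using LIMSEQ_inverse_real_of_nat by (auto simp: filterlim_at inverse_eq_divide)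
  ultimately have "(\<lambda>n. norm (F (z + (1 / real (Suc n)) *\<^sub>R d) - F z - F' ((1 / real (Suc n)) *\<^sub>R d)) / norm (1 / real (Suc n))) \<longlonglongrightarrow> 0"
    by (rule filterlim_compose)
  moreover have "norm (F (z + (1 / real (Suc n)) *\<^sub>R d) - F z - F' ((1 / real (Suc n)) *\<^sub>R d)) / norm (1 / real (Suc n))
     = norm (real (Suc n) *\<^sub>R (F (z + (1 / real (Suc n)) *\<^sub>R d) - F z) - F' d)" for n
  proof -
    have "real (Suc n) *\<^sub>R (F (z + (1 / real (Suc n)) *\<^sub>R d) - F z) - F' d
       = real (Suc n) *\<^sub>R (F (z + (1 / real (Suc n)) *\<^sub>R d) - F z - F' ((1 / real (Suc n)) *\<^sub>R d))"
      using linear_scale[OF lin] by (simp add: scaleR_diff_right del: of_nat_Suc)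
    then show ?thesis by (simp del: of_nat_Suc)
  qed
  ultimately have "(\<lambda>n. norm (real (Suc n) *\<^sub>R (F (z + (1 / real (Suc n)) *\<^sub>R d) - F z) - F' d)) \<longlonglongrightarrow> 0" by simp
  then show ?thesis using LIM_zero_cancel tendsto_norm_zero_iff by blast
qed

text \<open>\<open>G\<close> is a set of full measure on which the almost-everywhere hypotheses hold
  pointwise, so later estimates carry no exceptional sets. A single \<open>B\<close> bounds the
  values and both derivatives and serves as Lipschitz constant on the ball of radius
  \<open>M\<close>. Measurability in t is assumed of \<open>f\<close> alone; that of the derivatives
  is derived.\<close>

locale smooth_family =
  fixes G :: "real set" and M B :: real
    and f :: "real \<Rightarrow> 'z::euclidean_space \<Rightarrow> 'b::euclidean_space"
    and Df :: "real \<Rightarrow> 'z \<Rightarrow> 'z \<Rightarrow>\<^sub>L 'b" and D2f :: "real \<Rightarrow> 'z \<Rightarrow> 'z \<Rightarrow>\<^sub>L ('z \<Rightarrow>\<^sub>L 'b)"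
  assumes G_sets: "G \<in> sets I01" and G_AE: "AE t in I01. t \<in> G"
    and f_meas: "\<And>z. (\<lambda>t. f t z) \<in> borel_measurable I01"
    and D1: "\<And>t z. t \<in> G \<Longrightarrow> (f t has_derivative blinfun_apply (Df t z)) (at z)"
    and D2: "\<And>t z. t \<in> G \<Longrightarrow> (Df t has_derivative blinfun_apply (D2f t z)) (at z)"
    and bound: "\<And>t z. \<lbrakk>t \<in> G; norm z \<le> M\<rbrakk> \<Longrightarrow> norm (f t z) \<le> B"
      "\<And>t z. \<lbrakk>t \<in> G; norm z \<le> M\<rbrakk> \<Longrightarrow> norm (Df t z) \<le> B"
      "\<And>t z. \<lbrakk>t \<in> G; norm z \<le> M\<rbrakk> \<Longrightarrow> norm (D2f t z) \<le> B"
    and D_lip: "\<And>t z z'. \<lbrakk>t \<in> G; norm z \<le> M; norm z' \<le> M\<rbrakk> \<Longrightarrow> norm (Df t z - Df t z') \<le> B * norm (z - z')"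
    and D2_lip: "\<And>t z z'. \<lbrakk>t \<in> G; norm z \<le> M; norm z' \<le> M\<rbrakk> \<Longrightarrow> norm (D2f t z - D2f t z') \<le> B * norm (z - z')"
begin

lemma comp_measurable:
  assumes "z \<in> borel_measurable I01"
  shows "(\<lambda>t. f t (z t)) \<in> borel_measurable I01"
proof (rule caratheodory_measurable[OF f_meas _ assms])
  show "AE t in I01. continuous_on UNIV (f t)"
    using G_AE by eventually_elim
      (use D1 in \<open>auto simp: continuous_on_eq_continuous_at intro: has_derivative_continuous\<close>)
qed

text \<open>A directional derivative is the limit of difference quotients along the sequence 1 / (n
  + 1), so measurability in t passes from \<open>f\<close> to \<open>Df\<close>, and in the same way
  from \<open>Df\<close> to \<open>D2f\<close>.\<close>

lemma D_measurable:
  assumes z: "z \<in> borel_measurable I01" and d: "d \<in> borel_measurable I01"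
  shows "(\<lambda>t. Df t (z t) (d t)) \<in> borel_measurable I01"
proof (rule borel_measurable_I01_AE_LIMSEQ)
  show "(\<lambda>t. real (Suc n) *\<^sub>R (f t (z t + (1 / real (Suc n)) *\<^sub>R d t) - f t (z t))) \<in> borel_measurable I01" for n
    using z d by (intro borel_measurable_scaleR borel_measurable_diff comp_measurable borel_measurable_add borel_measurable_const)
  show "AE t in I01. (\<lambda>n. real (Suc n) *\<^sub>R (f t (z t + (1 / real (Suc n)) *\<^sub>R d t) - f t (z t))) \<longlonglongrightarrow> Df t (z t) (d t)"
    using G_AE by eventually_elim (rule directional_derivative_LIMSEQ[OF D1])
qed

lemma D2_measurable:
  assumes z: "z \<in> borel_measurable I01" and d: "d \<in> borel_measurable I01" and e: "e \<in> borel_measurable I01"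
  shows "(\<lambda>t. D2f t (z t) (d t) (e t)) \<in> borel_measurable I01"
proof (rule borel_measurable_I01_AE_LIMSEQ)
  show "(\<lambda>t. real (Suc n) *\<^sub>R (Df t (z t + (1 / real (Suc n)) *\<^sub>R d t) (e t) - Df t (z t) (e t))) \<in> borel_measurable I01" for n
    using z d e by (intro borel_measurable_scaleR borel_measurable_diff D_measurable borel_measurable_add borel_measurable_const)
  show "AE t in I01. (\<lambda>n. real (Suc n) *\<^sub>R (Df t (z t + (1 / real (Suc n)) *\<^sub>R d t) (e t) - Df t (z t) (e t))) \<longlonglongrightarrow> D2f t (z t) (d t) (e t)"
    using G_AE
  proof eventually_elim
    case (elim t)
    have "((\<lambda>z. Df t z (e t)) has_derivative (\<lambda>d. D2f t (z t) d (e t))) (at (z t))"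
      by (rule bounded_linear.has_derivative[OF blinfun.bounded_linear_left D2[OF elim]])
    from directional_derivative_LIMSEQ[OF this, of "d t"] show ?case .
  qed
qed

text \<open>Mean value inequality along the segment from z to z + d, which lies in the ball by
  convexity; there the derivative deviates from its value at z by at most B |d|. The second estimate
  is the same for \<open>Df\<close> and feeds \<open>taylor2\<close>.\<close>

lemma taylor1:
  assumes t: "t \<in> G" and z: "norm z \<le> M" "norm (z + d) \<le> M"
  shows "norm (f t (z + d) - f t z - Df t z d) \<le> B * (norm d)\<^sup>2"
    and "norm (Df t (z + d) - Df t z - D2f t z d) \<le> B * (norm d)\<^sup>2"
proof -
  define S where "S = closed_segment z (z + d)"
  have SM: "norm y \<le> M" if "y \<in> S" for y
    using that z closed_segment_subset[of z "cball 0 M" "z + d"] by (auto simp: S_def)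
  have Sd: "norm (y - z) \<le> norm d" if "y \<in> S" for y
    using segment_bound(1)[of y z "z + d"] that by (simp add: S_def)
  have seg: "z + s *\<^sub>R (z + d - z) \<in> S" if "s \<in> {0..1}" for s
    using that unfolding S_def closed_segment_def by (auto simp: algebra_simps)
  have zS: "z \<in> S" by (simp add: S_def)
  have B0: "0 \<le> B" using bound(1)[OF t z(1)] by (rule order_trans[OF norm_ge_zero])
  have 1: "norm (f t (z + d) - f t z - Df t z (z + d - z)) \<le> norm (z + d - z) * (B * norm d)"
  proof (rule differentiable_bound_linearization[OF seg])
    show "(f t has_derivative blinfun_apply (Df t y)) (at y within S)" for y
      using D1[OF t] by (rule has_derivative_at_withinI)
    show "onorm (blinfun_apply (Df t y) - blinfun_apply (Df t z)) \<le> B * norm d" if "y \<in> S" for y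
    proof -
      have "onorm (blinfun_apply (Df t y) - blinfun_apply (Df t z)) = norm (Df t y - Df t z)"
        by (simp add: norm_blinfun.rep_eq minus_blinfun.rep_eq fun_diff_def)
      also have "\<dots> \<le> B * norm (y - z)" using D_lip t SM z that by blast
      also have "\<dots> \<le> B * norm d" using Sd[OF that] B0 by (rule mult_left_mono)
      finally show ?thesis .
    qed
  qed (use zS in auto)
  then show "norm (f t (z + d) - f t z - Df t z d) \<le> B * (norm d)\<^sup>2" by (simp add: power2_eq_square mult.commute mult.left_commute)
  have 2: "norm (Df t (z + d) - Df t z - D2f t z (z + d - z)) \<le> norm (z + d - z) * (B * norm d)"
  proof (rule differentiable_bound_linearization[OF seg])
    show "(Df t has_derivative blinfun_apply (D2f t y)) (at y within S)" for y
      using D2[OF t] by (rule has_derivative_at_withinI)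
    show "onorm (blinfun_apply (D2f t y) - blinfun_apply (D2f t z)) \<le> B * norm d" if "y \<in> S" for y
    proof -
      have "onorm (blinfun_apply (D2f t y) - blinfun_apply (D2f t z)) = norm (D2f t y - D2f t z)"
        by (simp add: norm_blinfun.rep_eq minus_blinfun.rep_eq fun_diff_def)
      also have "\<dots> \<le> B * norm (y - z)" using D2_lip t SM z that by blast
      also have "\<dots> \<le> B * norm d" using Sd[OF that] B0 by (rule mult_left_mono)
      finally show ?thesis .
    qed
  qed (use zS in auto)
  then show "norm (Df t (z + d) - Df t z - D2f t z d) \<le> B * (norm d)\<^sup>2" by (simp add: power2_eq_square mult.commute mult.left_commute)
qed

lemma lipschitz:
  assumes t: "t \<in> G" and z: "norm z \<le> M" "norm z' \<le> M"
  shows "norm (f t z - f t z') \<le> B * norm (z - z')"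
proof (rule differentiable_bound[of "cball 0 M"])
  show "(f t has_derivative blinfun_apply (Df t y)) (at y within cball 0 M)" for y
    using D1[OF t] by (rule has_derivative_at_withinI)
  show "onorm (blinfun_apply (Df t y)) \<le> B" if "y \<in> cball 0 M" for y
    using bound(2)[OF t, of y] that by (simp add: norm_blinfun.rep_eq)
qed (use z in auto)

text \<open>The derivative is frozen at the centre \<open>z0\<close> while both points vary. The
  factor \<open>B * r\<close> shrinks with the radius, which is what lets the chord iteration for
  the control contract.\<close>

lemma linearization_bound:
  assumes t: "t \<in> G" and r: "norm z0 + r \<le> M" and z: "norm (z - z0) \<le> r" "norm (z' - z0) \<le> r"
  shows "norm (f t z - f t z' - Df t z0 (z - z')) \<le> norm (z - z') * (B * r)"
proof (rule differentiable_bound_linearization[where S="cball z0 r"])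
  have r0: "0 \<le> r" using z(1) by (rule order_trans[OF norm_ge_zero])
  have SM: "norm y \<le> M" if "y \<in> cball z0 r" for y
    using that r norm_triangle_sub[of y z0] by (simp add: dist_norm norm_minus_commute)
  have zM: "norm z0 \<le> M" using r r0 by linarith
  have B0: "0 \<le> B" using bound(1)[OF t zM] by (rule order_trans[OF norm_ge_zero])
  show "z' + s *\<^sub>R (z - z') \<in> cball z0 r" if "s \<in> {0..1}" for s
  proof -
    have "z' + s *\<^sub>R (z - z') \<in> closed_segment z' z"
      using that unfolding closed_segment_def by (intro CollectI exI[of _ s]) (auto simp: algebra_simps)
    then show ?thesis using z closed_segment_subset[of z' "cball z0 r" z] by (auto simp: dist_norm norm_minus_commute)
  qed
  show "(f t has_derivative blinfun_apply (Df t y)) (at y within cball z0 r)" for y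
    using D1[OF t] by (rule has_derivative_at_withinI)
  show "onorm (blinfun_apply (Df t y) - blinfun_apply (Df t z0)) \<le> B * r" if "y \<in> cball z0 r" for y
  proof -
    have "onorm (blinfun_apply (Df t y) - blinfun_apply (Df t z0)) = norm (Df t y - Df t z0)"
      by (simp add: norm_blinfun.rep_eq minus_blinfun.rep_eq fun_diff_def)
    also have "\<dots> \<le> B * norm (y - z0)" using D_lip[OF t SM[OF that] zM] .
    also have "\<dots> \<le> B * r" using that B0 by (intro mult_left_mono) (auto simp: dist_norm norm_minus_commute)
    finally show ?thesis .
  qed
  show "z0 \<in> cball z0 r" using r0 by simp
qed

lemma taylor2:
  assumes t: "t \<in> G" and z: "norm z \<le> M" "norm (z + d) \<le> M"
  shows "norm (f t (z + d) - f t z - Df t z d - (1/2) *\<^sub>R D2f t z d d) \<le> B * norm d ^ 3"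
proof -
  have B0: "0 \<le> B" using bound(1)[OF t z(1)] by (rule order_trans[OF norm_ge_zero])
  \<comment> \<open>\<psi> 1 - \<psi> 0 is the second-order remainder, and its derivative \<psi>' s
    is the first-order remainder of \<open>Df\<close> applied to d, of size at most B |s d|^2 |d|.
    The mean value inequality on [0,1] then gives the cubic bound.\<close>
  define \<psi> where "\<psi> s = f t (z + s *\<^sub>R d) - s *\<^sub>R Df t z d - (s\<^sup>2 / 2) *\<^sub>R D2f t z d d" for s :: real
  define \<psi>' where "\<psi>' s = Df t (z + s *\<^sub>R d) d - Df t z d - s *\<^sub>R D2f t z d d" for s :: real
  have der: "(\<psi> has_derivative (\<lambda>h. h *\<^sub>R \<psi>' s)) (at s within {0..1})" for s
  proof -
    have "((\<lambda>h. z + h *\<^sub>R d) has_derivative (\<lambda>h. h *\<^sub>R d)) (at s within {0..1})" by (auto intro!: derivative_eq_intros)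
    from has_derivative_compose[OF this D1[OF t]]
    have 1: "((\<lambda>s. f t (z + s *\<^sub>R d)) has_derivative (\<lambda>h. Df t (z + s *\<^sub>R d) (h *\<^sub>R d))) (at s within {0..1})" .
    show ?thesis unfolding \<psi>_def \<psi>'_def
      by (rule derivative_eq_intros 1 refl)+ (auto simp: fun_eq_iff blinfun.scaleR_right algebra_simps)
  qed
  have "norm (\<psi> 1 - \<psi> 0) \<le> (B * norm d ^ 3) * norm (1 - 0 :: real)"
  proof (rule differentiable_bound[of "{0..1}", OF _ der])
    fix s :: real assume s: "s \<in> {0..1}"
    have zs: "norm (z + s *\<^sub>R d) \<le> M"
    proof -
      have "z + s *\<^sub>R d \<in> closed_segment z (z + d)" using s unfolding closed_segment_def by (auto simp: algebra_simps)
      then show ?thesis using z closed_segment_subset[of z "cball 0 M" "z + d"] by auto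
    qed
    have "norm (\<psi>' s) = norm (blinfun_apply (Df t (z + s *\<^sub>R d) - Df t z - D2f t z (s *\<^sub>R d)) d)"
      by (simp add: \<psi>'_def blinfun.diff_left blinfun.scaleR_right blinfun.scaleR_left)
    also have "\<dots> \<le> norm (Df t (z + s *\<^sub>R d) - Df t z - D2f t z (s *\<^sub>R d)) * norm d" by (rule norm_blinfun)
    also have "\<dots> \<le> (B * (norm (s *\<^sub>R d))\<^sup>2) * norm d"
      using taylor1(2)[OF t z(1) zs] by (rule mult_right_mono) auto
    also have "\<dots> \<le> (B * (norm d)\<^sup>2) * norm d"
      using s B0 by (intro mult_right_mono mult_left_mono power_mono) (auto simp: mult_left_le_one_le)
    finally have "norm (\<psi>' s) \<le> B * norm d ^ 3" by (simp add: power2_eq_square power3_eq_cube)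
    moreover have "onorm (\<lambda>h::real. h *\<^sub>R \<psi>' s) \<le> norm (\<psi>' s)"
      by (rule onorm_le) (simp add: mult.commute)
    ultimately show "onorm (\<lambda>h. h *\<^sub>R \<psi>' s) \<le> B * norm d ^ 3" by linarith
  qed auto
  then show ?thesis by (simp add: \<psi>_def algebra_simps)
qed

end

section \<open>Adjoint states and multipliers\<close>

lemma measurable_fst_comp:
  fixes f :: "'c \<Rightarrow> 'a::euclidean_space \<times> 'b::euclidean_space"
  assumes "f \<in> borel_measurable N"
  shows "(\<lambda>t. fst (f t)) \<in> borel_measurable N" "(\<lambda>t. snd (f t)) \<in> borel_measurable N"
  using measurable_compose[OF assms borel_measurable_continuous_onI[OF continuous_on_fst[OF continuous_on_id]]]
    measurable_compose[OF assms borel_measurable_continuous_onI[OF continuous_on_snd[OF continuous_on_id]]] by auto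

lemma norm_axis_one: "norm (axis i 1 :: real^'k) = 1"
  by (simp add: norm_eq_1 inner_axis_axis)

lemma norm_fst_snd_le:
  "norm (fst z) \<le> norm z" "norm (snd z) \<le> norm z" "norm (a, b) \<le> norm a + norm b"
  using norm_triangle_ineq[of "(a, 0)" "(0, b)"] by (cases z; simp add: norm_fst_le norm_snd_le)+

text \<open>The + 1 in \<open>zb_bound\<close> leaves room for perturbations of norm at most 1
  inside the ball of radius \<open>M\<close>. The state equation is demanded at every t, and
  \<open>nondegenerate\<close> is (H2) on \<open>G\<close>.\<close>

locale control_problem =
  Ls: smooth_family G M B L DL D2L + Ps: smooth_family G M B \<phi> D\<phi> D2\<phi> + Gs: smooth_family G M B g Dg D2g
  for G :: "real set" and M B :: real
    and L :: "real \<Rightarrow> ((real^'n) \<times> (real^'l)) \<Rightarrow> real^'m" and DL D2L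
    and \<phi> :: "real \<Rightarrow> ((real^'n) \<times> (real^'l)) \<Rightarrow> real^'n" and D\<phi> D2\<phi>
    and g :: "real \<Rightarrow> ((real^'n) \<times> (real^'l)) \<Rightarrow> real" and Dg D2g +
  fixes x0 :: "real^'n" and xb :: "real \<Rightarrow> real^'n" and ub :: "real \<Rightarrow> real^'l" and i0 :: 'l and \<alpha> :: real
  assumes B1: "1 \<le> B" and \<alpha>: "0 < \<alpha>"
    and xb_cont: "continuous_on {0..1} xb" and ub_meas: "ub \<in> borel_measurable I01"
    and zb_bound: "\<And>t. t \<in> G \<Longrightarrow> norm (xb t, ub t) + 1 \<le> M"
    and xb_eq: "\<And>t. t \<in> {0..1} \<Longrightarrow> xb t = x0 + (\<integral>s. indicator {0..t} s *\<^sub>R \<phi> s (xb s, ub s) \<partial>I01)"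
    and g_nonpos: "\<And>t. t \<in> G \<Longrightarrow> g t (xb t, ub t) \<le> 0"
    and nondegenerate: "\<And>t. t \<in> G \<Longrightarrow> \<bar>Dg t (xb t, ub t) (0, axis i0 1)\<bar> \<ge> \<alpha>"
begin

definition zb :: "real \<Rightarrow> (real^'n) \<times> (real^'l)" where "zb t = (xb t, ub t)"

lemma G_subset: "t \<in> G \<Longrightarrow> t \<in> {0..1}"
  using sets.sets_into_space[OF Ls.G_sets] by auto

lemma zb_meas: "zb \<in> borel_measurable I01"
  unfolding zb_def using continuous_on_measurable_I01[OF xb_cont] ub_meas by (rule borel_measurable_Pair)

lemma zb_norm: "t \<in> G \<Longrightarrow> norm (zb t) + 1 \<le> M" "t \<in> G \<Longrightarrow> norm (zb t) \<le> M"
  using zb_bound[of t] by (auto simp: zb_def)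

lemma nondegenerate_zb: "t \<in> G \<Longrightarrow> \<alpha> \<le> \<bar>Dg t (zb t) (0, axis i0 1)\<bar>"
  using nondegenerate by (simp add: zb_def)

lemma D_bound:
  assumes "t \<in> G"
  shows "norm (DL t (zb t) d) \<le> B * norm d" "norm (D\<phi> t (zb t) d) \<le> B * norm d" "\<bar>Dg t (zb t) d\<bar> \<le> B * norm d"
    "norm (D2L t (zb t) d e) \<le> B * norm d * norm e" "norm (D2\<phi> t (zb t) d e) \<le> B * norm d * norm e"
    "\<bar>D2g t (zb t) d e\<bar> \<le> B * norm d * norm e"
proof -
  have D: "norm (blinfun_apply A d) \<le> B * norm d" if "norm A \<le> B" for A :: "((real^'n) \<times> (real^'l)) \<Rightarrow>\<^sub>L 'b::real_normed_vector" and d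
    using norm_blinfun[of A d] mult_right_mono[OF that norm_ge_zero[of d]] by linarith
  have D2: "norm (blinfun_apply (blinfun_apply A d) e) \<le> B * norm d * norm e" if "norm A \<le> B"
    for A :: "((real^'n) \<times> (real^'l)) \<Rightarrow>\<^sub>L ((real^'n) \<times> (real^'l)) \<Rightarrow>\<^sub>L 'b::real_normed_vector"
    using norm_blinfun[of "blinfun_apply A d" e] mult_right_mono[OF D[OF that, of d] norm_ge_zero[of e]] by linarith
  show "norm (DL t (zb t) d) \<le> B * norm d" "norm (D\<phi> t (zb t) d) \<le> B * norm d"
    "norm (D2L t (zb t) d e) \<le> B * norm d * norm e" "norm (D2\<phi> t (zb t) d e) \<le> B * norm d * norm e"
    by (intro D D2 Ls.bound Ps.bound assms zb_norm)+
  show "\<bar>Dg t (zb t) d\<bar> \<le> B * norm d" "\<bar>D2g t (zb t) d e\<bar> \<le> B * norm d * norm e"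
    unfolding real_norm_def[symmetric] by (intro D D2 Gs.bound assms zb_norm)+
qed

text \<open>The multiplier \<open>\<theta>\<close> is the one that makes the derivative of the Hamiltonian in the direction of the
  control component \<open>i0\<close> vanish; it is an affine function of the adjoint vector \<open>q\<close>.\<close>
definition th :: "'m \<Rightarrow> real \<Rightarrow> real^'n \<Rightarrow> real" where
  "th k t q = (if t \<in> G then - (DL t (zb t) (0, axis i0 1) $ k + q \<bullet> D\<phi> t (zb t) (0, axis i0 1)) / Dg t (zb t) (0, axis i0 1) else 0)"

text \<open>\<open>q\<close> is a free vector because the multiplier is eliminated before the
  adjoint state is known. The expression is affine in q with bounded coefficients on
  \<open>G\<close>, thanks to the lower bound \<alpha> on the denominator in \<open>th\<close>, so
  the adjoint state solves an affine backward equation.\<close>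

definition HDq :: "'m \<Rightarrow> real \<Rightarrow> real^'n \<Rightarrow> (real^'n) \<times> (real^'l) \<Rightarrow> real" where
  "HDq k t q d = DL t (zb t) d $ k + q \<bullet> D\<phi> t (zb t) d + th k t q * Dg t (zb t) d"

text \<open>State gradient of the Hamiltonian, set to 0 off \<open>G\<close> so that the Lipschitz
  bound and the bound at q = 0 hold at every t.\<close>

definition Hx :: "'m \<Rightarrow> real \<Rightarrow> real^'n \<Rightarrow> real^'n" where
  "Hx k t q = (if t \<in> G then \<chi> i. HDq k t q (axis i 1, 0) else 0)"

lemma th_measurable:
  assumes q[measurable]: "q \<in> borel_measurable I01"
  shows "(\<lambda>t. th k t (q t)) \<in> borel_measurable I01"
proof -
  note [measurable] = Ls.G_sets
  have [measurable]: "(\<lambda>t. DL t (zb t) (0, axis i0 1)) \<in> borel_measurable I01"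
     "(\<lambda>t. D\<phi> t (zb t) (0, axis i0 1)) \<in> borel_measurable I01" "(\<lambda>t. Dg t (zb t) (0, axis i0 1)) \<in> borel_measurable I01"
    by (intro Ls.D_measurable Ps.D_measurable Gs.D_measurable zb_meas borel_measurable_const)+
  have "(\<lambda>t. indicator G t * (- ((DL t (zb t) (0, axis i0 1)) \<bullet> axis k 1 + q t \<bullet> D\<phi> t (zb t) (0, axis i0 1)) / Dg t (zb t) (0, axis i0 1)))
     \<in> borel_measurable I01" by measurable
  moreover have "(\<lambda>t. th k t (q t)) = (\<lambda>t. indicator G t * (- ((DL t (zb t) (0, axis i0 1)) \<bullet> axis k 1 + q t \<bullet> D\<phi> t (zb t) (0, axis i0 1)) / Dg t (zb t) (0, axis i0 1)))"
    by (auto simp: th_def inner_axis)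
  ultimately show ?thesis by simp
qed

lemma HDq_measurable:
  assumes q[measurable]: "q \<in> borel_measurable I01" and d: "d \<in> borel_measurable I01"
  shows "(\<lambda>t. HDq k t (q t) (d t)) \<in> borel_measurable I01"
proof -
  have [measurable]: "(\<lambda>t. DL t (zb t) (d t)) \<in> borel_measurable I01"
     "(\<lambda>t. D\<phi> t (zb t) (d t)) \<in> borel_measurable I01" "(\<lambda>t. Dg t (zb t) (d t)) \<in> borel_measurable I01"
    by (intro Ls.D_measurable Ps.D_measurable Gs.D_measurable zb_meas d)+
  note [measurable] = th_measurable[OF q]
  have "(\<lambda>t. (DL t (zb t) (d t)) \<bullet> axis k 1 + q t \<bullet> D\<phi> t (zb t) (d t) + th k t (q t) * Dg t (zb t) (d t)) \<in> borel_measurable I01"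
    by measurable
  then show ?thesis by (simp add: HDq_def inner_axis)
qed

lemma Hx_measurable:
  assumes q: "q \<in> borel_measurable I01"
  shows "(\<lambda>t. Hx k t (q t)) \<in> borel_measurable I01"
proof -
  note [measurable] = Ls.G_sets
  have [measurable]: "(\<lambda>t. HDq k t (q t) (axis i 1, 0)) \<in> borel_measurable I01" for i
    by (intro HDq_measurable q borel_measurable_const)
  have "(\<lambda>t. indicator G t *\<^sub>R (\<Sum>i\<in>UNIV. HDq k t (q t) (axis i 1, 0) *\<^sub>R axis i 1 :: real^'n)) \<in> borel_measurable I01"
    by measurable
  moreover have "(\<lambda>t. Hx k t (q t)) = (\<lambda>t. indicator G t *\<^sub>R (\<Sum>i\<in>UNIV. HDq k t (q t) (axis i 1, 0) *\<^sub>R axis i 1))"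
    by (auto simp: Hx_def fun_eq_iff vec_eq_iff axis_def if_distrib cong: if_cong)
  ultimately show ?thesis by simp
qed

lemma th_diff: "\<bar>th k t p - th k t q\<bar> \<le> B / \<alpha> * norm (p - q)"
proof (cases "t \<in> G")
  case True
  let ?g = "Dg t (zb t) (0, axis i0 1)"
  have g: "\<alpha> \<le> \<bar>?g\<bar>" using nondegenerate_zb[OF True] .
  have "th k t p - th k t q = - ((p - q) \<bullet> D\<phi> t (zb t) (0, axis i0 1)) / ?g"
    using True by (simp add: th_def inner_diff_left diff_divide_distrib[symmetric] add_divide_distrib)
  then have "\<bar>th k t p - th k t q\<bar> = \<bar>(p - q) \<bullet> D\<phi> t (zb t) (0, axis i0 1)\<bar> / \<bar>?g\<bar>" by simp
  also have "\<dots> \<le> (norm (p - q) * B) / \<alpha>"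
  proof (rule frac_le)
    have "\<bar>(p - q) \<bullet> D\<phi> t (zb t) (0, axis i0 1)\<bar> \<le> norm (p - q) * norm (D\<phi> t (zb t) (0, axis i0 1))"
      by (rule Cauchy_Schwarz_ineq2)
    also have "\<dots> \<le> norm (p - q) * B"
      using D_bound(2)[OF True, of "(0, axis i0 1)"] by (intro mult_left_mono) (auto simp: norm_Pair norm_axis_one)
    finally show "\<bar>(p - q) \<bullet> D\<phi> t (zb t) (0, axis i0 1)\<bar> \<le> norm (p - q) * B" .
  qed (use g \<alpha> B1 in auto)
  finally show ?thesis by (simp add: mult.commute)
qed (use B1 \<alpha> in \<open>auto simp: th_def\<close>)

lemma th_zero: "\<bar>th k t 0\<bar> \<le> B / \<alpha>"
proof (cases "t \<in> G")
  case True
  let ?g = "Dg t (zb t) (0, axis i0 1)"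
  have g: "\<alpha> \<le> \<bar>?g\<bar>" using nondegenerate_zb[OF True] .
  have "\<bar>th k t 0\<bar> = \<bar>DL t (zb t) (0, axis i0 1) $ k\<bar> / \<bar>?g\<bar>" using True by (simp add: th_def)
  also have "\<dots> \<le> B / \<alpha>"
  proof (rule frac_le)
    show "\<bar>DL t (zb t) (0, axis i0 1) $ k\<bar> \<le> B"
      using component_le_norm_cart[of "DL t (zb t) (0, axis i0 1)" k] D_bound(1)[OF True, of "(0, axis i0 1)"] by (auto simp: norm_Pair norm_axis_one)
  qed (use g \<alpha> B1 in auto)
  finally show ?thesis .
qed (use B1 \<alpha> in \<open>auto simp: th_def\<close>)

lemma HDq_diff:
  assumes "t \<in> G"
  shows "\<bar>HDq k t p d - HDq k t q d\<bar> \<le> (B + B / \<alpha> * B) * norm (p - q) * norm d"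
proof -
  have "HDq k t p d - HDq k t q d = (p - q) \<bullet> D\<phi> t (zb t) d + (th k t p - th k t q) * Dg t (zb t) d"
    by (simp add: HDq_def algebra_simps inner_diff_left)
  also have "\<bar>\<dots>\<bar> \<le> norm (p - q) * (B * norm d) + (B / \<alpha> * norm (p - q)) * (B * norm d)"
  proof (rule order_trans[OF abs_triangle_ineq], rule add_mono)
    show "\<bar>(p - q) \<bullet> D\<phi> t (zb t) d\<bar> \<le> norm (p - q) * (B * norm d)"
      using Cauchy_Schwarz_ineq2[of "p - q" "D\<phi> t (zb t) d"] mult_left_mono[OF D_bound(2)[OF assms] norm_ge_zero] by (rule order_trans)
    show "\<bar>(th k t p - th k t q) * Dg t (zb t) d\<bar> \<le> (B / \<alpha> * norm (p - q)) * (B * norm d)"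
      unfolding abs_mult using th_diff D_bound(3)[OF assms] B1 \<alpha> by (intro mult_mono) auto
  qed
  finally show ?thesis by (simp add: algebra_simps)
qed

lemma HDq_zero:
  assumes "t \<in> G"
  shows "\<bar>HDq k t 0 d\<bar> \<le> (B + B / \<alpha> * B) * norm d"
proof -
  have "\<bar>HDq k t 0 d\<bar> \<le> \<bar>DL t (zb t) d $ k\<bar> + \<bar>th k t 0 * Dg t (zb t) d\<bar>" by (simp add: HDq_def)
  also have "\<dots> \<le> B * norm d + (B / \<alpha>) * (B * norm d)"
  proof (rule add_mono)
    show "\<bar>DL t (zb t) d $ k\<bar> \<le> B * norm d"
      using component_le_norm_cart D_bound(1)[OF assms] by (rule order_trans)
    show "\<bar>th k t 0 * Dg t (zb t) d\<bar> \<le> (B / \<alpha>) * (B * norm d)"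
      unfolding abs_mult using th_zero D_bound(3)[OF assms] B1 \<alpha> by (intro mult_mono) auto
  qed
  finally show ?thesis by (simp add: algebra_simps)
qed

lemma adjoint_exists:
  "\<exists>p C. p \<in> borel_measurable I01 \<and> (\<forall>t. norm (p t) \<le> C) \<and>
     (\<forall>t\<in>{0..1}. p t = (\<integral>s. indicator {t..1} s *\<^sub>R Hx k s (p s) \<partial>I01))"
proof -
  \<comment> \<open>The norm of a vector is at most \<open>CARD('n)\<close> times a bound on its
    components. Each component contributes \<open>B\<close> from \<open>D\<phi>\<close> (from
    \<open>DL\<close> at q = 0) plus B / \<alpha> times \<open>B\<close> from the product of
    \<open>th\<close> and \<open>Dg\<close>. The same number serves as Lipschitz constant and as
    bound at 0.\<close>
  define K where "K = real CARD('n) * (B + B / \<alpha> * B)"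
  have B': "0 < B + B / \<alpha> * B" using B1 \<alpha> by (simp add: add_pos_pos)
  have le: "norm v \<le> real CARD('n) * b" if "\<And>i. \<bar>v $ i\<bar> \<le> b" for v :: "real^'n" and b
    using order_trans[OF norm_le_l1_cart[of v] sum_bounded_above[of UNIV "\<lambda>i. \<bar>v $ i\<bar>" b]] that by simp
  obtain p C where "p \<in> borel_measurable I01" "\<And>t. norm (p t) \<le> C"
    "\<And>t. t \<in> {0..1} \<Longrightarrow> p t = (\<integral>s. indicator {t..1} s *\<^sub>R Hx k s (p s) \<partial>I01)"
  proof (rule backward_integral_equation[where F="Hx k" and K=K and B=K])
    show "norm (Hx k t p - Hx k t q) \<le> K * norm (p - q)" for t p q
    proof (cases "t \<in> G")
      case True
      have "norm (Hx k t p - Hx k t q) \<le> real CARD('n) * ((B + B / \<alpha> * B) * norm (p - q))"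
      proof (rule le)
        fix i
        show "\<bar>(Hx k t p - Hx k t q) $ i\<bar> \<le> (B + B / \<alpha> * B) * norm (p - q)"
          using HDq_diff[OF True, of k p "(axis i 1, 0)" q] True by (simp add: Hx_def norm_Pair norm_axis_one)
      qed
      then show ?thesis by (simp add: K_def mult.assoc)
    qed (use B' in \<open>simp add: Hx_def K_def\<close>)
    show "norm (Hx k t 0) \<le> K" for t
    proof (cases "t \<in> G")
      case True
      show ?thesis unfolding K_def
      proof (rule le)
        fix i
        show "\<bar>Hx k t 0 $ i\<bar> \<le> (B + B / \<alpha> * B)"
          using HDq_zero[OF True, of k "(axis i 1, 0)"] True by (simp add: Hx_def norm_Pair norm_axis_one)
      qed
    qed (use B' in \<open>simp add: Hx_def K_def\<close>)
    show "K > 0" using B' by (simp add: K_def)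
  qed (auto intro: Hx_measurable)
  then show ?thesis by blast
qed

text \<open>Integral form of p' = - H_x, p(1) = 0, with the multiplier already substituted.
  Measurability and boundedness are chosen along with the solution. There is one adjoint state per
  objective, so \<lambda> will enter only as a vector of coefficients.\<close>

definition adj :: "'m \<Rightarrow> real \<Rightarrow> real^'n" where
  "adj k = (SOME p. \<exists>C. p \<in> borel_measurable I01 \<and> (\<forall>t. norm (p t) \<le> C) \<and>
     (\<forall>t\<in>{0..1}. p t = (\<integral>s. indicator {t..1} s *\<^sub>R Hx k s (p s) \<partial>I01)))"

lemma adj_props:
  "\<exists>C. adj k \<in> borel_measurable I01 \<and> (\<forall>t. norm (adj k t) \<le> C) \<and>
     (\<forall>t\<in>{0..1}. adj k t = (\<integral>s. indicator {t..1} s *\<^sub>R Hx k s (adj k s) \<partial>I01))"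
  unfolding adj_def using adjoint_exists[of k] by (rule someI_ex)

lemma adj_measurable: "adj k \<in> borel_measurable I01"
  and adj_eq: "t \<in> {0..1} \<Longrightarrow> adj k t = (\<integral>s. indicator {t..1} s *\<^sub>R Hx k s (adj k s) \<partial>I01)"
  using adj_props[of k] by blast+

definition \<theta> :: "'m \<Rightarrow> real \<Rightarrow> real" where "\<theta> k t = th k t (adj k t)"

definition HD :: "'m \<Rightarrow> real \<Rightarrow> (real^'n) \<times> (real^'l) \<Rightarrow> real" where
  "HD k t d = DL t (zb t) d $ k + adj k t \<bullet> D\<phi> t (zb t) d + \<theta> k t * Dg t (zb t) d"

definition HD2 :: "'m \<Rightarrow> real \<Rightarrow> (real^'n) \<times> (real^'l) \<Rightarrow> (real^'n) \<times> (real^'l) \<Rightarrow> real" where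
  "HD2 k t d e = D2L t (zb t) d e $ k + adj k t \<bullet> D2\<phi> t (zb t) d e + \<theta> k t * D2g t (zb t) d e"

lemma HD_eq: "HD k t d = HDq k t (adj k t) d"
  by (simp add: HD_def HDq_def \<theta>_def)

lemma \<theta>_measurable: "\<theta> k \<in> borel_measurable I01"
  using th_measurable[OF adj_measurable] unfolding \<theta>_def .

lemma HD_measurable: "d \<in> borel_measurable I01 \<Longrightarrow> (\<lambda>t. HD k t (d t)) \<in> borel_measurable I01"
  unfolding HD_eq by (intro HDq_measurable adj_measurable)

lemma HD2_measurable:
  assumes "d \<in> borel_measurable I01" "e \<in> borel_measurable I01"
  shows "(\<lambda>t. HD2 k t (d t) (e t)) \<in> borel_measurable I01"
proof -
  have [measurable]: "(\<lambda>t. D2L t (zb t) (d t) (e t)) \<in> borel_measurable I01"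
     "(\<lambda>t. D2\<phi> t (zb t) (d t) (e t)) \<in> borel_measurable I01" "(\<lambda>t. D2g t (zb t) (d t) (e t)) \<in> borel_measurable I01"
    by (intro Ls.D2_measurable Ps.D2_measurable Gs.D2_measurable zb_meas assms)+
  note [measurable] = adj_measurable \<theta>_measurable
  have "(\<lambda>t. D2L t (zb t) (d t) (e t) \<bullet> axis k 1 + adj k t \<bullet> D2\<phi> t (zb t) (d t) (e t) + \<theta> k t * D2g t (zb t) (d t) (e t)) \<in> borel_measurable I01"
    by measurable
  then show ?thesis by (simp add: HD2_def inner_axis)
qed

lemma HD_add: "HD k t (d + e) = HD k t d + HD k t e"
  and HD_scale: "HD k t (c *\<^sub>R d) = c * HD k t d"
  by (simp_all add: HD_def blinfun.add_right blinfun.scaleR_right algebra_simps inner_add_right)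

text \<open>The purpose of \<open>th\<close>. The control correction along axis \<open>i0\<close> is
  controlled only in size, by a multiple of \<epsilon>^2, which is the order at which costs are
  compared; vanishing of the derivative in this direction removes it from the comparison.\<close>

lemma HD_i0: "t \<in> G \<Longrightarrow> HD k t (0, axis i0 1) = 0"
  using nondegenerate_zb[of t] \<alpha> by (auto simp: HD_def \<theta>_def th_def)

lemma HD_control: "HD k t (0, w) = (\<Sum>i\<in>UNIV. w $ i * HD k t (0, axis i 1))"
proof -
  have lin: "linear (\<lambda>w. HD k t (0, w))"
  proof (rule linearI)
    show "HD k t (0, a + b) = HD k t (0, a) + HD k t (0, b)" for a b using HD_add[of k t "(0,a)" "(0,b)"] by simp
    show "HD k t (0, c *\<^sub>R b) = c *\<^sub>R HD k t (0, b)" for b c using HD_scale[of k t c "(0,b)"] by simp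
  qed
  have "HD k t (0, w) = HD k t (0, \<Sum>i\<in>UNIV. w $ i *\<^sub>R axis i 1)" by (simp add: basis_expansion scalar_mult_eq_scaleR[symmetric])
  also have "\<dots> = (\<Sum>i\<in>UNIV. w $ i * HD k t (0, axis i 1))"
    using linear_sum[OF lin, of "\<lambda>i. w $ i *\<^sub>R axis i 1" UNIV] linear_scale[OF lin] by simp
  finally show ?thesis .
qed

lemma HD_state:
  assumes "t \<in> G"
  shows "HD k t (y, 0) = Hx k t (adj k t) \<bullet> y"
proof -
  have lin: "linear (\<lambda>y. HD k t (y, 0))"
  proof (rule linearI)
    show "HD k t (a + b, 0) = HD k t (a, 0) + HD k t (b, 0)" for a b using HD_add[of k t "(a,0)" "(b,0)"] by simp
    show "HD k t (c *\<^sub>R b, 0) = c *\<^sub>R HD k t (b, 0)" for b c using HD_scale[of k t c "(b,0)"] by simp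
  qed
  have "HD k t (y, 0) = HD k t (\<Sum>i\<in>UNIV. y $ i *\<^sub>R axis i 1, 0)" by (simp add: basis_expansion scalar_mult_eq_scaleR[symmetric])
  also have "\<dots> = (\<Sum>i\<in>UNIV. y $ i * HD k t (axis i 1, 0))"
    using linear_sum[OF lin, of "\<lambda>i. y $ i *\<^sub>R axis i 1" UNIV] linear_scale[OF lin] by simp
  finally show ?thesis using assms by (simp add: Hx_def inner_vec_def HD_eq mult.commute)
qed

text \<open>Uniformity in k holds because there are finitely many objectives. The bound on \<theta>
  adds \<open>th_zero\<close> to the Lipschitz estimate \<open>th_diff\<close> along the bounded
  adjoint state; it is what makes the multiplier an integrable function.\<close>

lemma multiplier_bounds:
  obtains C where "C \<ge> 1" "\<And>k t. norm (adj k t) \<le> C" "\<And>k t. \<bar>\<theta> k t\<bar> \<le> C"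
    "\<And>k t. norm (Hx k t (adj k t)) \<le> C"
    "\<And>k t d. t \<in> G \<Longrightarrow> \<bar>HD k t d\<bar> \<le> C * norm d"
    "\<And>k t d e. t \<in> G \<Longrightarrow> \<bar>HD2 k t d e\<bar> \<le> C * norm d * norm e"
proof -
  obtain Ck where Ck: "\<And>k t. norm (adj k t) \<le> Ck k" using adj_props by metis
  define A where "A = (\<Sum>k\<in>UNIV. \<bar>Ck k\<bar>) + 1"
  have A: "norm (adj k t) \<le> A" for k t
    using Ck[of k t] member_le_sum[of k UNIV "\<lambda>k. \<bar>Ck k\<bar>"] by (simp add: A_def)
  have A1: "A \<ge> 1" unfolding A_def by (simp add: sum_nonneg)
  define T where "T = B / \<alpha> + B / \<alpha> * A"
  have T: "\<bar>\<theta> k t\<bar> \<le> T" for k t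
  proof -
    have "\<bar>\<theta> k t\<bar> \<le> \<bar>th k t 0\<bar> + \<bar>th k t (adj k t) - th k t 0\<bar>" by (simp add: \<theta>_def)
    also have "\<dots> \<le> B / \<alpha> + B / \<alpha> * norm (adj k t - 0)" using th_zero th_diff by (rule add_mono)
    also have "\<dots> \<le> T" unfolding T_def using A[of k t] B1 \<alpha> by (intro add_mono mult_left_mono) auto
    finally show ?thesis .
  qed
  have T0: "0 \<le> T" unfolding T_def using B1 \<alpha> A1 by simp
  define D where "D = B + A * B + T * B"
  have D0: "0 \<le> D" unfolding D_def using B1 A1 T0 by simp
  have gen: "\<bar>l $ k + adj k t \<bullet> f + \<theta> k t * h\<bar> \<le> D * n"
    if "norm l \<le> B * n" "norm f \<le> B * n" "\<bar>h\<bar> \<le> B * n" "0 \<le> n" for l :: "real^'m" and f k t h n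
  proof -
    have "\<bar>l $ k\<bar> \<le> B * n" using component_le_norm_cart that(1) by (rule order_trans)
    moreover have "\<bar>adj k t \<bullet> f\<bar> \<le> A * (B * n)"
      using Cauchy_Schwarz_ineq2[of "adj k t" f] mult_mono[OF A that(2)] A1 by (meson norm_ge_zero order_trans zero_le_one)
    moreover have "\<bar>\<theta> k t * h\<bar> \<le> T * (B * n)" unfolding abs_mult using T that T0 by (intro mult_mono) auto
    ultimately have "\<bar>l $ k + adj k t \<bullet> f + \<theta> k t * h\<bar> \<le> B * n + A * (B * n) + T * (B * n)" by linarith
    then show ?thesis by (simp add: D_def algebra_simps)
  qed
  have HD: "\<bar>HD k t d\<bar> \<le> D * norm d" if "t \<in> G" for k t d
    unfolding HD_def using D_bound[OF that] by (intro gen) auto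
  have HD2: "\<bar>HD2 k t d e\<bar> \<le> D * (norm d * norm e)" if "t \<in> G" for k t d e
    unfolding HD2_def using D_bound[OF that] by (intro gen) (auto simp: mult.assoc)
  define X where "X = real CARD('n) * D"
  have Hx: "norm (Hx k t (adj k t)) \<le> X" for k t
  proof (cases "t \<in> G")
    case True
    have "\<bar>Hx k t (adj k t) $ i\<bar> \<le> D" for i
      using HD[OF True, of k "(axis i 1, 0)"] True by (simp add: Hx_def HD_eq norm_Pair norm_axis_one)
    then show ?thesis unfolding X_def
      using order_trans[OF norm_le_l1_cart[of "Hx k t (adj k t)"] sum_bounded_above[of UNIV "\<lambda>i. \<bar>Hx k t (adj k t) $ i\<bar>" D]] by simp
  qed (use D0 in \<open>simp add: Hx_def X_def\<close>)
  have X0: "0 \<le> X" using D0 by (simp add: X_def)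
  show ?thesis
  proof (rule that[of "A + T + D + X"])
    show "1 \<le> A + T + D + X" using A1 T0 D0 X0 by linarith
    show "norm (adj k t) \<le> A + T + D + X" "\<bar>\<theta> k t\<bar> \<le> A + T + D + X" "norm (Hx k t (adj k t)) \<le> A + T + D + X" for k t
      using A[of k t] T[of k t] Hx[of k t] A1 T0 D0 X0 by linarith+
    have le: "D * n \<le> (A + T + D + X) * n" if "0 \<le> n" for n using that A1 T0 D0 X0 by (intro mult_right_mono) auto
    show "\<bar>HD k t d\<bar> \<le> (A + T + D + X) * norm d" if "t \<in> G" for k t d
      using HD[OF that, of k d] le[of "norm d"] by simp
    show "\<bar>HD2 k t d e\<bar> \<le> (A + T + D + X) * norm d * norm e" if "t \<in> G" for k t d e
      using HD2[OF that, of k d e] le[of "norm d * norm e"] by (simp add: mult.assoc)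
  qed
qed

text \<open>\<open>b\<close> is the velocity of y and y starts at 0, while the adjoint state ends at
  0, so no boundary term appears. The identity is exact for every such y: besides linearised
  trajectories it applies to the true difference of two trajectories, whose state correction
  therefore never has to be computed.\<close>

lemma adjoint_by_parts:
  assumes b: "b \<in> borel_measurable I01" "AE t in I01. norm (b t) \<le> C"
    and y: "\<And>t. t \<in> {0..1} \<Longrightarrow> y t = (\<integral>s. indicator {0..t} s *\<^sub>R b s \<partial>I01)"
  shows "(\<integral>t. adj k t \<bullet> b t \<partial>I01) = (\<integral>t. HD k t (y t, 0) \<partial>I01)"
proof -
  obtain D where D: "\<And>t. norm (Hx k t (adj k t)) \<le> D" using multiplier_bounds by metis
  have "(\<integral>t. adj k t \<bullet> b t \<partial>I01) = (\<integral>t. (\<integral>s. indicator {t..1} s *\<^sub>R Hx k s (adj k s) \<partial>I01) \<bullet> b t \<partial>I01)"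
    by (intro Bochner_Integration.integral_cong refl) (subst adj_eq, auto)
  also have "\<dots> = (\<integral>s. Hx k s (adj k s) \<bullet> (\<integral>t. indicator {0..s} t *\<^sub>R b t \<partial>I01) \<partial>I01)"
    using D by (intro integral_by_parts_I01[OF b(1) _ b(2), of _ D] Hx_measurable adj_measurable) auto
  also have "\<dots> = (\<integral>s. Hx k s (adj k s) \<bullet> y s \<partial>I01)"
    by (intro Bochner_Integration.integral_cong refl) (simp add: y)
  also have "\<dots> = (\<integral>t. HD k t (y t, 0) \<partial>I01)"
  proof (rule integral_cong_AE)
    have ym: "y \<in> borel_measurable I01"
      using initial_integral_measurable(2)[OF b] by (subst measurable_lebesgue_cong[OF y]) auto
    then show "(\<lambda>s. Hx k s (adj k s) \<bullet> y s) \<in> borel_measurable I01"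
      by (intro borel_measurable_inner Hx_measurable adj_measurable)
    show "(\<lambda>t. HD k t (y t, 0)) \<in> borel_measurable I01"
      using ym by (intro HD_measurable borel_measurable_Pair) auto
    show "AE s in I01. Hx k s (adj k s) \<bullet> y s = HD k s (y s, 0)"
      using Ls.G_AE by eventually_elim (simp add: HD_state)
  qed
  finally show ?thesis .
qed

end

section \<open>Restoring feasibility\<close>

context control_problem
begin

text \<open>Picard iteration for the state coupled with a chord (simplified Newton) iteration for the
  control component \<open>i0\<close>, contracting in the sup norm weighted by \<open>exp (K * t)\<close>.\<close>
lemma feasible_correction:
  obtains C R where "C > 0" "R > 0"
    "\<And>x1 u1 v \<delta>. \<lbrakk>x1 \<in> borel_measurable I01; u1 \<in> borel_measurable I01; v \<in> borel_measurable I01;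
        \<And>t. t \<in> G \<Longrightarrow> norm ((x1 t, u1 t) - zb t) \<le> R; 0 \<le> \<delta>; \<delta> \<le> R;
        \<And>t. t \<in> {0..1} \<Longrightarrow> norm (x0 + (\<integral>s. indicator {0..t} s *\<^sub>R \<phi> s (x1 s, u1 s) \<partial>I01) - x1 t) \<le> \<delta>;
        \<And>t. t \<in> G \<Longrightarrow> \<bar>g t (x1 t, u1 t) - v t\<bar> \<le> \<delta>\<rbrakk> \<Longrightarrow>
      \<exists>y s. y \<in> borel_measurable I01 \<and> s \<in> borel_measurable I01 \<and>
        (\<forall>t\<in>{0..1}. x1 t + y t = x0 + (\<integral>r. indicator {0..t} r *\<^sub>R \<phi> r (x1 r + y r, u1 r + s r *\<^sub>R axis i0 1) \<partial>I01)) \<and>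
        (\<forall>t\<in>G. g t (x1 t + y t, u1 t + s t *\<^sub>R axis i0 1) = v t) \<and>
        (\<forall>t. norm (y t) \<le> C * \<delta> \<and> \<bar>s t\<bar> \<le> C * \<delta>)"
proof -
  \<comment> \<open>The unknown is the pair (y, s / \<Lambda>). In these units y acts on the control
    equation with factor B / (\<alpha> \<Lambda>) \<le> 1/16. The integral operator has Lipschitz
    constant B (1 + \<Lambda>), which K reduces to 1/4; the control equation contributes another
    1/4, in total 1/2. \<open>C\<close> is the fixed-point bound 2 (2 \<delta>) exp K multiplied by
    \<Lambda>, without \<delta>. The radius r gives B r \<le> \<alpha> / 8, and R + 2 C R = r keeps
    all iterates in the tube of radius r around \<open>zb\<close>.\<close>
  define \<Lambda> where "\<Lambda> = 16 * B / \<alpha> + 1"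
  define K where "K = 4 * (B * (1 + \<Lambda>))"
  define C where "C = 4 * \<Lambda> * exp K"
  define r where "r = min 1 (\<alpha> / (8 * B))"
  define R where "R = r / (1 + 2 * C)"
  have \<Lambda>1: "\<Lambda> \<ge> 1" using B1 \<alpha> by (auto simp: \<Lambda>_def)
  have "\<alpha> * \<Lambda> = 16 * B + \<alpha>" using \<alpha> by (simp add: \<Lambda>_def field_simps)
  then have \<Lambda>\<alpha>: "1 \<le> \<alpha> * \<Lambda>" and \<Lambda>B': "16 * B \<le> \<alpha> * \<Lambda>" using B1 \<alpha> by linarith+
  have K0: "K > 0" using B1 \<Lambda>1 by (simp add: K_def)
  have C4: "C \<ge> 4" unfolding C_def using \<Lambda>1 K0 one_le_exp_iff[of K]
    by (smt (verit, best) mult_le_cancel_left1 mult_le_cancel_right1)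
  have r0: "r > 0" and r1: "r \<le> 1" and rB: "B * r \<le> \<alpha> / 8"
    using \<alpha> B1 by (auto simp: r_def min_def field_simps)
  have R0: "R > 0" using r0 C4 by (simp add: R_def)
  have "R * (1 + 2 * C) = r" using C4 by (simp add: R_def)
  then have RC: "R + 2 * (C * R) = r" by (simp add: algebra_simps)
  show ?thesis
  proof (rule that[of C R])
    show "C > 0" "R > 0" using C4 R0 by auto
    fix x1 :: "real \<Rightarrow> real^'n" and u1 :: "real \<Rightarrow> real^'l" and v :: "real \<Rightarrow> real" and \<delta> :: real
    assume m: "x1 \<in> borel_measurable I01" "u1 \<in> borel_measurable I01" "v \<in> borel_measurable I01"
      and near: "\<And>t. t \<in> G \<Longrightarrow> norm ((x1 t, u1 t) - zb t) \<le> R" and \<delta>: "0 \<le> \<delta>" "\<delta> \<le> R"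
      and res1: "\<And>t. t \<in> {0..1} \<Longrightarrow> norm (x0 + (\<integral>s. indicator {0..t} s *\<^sub>R \<phi> s (x1 s, u1 s) \<partial>I01) - x1 t) \<le> \<delta>"
      and res2: "\<And>t. t \<in> G \<Longrightarrow> \<bar>g t (x1 t, u1 t) - v t\<bar> \<le> \<delta>"
    define a where "a t = 1 / Dg t (zb t) (0, axis i0 1)" for t
    define Z where "Z f t = (x1 t + fst (f t), u1 t + (\<Lambda> * snd (f t)) *\<^sub>R axis i0 1)" for f :: "real \<Rightarrow> (real^'n) \<times> real" and t
    define F where "F f t = (if t \<in> G then \<phi> t (Z f t) else 0)" for f t
    \<comment> \<open>Chord step s - a (g - v) with the derivative frozen at \<open>zb\<close>,
      written for the rescaled unknown s / \<Lambda>. Since a is nonzero on \<open>G\<close>, a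
      fixed point satisfies the constraint equation exactly.\<close>
    define T2 where "T2 f t = (if t \<in> G then snd (f t) - a t / \<Lambda> * (g t (Z f t) - v t) else 0)" for f t
    define T where "T f t = (if t \<in> {0..1} then (x0 + (\<integral>s. indicator {0..t} s *\<^sub>R F f s \<partial>I01) - x1 t, T2 f t) else 0)" for f t
    define \<omega> where "\<omega> t = (if t \<in> {0..1} then exp (K * t) else 0)" for t
    have \<omega>0: "0 \<le> \<omega> t" and \<omega>K: "\<omega> t \<le> exp K" for t using K0 by (auto simp: \<omega>_def)
    have \<omega>1: "1 \<le> \<omega> t" if "t \<in> {0..1}" for t using that K0 by (auto simp: \<omega>_def)
    have aa: "a t * Dg t (zb t) (0, axis i0 1) = 1" "\<bar>a t\<bar> \<le> 1 / \<alpha>" "a t \<noteq> 0" if "t \<in> G" for t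
      using nondegenerate_zb[OF that] \<alpha> by (auto simp: a_def field_simps)
    have small: "norm (f t) \<le> C * \<delta> / \<Lambda>" if "\<And>t. norm (f t) \<le> 2 * (2 * \<delta>) * \<omega> t" for f :: "real \<Rightarrow> (real^'n) \<times> real" and t
    proof -
      have "norm (f t) \<le> 4 * \<delta> * exp K" using that[of t] mult_left_mono[OF \<omega>K[of t], of "4 * \<delta>"] \<delta> by simp
      then show ?thesis using \<Lambda>1 by (simp add: C_def mult.commute mult.left_commute)
    qed
    have Zd: "norm (Z f t - Z h t) \<le> norm (fst (f t - h t)) + \<Lambda> * \<bar>snd (f t - h t)\<bar>" for f h t
    proof -
      have "Z f t - Z h t = (fst (f t - h t), (\<Lambda> * snd (f t - h t)) *\<^sub>R axis i0 1)"
        by (simp add: Z_def scaleR_diff_left[symmetric] right_diff_distrib[symmetric])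
      then show ?thesis using norm_fst_snd_le(3)[of "fst (f t - h t)" "(\<Lambda> * snd (f t - h t)) *\<^sub>R axis i0 1 :: real^'l"] \<Lambda>1
        by (simp add: norm_axis_one abs_mult)
    qed
    have Ztube: "norm (Z f t - zb t) \<le> r" if f: "\<And>t. norm (f t) \<le> 2 * (2 * \<delta>) * \<omega> t" and t: "t \<in> G" for f t
    proof -
      have "norm (Z f t - zb t) \<le> norm ((x1 t, u1 t) - zb t) + norm (Z f t - Z (\<lambda>t. 0) t)"
      proof -
        have "(x1 t, u1 t) = Z (\<lambda>t. 0) t" by (simp add: Z_def)
        then show ?thesis using norm_triangle_ineq[of "Z (\<lambda>t. 0) t - zb t" "Z f t - Z (\<lambda>t. 0) t"] by simp
      qed
      also have "\<dots> \<le> R + (norm (fst (f t)) + \<Lambda> * \<bar>snd (f t)\<bar>)" using near[OF t] Zd[of f t "\<lambda>t. 0"] by simp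
      also have "norm (fst (f t)) + \<Lambda> * \<bar>snd (f t)\<bar> \<le> \<Lambda> * norm (f t) + \<Lambda> * norm (f t)"
      proof (rule add_mono)
        show "norm (fst (f t)) \<le> \<Lambda> * norm (f t)"
          using norm_fst_snd_le(1)[of "f t"] mult_right_mono[OF \<Lambda>1 norm_ge_zero[of "f t"]] by simp
        show "\<Lambda> * \<bar>snd (f t)\<bar> \<le> \<Lambda> * norm (f t)" using norm_fst_snd_le(2)[of "f t"] \<Lambda>1 by (intro mult_left_mono) auto
      qed
      also have "\<Lambda> * norm (f t) \<le> C * \<delta>" using small[OF f, of t] \<Lambda>1 by (simp add: field_simps)
      also have "C * \<delta> \<le> C * R" using \<delta> C4 by (intro mult_left_mono) auto
      finally show ?thesis using RC by simp
    qed
    have ZM: "norm (Z f t) \<le> M" if "\<And>t. norm (f t) \<le> 2 * (2 * \<delta>) * \<omega> t" and "t \<in> G" for f t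
      using Ztube[OF that] zb_norm(1)[OF that(2)] r1 norm_triangle_sub[of "Z f t" "zb t"] by linarith
    have Zm: "Z f \<in> borel_measurable I01" if "f \<in> borel_measurable I01" for f
      unfolding Z_def using m measurable_fst_comp[OF that]
      by (intro borel_measurable_Pair borel_measurable_add borel_measurable_scaleR borel_measurable_times borel_measurable_const)
    note [measurable] = Ls.G_sets
    have Fm: "F f \<in> borel_measurable I01" if "f \<in> borel_measurable I01" for f
    proof -
      have [measurable]: "(\<lambda>t. \<phi> t (Z f t)) \<in> borel_measurable I01" using Zm[OF that] by (rule Ps.comp_measurable)
      have "(\<lambda>t. indicator G t *\<^sub>R \<phi> t (Z f t)) \<in> borel_measurable I01" by measurable
      moreover have "F f = (\<lambda>t. indicator G t *\<^sub>R \<phi> t (Z f t))" by (auto simp: F_def)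
      ultimately show ?thesis by simp
    qed
    have Fb: "norm (F f t) \<le> B" if "\<And>t. norm (f t) \<le> 2 * (2 * \<delta>) * \<omega> t" for f t
      using Ps.bound(1)[OF _ ZM[OF that]] B1 by (auto simp: F_def)
    have T2m: "T2 f \<in> borel_measurable I01" if f: "f \<in> borel_measurable I01" for f
    proof -
      have [measurable]: "(\<lambda>t. g t (Z f t)) \<in> borel_measurable I01" using Zm[OF that] by (rule Gs.comp_measurable)
      have [measurable]: "(\<lambda>t. Dg t (zb t) (0, axis i0 1)) \<in> borel_measurable I01"
        by (intro Gs.D_measurable zb_meas borel_measurable_const)
      note [measurable] = m(3) measurable_fst_comp(2)[OF f]
      have "(\<lambda>t. indicator G t * (snd (f t) - a t / \<Lambda> * (g t (Z f t) - v t))) \<in> borel_measurable I01"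
        unfolding a_def by measurable
      moreover have "T2 f = (\<lambda>t. indicator G t * (snd (f t) - a t / \<Lambda> * (g t (Z f t) - v t)))" by (auto simp: T2_def)
      ultimately show ?thesis by simp
    qed
    obtain f where f: "f \<in> borel_measurable I01" "\<And>t. norm (f t) \<le> 2 * (2 * \<delta>) * \<omega> t" "T f = f"
    proof (rule weighted_contraction_fixpoint[of "\<lambda>f. f \<in> borel_measurable I01" "2 * \<delta>" \<omega> T])
      show "T f \<in> borel_measurable I01" if f: "f \<in> borel_measurable I01" "\<And>t. norm (f t) \<le> 2 * (2 * \<delta>) * \<omega> t" for f
      proof -
        have "(\<lambda>t. \<integral>s. indicator {0..t} s *\<^sub>R F f s \<partial>I01) \<in> borel_measurable I01"
          using Fm[OF f(1)] Fb[OF f(2)] by (intro initial_integral_measurable(2)[where C=B]) auto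
        then have "(\<lambda>t. (x0 + (\<integral>s. indicator {0..t} s *\<^sub>R F f s \<partial>I01) - x1 t, T2 f t)) \<in> borel_measurable I01"
          using m T2m[OF f(1)] by (intro borel_measurable_Pair borel_measurable_add borel_measurable_diff borel_measurable_const)
        then show ?thesis
          by (subst measurable_lebesgue_cong[where g="\<lambda>t. (x0 + (\<integral>s. indicator {0..t} s *\<^sub>R F f s \<partial>I01) - x1 t, T2 f t)"]) (auto simp: T_def)
      qed
      show "f \<in> borel_measurable I01" if "\<And>k::nat. U k \<in> borel_measurable I01" "\<And>t. (\<lambda>k. U k t) \<longlonglongrightarrow> f t"
        for U and f :: "real \<Rightarrow> (real^'n) \<times> real"
        using borel_measurable_LIMSEQ_metric[of U I01 f] that by auto
      show "norm (T f t - T h t) \<le> c / 2 * \<omega> t"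
        if fm: "f \<in> borel_measurable I01" and hm: "h \<in> borel_measurable I01"
          and fb: "\<And>t. norm (f t) \<le> 2 * (2 * \<delta>) * \<omega> t" and hb: "\<And>t. norm (h t) \<le> 2 * (2 * \<delta>) * \<omega> t" and c: "0 \<le> c"
          and d: "\<And>t. norm (f t - h t) \<le> c * \<omega> t" for f h c t
      proof (cases "t \<in> {0..1}")
        case True
        have ii: "integrable I01 (F f)" "integrable I01 (F h)"
          using integrable_I01_bounded[OF Fm[OF fm], of B] integrable_I01_bounded[OF Fm[OF hm], of B] Fb[OF fb] Fb[OF hb] by auto
        have d1: "norm (fst (f s - h s)) \<le> c * \<omega> s" "\<bar>snd (f s - h s)\<bar> \<le> c * \<omega> s" for s
          using norm_fst_snd_le(1,2)[of "f s - h s"] d[of s] by auto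
        have "norm ((x0 + (\<integral>s. indicator {0..t} s *\<^sub>R F f s \<partial>I01) - x1 t) - (x0 + (\<integral>s. indicator {0..t} s *\<^sub>R F h s \<partial>I01) - x1 t))
            = norm (\<integral>s. indicator {0..t} s *\<^sub>R (F f s - F h s) \<partial>I01)"
          using integrable_I01_interval[OF ii(1)] integrable_I01_interval[OF ii(2)] by (simp add: scaleR_diff_right)
        also have "\<dots> \<le> (B * (1 + \<Lambda>) * c) / K * exp (K * t)"
        proof (rule integral_exp_bound_forward)
          fix s :: real assume s: "s \<in> {0..1}"
          show "norm (F f s - F h s) \<le> (B * (1 + \<Lambda>) * c) * exp (K * s)"
          proof (cases "s \<in> G")
            case sG: True
            have "norm (F f s - F h s) \<le> B * norm (Z f s - Z h s)"
              using Ps.lipschitz[OF sG ZM[OF fb sG] ZM[OF hb sG]] sG by (simp add: F_def)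
            also have "\<dots> \<le> B * (c * \<omega> s + \<Lambda> * (c * \<omega> s))"
              using order_trans[OF Zd[of f s h] add_mono[OF d1(1)[of s] mult_left_mono[OF d1(2)[of s], of \<Lambda>]]] \<Lambda>1 B1
              by (intro mult_left_mono) auto
            finally show ?thesis using s by (simp add: \<omega>_def algebra_simps)
          qed (use B1 \<Lambda>1 c in \<open>simp add: F_def\<close>)
        qed (use True K0 B1 \<Lambda>1 c in auto)
        also have "\<dots> = c / 4 * \<omega> t" using True K0 B1 \<Lambda>1 by (simp add: K_def \<omega>_def)
        finally have p1: "norm ((x0 + (\<integral>s. indicator {0..t} s *\<^sub>R F f s \<partial>I01) - x1 t) - (x0 + (\<integral>s. indicator {0..t} s *\<^sub>R F h s \<partial>I01) - x1 t)) \<le> c / 4 * \<omega> t" .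
        have p2: "\<bar>T2 f t - T2 h t\<bar> \<le> c / 4 * \<omega> t"
        proof (cases "t \<in> G")
          case tG: True
          define y where "y = fst (f t - h t)"
          define s where "s = snd (f t - h t)"
          have Zeq: "Z f t - Z h t = (y, 0) + (\<Lambda> * s) *\<^sub>R (0, axis i0 1)"
            by (simp add: Z_def y_def s_def scaleR_diff_left[symmetric] right_diff_distrib[symmetric])
          define er where "er = g t (Z f t) - g t (Z h t) - Dg t (zb t) (Z f t - Z h t)"
          have er: "\<bar>er\<bar> \<le> norm (Z f t - Z h t) * (B * r)"
            using Gs.linearization_bound[OF tG _ Ztube[OF fb tG] Ztube[OF hb tG]] zb_norm(1)[OF tG] r1 by (simp add: er_def)
          have geq: "g t (Z f t) - g t (Z h t) = er + Dg t (zb t) (y, 0) + \<Lambda> * s * Dg t (zb t) (0, axis i0 1)"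
            unfolding er_def Zeq by (simp only: blinfun.add_right blinfun.scaleR_right) simp
          have "T2 f t - T2 h t = s - a t / \<Lambda> * (g t (Z f t) - g t (Z h t))"
            using tG by (simp add: T2_def s_def right_diff_distrib)
          also note geq
          also have "s - a t / \<Lambda> * (er + Dg t (zb t) (y, 0) + \<Lambda> * s * Dg t (zb t) (0, axis i0 1)) = s - s * (a t * Dg t (zb t) (0, axis i0 1)) - a t / \<Lambda> * (er + Dg t (zb t) (y, 0))"
            using \<Lambda>1 by (simp add: field_simps)
          also have "\<dots> = - (a t / \<Lambda> * (er + Dg t (zb t) (y, 0)))" using aa(1)[OF tG] by simp
          finally have "\<bar>T2 f t - T2 h t\<bar> = \<bar>a t\<bar> / \<Lambda> * \<bar>er + Dg t (zb t) (y, 0)\<bar>"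
            using \<Lambda>1 by (simp add: abs_mult)
          also have "\<dots> \<le> (1 / \<alpha>) / \<Lambda> * ((norm y + \<Lambda> * \<bar>s\<bar>) * (B * r) + B * norm y)"
          proof (intro mult_mono divide_right_mono aa(2)[OF tG])
            have "\<bar>er\<bar> \<le> (norm y + \<Lambda> * \<bar>s\<bar>) * (B * r)"
              using order_trans[OF er mult_right_mono[OF Zd[of f t h], of "B * r"]] B1 r0 by (simp add: y_def s_def)
            moreover have "\<bar>Dg t (zb t) (y, 0)\<bar> \<le> B * norm y" using D_bound(3)[OF tG, of "(y, 0)"] by (simp add: norm_Pair)
            ultimately show "\<bar>er + Dg t (zb t) (y, 0)\<bar> \<le> (norm y + \<Lambda> * \<bar>s\<bar>) * (B * r) + B * norm y" by linarith
          qed (use \<Lambda>1 \<alpha> in auto)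
          \<comment> \<open>The subtracted term restores the factor B r for the y part, so B r \<le>
            \<alpha> / 8 is spent on the \<Lambda> part alone, where it yields 1/8. What remains is
            at most 2 B / (\<alpha> \<Lambda>) \<le> 1/8.\<close>
          also have "\<dots> \<le> (1 / \<alpha>) / \<Lambda> * ((c * \<omega> t + \<Lambda> * (c * \<omega> t)) * (\<alpha> / 8) + B * (c * \<omega> t) - (\<alpha> / 8 - B * r) * (c * \<omega> t))"
          proof (rule mult_left_mono)
            have "(norm y + \<Lambda> * \<bar>s\<bar>) * (B * r) + B * norm y = norm y * (B * r) + \<Lambda> * \<bar>s\<bar> * (B * r) + B * norm y"
              by (simp add: algebra_simps)
            also have "\<dots> \<le> (c * \<omega> t) * (B * r) + \<Lambda> * (c * \<omega> t) * (\<alpha> / 8) + B * (c * \<omega> t)"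
              using d1[of t] B1 r0 \<Lambda>1 c \<omega>0[of t] rB \<alpha>
              by (intro add_mono mult_mono) (auto simp: y_def s_def)
            finally show "(norm y + \<Lambda> * \<bar>s\<bar>) * (B * r) + B * norm y
              \<le> (c * \<omega> t + \<Lambda> * (c * \<omega> t)) * (\<alpha> / 8) + B * (c * \<omega> t) - (\<alpha> / 8 - B * r) * (c * \<omega> t)" by (simp add: algebra_simps)
          qed (use \<Lambda>1 \<alpha> in auto)
          also have "\<dots> = (c * \<omega> t) * ((\<Lambda> * (\<alpha> / 8) + B * r + B) / (\<alpha> * \<Lambda>))"
            using \<alpha> \<Lambda>1 by (simp add: field_simps)
          also have "\<dots> \<le> (c * \<omega> t) * (1 / 4)"
          proof (rule mult_left_mono)
            have "B * r \<le> B" using B1 r1 by (simp add: mult_left_le)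
            then have "\<Lambda> * (\<alpha> / 8) + B * r + B \<le> (\<alpha> * \<Lambda>) / 4" using \<Lambda>B' by (simp add: mult.commute[of \<Lambda>])
            moreover have "0 < \<alpha> * \<Lambda>" using \<alpha> \<Lambda>1 by simp
            ultimately show "(\<Lambda> * (\<alpha> / 8) + B * r + B) / (\<alpha> * \<Lambda>) \<le> 1 / 4" by (simp add: pos_divide_le_eq)
          qed (use c \<omega>0[of t] in auto)
          finally show ?thesis by simp
        qed (use c \<omega>0[of t] in \<open>simp add: T2_def\<close>)
        have "norm (T f t - T h t) \<le> c / 4 * \<omega> t + c / 4 * \<omega> t"
          using True p1 p2 norm_fst_snd_le(3)[of "(x0 + (\<integral>s. indicator {0..t} s *\<^sub>R F f s \<partial>I01) - x1 t) - (x0 + (\<integral>s. indicator {0..t} s *\<^sub>R F h s \<partial>I01) - x1 t)" "T2 f t - T2 h t"]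
          by (simp add: T_def)
        then show ?thesis by simp
      qed (auto simp: T_def \<omega>_def)
      show "norm (T (\<lambda>t. 0) t) \<le> 2 * \<delta> * \<omega> t" for t
      proof (cases "t \<in> {0..1}")
        case True
        have Z0: "Z (\<lambda>t. 0) s = (x1 s, u1 s)" for s by (simp add: Z_def)
        have "(\<integral>s. indicator {0..t} s *\<^sub>R F (\<lambda>t. 0) s \<partial>I01) = (\<integral>s. indicator {0..t} s *\<^sub>R \<phi> s (x1 s, u1 s) \<partial>I01)"
        proof (rule integral_cong_AE)
          have [measurable]: "F (\<lambda>t. 0) \<in> borel_measurable I01" by (rule Fm) simp
          have [measurable]: "(\<lambda>s. \<phi> s (x1 s, u1 s)) \<in> borel_measurable I01" using m by (intro Ps.comp_measurable borel_measurable_Pair)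
          show "(\<lambda>s. indicator {0..t} s *\<^sub>R F (\<lambda>t. 0) s) \<in> borel_measurable I01"
            "(\<lambda>s. indicator {0..t} s *\<^sub>R \<phi> s (x1 s, u1 s)) \<in> borel_measurable I01"
            unfolding indicator_def by measurable
          show "AE s in I01. indicator {0..t} s *\<^sub>R F (\<lambda>t. 0) s = indicator {0..t} s *\<^sub>R \<phi> s (x1 s, u1 s)"
            using Ls.G_AE by eventually_elim (simp add: F_def Z0)
        qed
        then have 1: "norm (x0 + (\<integral>s. indicator {0..t} s *\<^sub>R F (\<lambda>t. 0) s \<partial>I01) - x1 t) \<le> \<delta>" using res1[OF True] by simp
        have 2: "\<bar>T2 (\<lambda>t. 0) t\<bar> \<le> \<delta>"
        proof (cases "t \<in> G")
          case tG: True
          have "\<bar>T2 (\<lambda>t. 0) t\<bar> = \<bar>a t\<bar> / \<Lambda> * \<bar>g t (x1 t, u1 t) - v t\<bar>" using tG \<Lambda>1 by (simp add: T2_def Z0 abs_mult)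
          also have "\<dots> \<le> 1 * \<delta>"
          proof (rule mult_mono[OF _ res2[OF tG]])
            have "\<bar>a t\<bar> \<le> 1 / \<alpha>" using aa(2)[OF tG] .
            also have "\<dots> \<le> \<Lambda>" using \<Lambda>\<alpha> \<alpha> by (simp add: field_simps)
            finally show "\<bar>a t\<bar> / \<Lambda> \<le> 1" using \<Lambda>1 by simp
          qed auto
          finally show ?thesis by simp
        qed (use \<delta> in \<open>simp add: T2_def\<close>)
        have "norm (T (\<lambda>t. 0) t) \<le> \<delta> + \<delta>"
          using 1 2 True norm_fst_snd_le(3)[of "x0 + (\<integral>s. indicator {0..t} s *\<^sub>R F (\<lambda>t. 0) s \<partial>I01) - x1 t" "T2 (\<lambda>t. 0) t"] by (simp add: T_def)
        also have "\<dots> \<le> 2 * \<delta> * \<omega> t" using mult_left_mono[OF \<omega>1[OF True], of "2 * \<delta>"] \<delta> by simp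
        finally show ?thesis .
      qed (auto simp: T_def \<omega>_def)
    qed (use \<omega>0 \<delta> in auto)
    have f1: "fst (f t) = x0 + (\<integral>s. indicator {0..t} s *\<^sub>R F f s \<partial>I01) - x1 t" "snd (f t) = T2 f t" if "t \<in> {0..1}" for t
      using arg_cong[OF fun_cong[OF f(3), of t], of fst] arg_cong[OF fun_cong[OF f(3), of t], of snd] that by (simp_all add: T_def)
    define y where "y t = fst (f t)" for t
    define s where "s t = \<Lambda> * snd (f t)" for t
    have Zf: "Z f t = (x1 t + y t, u1 t + s t *\<^sub>R axis i0 1)" for t by (simp add: Z_def y_def s_def)
    show "\<exists>y s. y \<in> borel_measurable I01 \<and> s \<in> borel_measurable I01 \<and>
        (\<forall>t\<in>{0..1}. x1 t + y t = x0 + (\<integral>r. indicator {0..t} r *\<^sub>R \<phi> r (x1 r + y r, u1 r + s r *\<^sub>R axis i0 1) \<partial>I01)) \<and>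
        (\<forall>t\<in>G. g t (x1 t + y t, u1 t + s t *\<^sub>R axis i0 1) = v t) \<and>
        (\<forall>t. norm (y t) \<le> C * \<delta> \<and> \<bar>s t\<bar> \<le> C * \<delta>)"
    proof (intro exI[of _ y] exI[of _ s] conjI ballI allI)
      show "y \<in> borel_measurable I01" "s \<in> borel_measurable I01"
        unfolding y_def s_def using measurable_fst_comp[OF f(1)] by auto
      fix t :: real
      have nf: "\<Lambda> * norm (f t) \<le> C * \<delta>" using small[OF f(2), of t] \<Lambda>1 by (simp add: field_simps)
      show "norm (y t) \<le> C * \<delta>"
        using norm_fst_snd_le(1)[of "f t"] mult_right_mono[OF \<Lambda>1 norm_ge_zero[of "f t"]] nf by (simp add: y_def)
      show "\<bar>s t\<bar> \<le> C * \<delta>"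
      proof -
        have "\<bar>s t\<bar> = \<Lambda> * norm (snd (f t))" using \<Lambda>1 by (simp add: s_def abs_mult)
        also have "\<dots> \<le> \<Lambda> * norm (f t)" using norm_fst_snd_le(2)[of "f t"] \<Lambda>1 by (intro mult_left_mono) auto
        finally show ?thesis using nf by linarith
      qed
      show "g t (x1 t + y t, u1 t + s t *\<^sub>R axis i0 1) = v t" if "t \<in> G"
        using f1(2)[OF G_subset[OF that]] aa(3)[OF that] \<Lambda>1 that by (simp add: T2_def Zf)
      assume t: "t \<in> {0..1}"
      have "(\<integral>r. indicator {0..t} r *\<^sub>R F f r \<partial>I01) = (\<integral>r. indicator {0..t} r *\<^sub>R \<phi> r (x1 r + y r, u1 r + s r *\<^sub>R axis i0 1) \<partial>I01)"
      proof (rule integral_cong_AE)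
        note [measurable] = Fm[OF f(1)]
        have [measurable]: "(\<lambda>r. \<phi> r (x1 r + y r, u1 r + s r *\<^sub>R axis i0 1)) \<in> borel_measurable I01"
          using Ps.comp_measurable[OF Zm[OF f(1)]] by (simp add: Zf)
        show "(\<lambda>r. indicator {0..t} r *\<^sub>R F f r) \<in> borel_measurable I01"
            "(\<lambda>r. indicator {0..t} r *\<^sub>R \<phi> r (x1 r + y r, u1 r + s r *\<^sub>R axis i0 1)) \<in> borel_measurable I01"
          unfolding indicator_def by measurable
        show "AE r in I01. indicator {0..t} r *\<^sub>R F f r = indicator {0..t} r *\<^sub>R \<phi> r (x1 r + y r, u1 r + s r *\<^sub>R axis i0 1)"
          using Ls.G_AE by eventually_elim (simp add: F_def Zf)
      qed
      then show "x1 t + y t = x0 + (\<integral>r. indicator {0..t} r *\<^sub>R \<phi> r (x1 r + y r, u1 r + s r *\<^sub>R axis i0 1) \<partial>I01)"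
        using f1(1)[OF t] by (simp add: y_def)
    qed
  qed
qed

end

section \<open>Second-order expansion of the cost\<close>

context control_problem
begin

lemma integrable_bounded_on_G:
  fixes f :: "real \<Rightarrow> 'b::euclidean_space"
  assumes "f \<in> borel_measurable I01" "\<And>t. t \<in> G \<Longrightarrow> norm (f t) \<le> C"
  shows "integrable I01 f"
proof (rule integrable_I01_bounded[OF assms(1)])
  show "AE t in I01. norm (f t) \<le> C" using Ls.G_AE by eventually_elim (rule assms(2))
qed

lemma integrable_HD:
  assumes "d \<in> borel_measurable I01" "\<And>t. t \<in> G \<Longrightarrow> norm (d t) \<le> N"
  shows "integrable I01 (\<lambda>t. HD k t (d t))"
proof -
  obtain C where C: "C \<ge> 1" "\<And>k t d. t \<in> G \<Longrightarrow> \<bar>HD k t d\<bar> \<le> C * norm d" using multiplier_bounds by metis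
  show ?thesis
  proof (rule integrable_bounded_on_G[OF HD_measurable[OF assms(1)]])
    fix t assume t: "t \<in> G"
    show "norm (HD k t (d t)) \<le> C * N"
      using C(2)[OF t, of k "d t"] mult_left_mono[OF assms(2)[OF t] order_trans[OF zero_le_one C(1)]]
      unfolding real_norm_def by linarith
  qed
qed

lemma integrable_HD2:
  assumes "d \<in> borel_measurable I01" "\<And>t. t \<in> G \<Longrightarrow> norm (d t) \<le> N"
  shows "integrable I01 (\<lambda>t. HD2 k t (d t) (d t))"
proof -
  obtain C where C: "C \<ge> 1" "\<And>k t d e. t \<in> G \<Longrightarrow> \<bar>HD2 k t d e\<bar> \<le> C * norm d * norm e" using multiplier_bounds by metis
  show ?thesis
  proof (rule integrable_bounded_on_G[OF HD2_measurable[OF assms(1) assms(1)]])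
    fix t assume t: "t \<in> G"
    have N0: "0 \<le> N" using assms(2)[OF t] by (rule order_trans[OF norm_ge_zero])
    have "C * norm (d t) * norm (d t) \<le> C * N * N"
      using assms(2)[OF t] C(1) N0 by (intro mult_mono) auto
    then show "norm (HD2 k t (d t) (d t)) \<le> C * N * N" using C(2)[OF t, of k "d t" "d t"] by simp
  qed
qed

lemma integrable_\<theta>:
  assumes "f \<in> borel_measurable I01" "\<And>t. t \<in> G \<Longrightarrow> \<bar>f t\<bar> \<le> N"
  shows "integrable I01 (\<lambda>t. \<theta> k t * f t)"
proof -
  obtain C where C: "C \<ge> 1" "\<And>k t. \<bar>\<theta> k t\<bar> \<le> C" using multiplier_bounds by metis
  show ?thesis
  proof (rule integrable_bounded_on_G)
    show "(\<lambda>t. \<theta> k t * f t) \<in> borel_measurable I01" by (intro borel_measurable_times \<theta>_measurable assms)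
    fix t assume t: "t \<in> G"
    show "norm (\<theta> k t * f t) \<le> C * N"
      using mult_mono[OF C(2)[of k t] assms(2)[OF t]] C(1) by (simp add: abs_mult)
  qed
qed

lemma integrable_adj:
  assumes "f \<in> borel_measurable I01" "\<And>t. t \<in> G \<Longrightarrow> norm (f t) \<le> N"
  shows "integrable I01 (\<lambda>t. adj k t \<bullet> f t)"
proof -
  obtain C where C: "C \<ge> 1" "\<And>k t. norm (adj k t) \<le> C" using multiplier_bounds by metis
  show ?thesis
  proof (rule integrable_bounded_on_G)
    show "(\<lambda>t. adj k t \<bullet> f t) \<in> borel_measurable I01" by (intro borel_measurable_inner adj_measurable assms)
    fix t assume t: "t \<in> G"
    show "norm (adj k t \<bullet> f t) \<le> C * N"
      using Cauchy_Schwarz_ineq2[of "adj k t" "f t"] mult_mono[OF C(2)[of k t] assms(2)[OF t]] C(1) by simp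
  qed
qed

lemma integrable_DL:
  assumes "d \<in> borel_measurable I01" "\<And>t. t \<in> G \<Longrightarrow> norm (d t) \<le> N"
  shows "integrable I01 (\<lambda>t. DL t (zb t) (d t) $ k)"
proof (rule integrable_bounded_on_G)
  have "(\<lambda>t. DL t (zb t) (d t) \<bullet> axis k 1) \<in> borel_measurable I01"
    by (intro borel_measurable_inner borel_measurable_const Ls.D_measurable zb_meas assms)
  then show "(\<lambda>t. DL t (zb t) (d t) $ k) \<in> borel_measurable I01" by (simp add: inner_axis)
  fix t assume t: "t \<in> G"
  have "\<bar>DL t (zb t) (d t) $ k\<bar> \<le> B * norm (d t)" using component_le_norm_cart D_bound(1)[OF t] by (rule order_trans)
  also have "\<dots> \<le> B * N" using assms(2)[OF t] B1 by (intro mult_left_mono) auto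
  finally show "norm (DL t (zb t) (d t) $ k) \<le> B * N" by simp
qed

lemma integrable_comp_L:
  assumes "z \<in> borel_measurable I01" "\<And>t. t \<in> G \<Longrightarrow> norm (z t) \<le> M"
  shows "integrable I01 (\<lambda>t. L t (z t) $ k)"
proof (rule integrable_bounded_on_G)
  have "(\<lambda>t. L t (z t) \<bullet> axis k 1) \<in> borel_measurable I01"
    by (intro borel_measurable_inner borel_measurable_const Ls.comp_measurable assms)
  then show "(\<lambda>t. L t (z t) $ k) \<in> borel_measurable I01" by (simp add: inner_axis)
  show "norm (L t (z t) $ k) \<le> B" if "t \<in> G" for t
    using component_le_norm_cart[of "L t (z t)" k] Ls.bound(1)[OF that assms(2)[OF that]] by simp
qed

text \<open>When \<open>HD k t (x t, u t)\<close> is split into state and control parts, the state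
  part cancels against the adjoint term by \<open>adjoint_by_parts\<close>. The left side is the
  order \<epsilon> term that arises from expanding the Hamiltonian; the right side is the quantity
  that critical directions make nonpositive.\<close>

lemma first_variation:
  assumes x: "continuous_on {0..1} x" and u: "u \<in> borel_measurable I01"
    and bd: "\<And>t. t \<in> G \<Longrightarrow> norm (x t, u t) \<le> N"
    and lin: "\<And>t. t \<in> {0..1} \<Longrightarrow> x t = (\<integral>s. indicator {0..t} s *\<^sub>R D\<phi> s (zb s) (x s, u s) \<partial>I01)"
  shows "(\<integral>t. HD k t (0, u t) - \<theta> k t * Dg t (zb t) (x t, u t) \<partial>I01) = (\<integral>t. DL t (zb t) (x t, u t) $ k \<partial>I01)"
proof -
  have dm: "(\<lambda>t. (x t, u t)) \<in> borel_measurable I01" using continuous_on_measurable_I01[OF x] u by (rule borel_measurable_Pair)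
  have bm: "(\<lambda>t. D\<phi> t (zb t) (x t, u t)) \<in> borel_measurable I01" by (intro Ps.D_measurable zb_meas dm)
  have bb: "norm (D\<phi> t (zb t) (x t, u t)) \<le> B * N" if "t \<in> G" for t
    using D_bound(2)[OF that, of "(x t, u t)"] mult_left_mono[OF bd[OF that] order_trans[OF zero_le_one B1]] by linarith
  have ba: "AE t in I01. norm (D\<phi> t (zb t) (x t, u t)) \<le> B * N" using Ls.G_AE by eventually_elim (rule bb)
  have xb': "norm (x t, 0 :: real^'l) \<le> N" if "t \<in> G" for t
  proof -
    have "norm (x t) \<le> norm (x t, u t)" using norm_fst_snd_le(1)[of "(x t, u t)"] by simp
    then show ?thesis using bd[OF that] unfolding norm_Pair[of _ 0] by simp
  qed
  have xm: "(\<lambda>t. (x t, 0 :: real^'l)) \<in> borel_measurable I01" using continuous_on_measurable_I01[OF x] by (intro borel_measurable_Pair) auto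
  have "(\<integral>t. HD k t (0, u t) - \<theta> k t * Dg t (zb t) (x t, u t) \<partial>I01)
     = (\<integral>t. DL t (zb t) (x t, u t) $ k + adj k t \<bullet> D\<phi> t (zb t) (x t, u t) - HD k t (x t, 0) \<partial>I01)"
  proof (rule Bochner_Integration.integral_cong[OF refl])
    fix t
    have "HD k t (x t, u t) = HD k t (x t, 0) + HD k t (0, u t)" using HD_add[of k t "(x t, 0)" "(0, u t)"] by simp
    then show "HD k t (0, u t) - \<theta> k t * Dg t (zb t) (x t, u t)
      = DL t (zb t) (x t, u t) $ k + adj k t \<bullet> D\<phi> t (zb t) (x t, u t) - HD k t (x t, 0)" by (simp add: HD_def)
  qed
  also have "\<dots> = (\<integral>t. DL t (zb t) (x t, u t) $ k \<partial>I01) + (\<integral>t. adj k t \<bullet> D\<phi> t (zb t) (x t, u t) \<partial>I01) - (\<integral>t. HD k t (x t, 0) \<partial>I01)"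
    using integrable_DL[OF dm bd] integrable_adj[OF bm bb] integrable_HD[OF xm xb'] by simp
  also have "(\<integral>t. adj k t \<bullet> D\<phi> t (zb t) (x t, u t) \<partial>I01) = (\<integral>t. HD k t (x t, 0) \<partial>I01)"
    using bm ba lin by (rule adjoint_by_parts)
  finally show ?thesis by simp
qed

text \<open>The cross terms have order \<epsilon> times \<epsilon>^2 and the square of \<rho> has
  order \<epsilon>^4, so a perturbation known only to have size \<epsilon>^2 leaves the coefficient
  of \<epsilon>^2 intact.\<close>

lemma HD2_expand:
  assumes t: "t \<in> G" and C: "\<And>d e. \<bar>HD2 k t d e\<bar> \<le> C * norm d * norm e" and d: "norm d \<le> N" and \<rho>: "norm \<rho> \<le> \<epsilon>\<^sup>2 * P"
    and "0 \<le> \<epsilon>" "\<epsilon> \<le> 1" "0 \<le> C" "0 \<le> P"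
  shows "HD2 k t (\<epsilon> *\<^sub>R d + \<rho>) (\<epsilon> *\<^sub>R d + \<rho>) \<le> \<epsilon>\<^sup>2 * HD2 k t d d + C * (2 * N * P + P\<^sup>2) * \<epsilon> ^ 3"
proof -
  have N0: "0 \<le> N" using d by (rule order_trans[OF norm_ge_zero])
  have "HD2 k t (\<epsilon> *\<^sub>R d + \<rho>) (\<epsilon> *\<^sub>R d + \<rho>) = \<epsilon>\<^sup>2 * HD2 k t d d + \<epsilon> * (HD2 k t d \<rho> + HD2 k t \<rho> d) + HD2 k t \<rho> \<rho>"
    by (simp add: HD2_def blinfun.add_left blinfun.add_right blinfun.scaleR_left blinfun.scaleR_right inner_add_right
        algebra_simps power2_eq_square)
  also have "\<dots> \<le> \<epsilon>\<^sup>2 * HD2 k t d d + \<epsilon> * (C * N * (\<epsilon>\<^sup>2 * P) + C * (\<epsilon>\<^sup>2 * P) * N) + C * (\<epsilon>\<^sup>2 * P) * (\<epsilon>\<^sup>2 * P)"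
  proof -
    have le: "HD2 k t a b \<le> C * A * A'" if "norm a \<le> A" "norm b \<le> A'" "0 \<le> A" for a b A A'
    proof -
      have "C * norm a * norm b \<le> C * A * A'" using that assms(7) by (intro mult_mono) auto
      then show ?thesis using C[of a b] by linarith
    qed
    have "HD2 k t d \<rho> \<le> C * N * (\<epsilon>\<^sup>2 * P)" "HD2 k t \<rho> d \<le> C * (\<epsilon>\<^sup>2 * P) * N" "HD2 k t \<rho> \<rho> \<le> C * (\<epsilon>\<^sup>2 * P) * (\<epsilon>\<^sup>2 * P)"
      using d \<rho> N0 assms(8) by (auto intro!: le)
    then show ?thesis using assms(5) by (intro add_mono mult_left_mono order_refl) auto
  qed
  also have "\<dots> = \<epsilon>\<^sup>2 * HD2 k t d d + C * (2 * N * P) * \<epsilon> ^ 3 + C * P\<^sup>2 * (\<epsilon> ^ 3 * \<epsilon>)"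
    by (simp add: algebra_simps power2_eq_square power3_eq_cube)
  also have "C * P\<^sup>2 * (\<epsilon> ^ 3 * \<epsilon>) \<le> C * P\<^sup>2 * (\<epsilon> ^ 3 * 1)"
    using assms by (intro mult_left_mono) auto
  finally show ?thesis by (simp add: algebra_simps)
qed

text \<open>The cubic remainders of L, \<phi> and g are weighted by 1, the adjoint state and
  \<theta>, whence B + 2 C B. The increments on the left stay actual differences: that of \<phi>
  will be integrated by parts and that of g is prescribed.\<close>

lemma lagrangian_taylor:
  assumes t: "t \<in> G" and d: "norm \<Delta> \<le> 1" and C: "norm (adj k t) \<le> C" "\<bar>\<theta> k t\<bar> \<le> C"
  shows "(L t (zb t + \<Delta>) - L t (zb t)) $ k + adj k t \<bullet> (\<phi> t (zb t + \<Delta>) - \<phi> t (zb t)) + \<theta> k t * (g t (zb t + \<Delta>) - g t (zb t))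
     \<le> HD k t \<Delta> + HD2 k t \<Delta> \<Delta> / 2 + (B + 2 * C * B) * norm \<Delta> ^ 3"
proof -
  have z: "norm (zb t) \<le> M" "norm (zb t + \<Delta>) \<le> M"
    using zb_norm[OF t] d norm_triangle_ineq[of "zb t" \<Delta>] by linarith+
  define n where "n = B * norm \<Delta> ^ 3"
  define l where "l = L t (zb t + \<Delta>) - L t (zb t) - DL t (zb t) \<Delta> - (1/2) *\<^sub>R D2L t (zb t) \<Delta> \<Delta>"
  define f where "f = \<phi> t (zb t + \<Delta>) - \<phi> t (zb t) - D\<phi> t (zb t) \<Delta> - (1/2) *\<^sub>R D2\<phi> t (zb t) \<Delta> \<Delta>"
  define h where "h = g t (zb t + \<Delta>) - g t (zb t) - Dg t (zb t) \<Delta> - (1/2) *\<^sub>R D2g t (zb t) \<Delta> \<Delta>"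
  have "norm l \<le> n" "norm f \<le> n" "norm h \<le> n"
    unfolding l_def f_def h_def n_def using Ls.taylor2[OF t z] Ps.taylor2[OF t z] Gs.taylor2[OF t z] by auto
  note b = this
  have C0: "0 \<le> C" using C(1) by (rule order_trans[OF norm_ge_zero])
  have "l $ k \<le> n" using component_le_norm_cart[of l k] b(1) by linarith
  moreover have "adj k t \<bullet> f \<le> C * n"
    using Cauchy_Schwarz_ineq2[of "adj k t" f] mult_mono[OF C(1) b(2) C0] by simp
  moreover have "\<theta> k t * h \<le> C * n"
    using mult_mono[OF C(2) b(3) C0] abs_ge_self[of "\<theta> k t * h"] by (simp add: abs_mult)
  moreover have "(L t (zb t + \<Delta>) - L t (zb t)) $ k + adj k t \<bullet> (\<phi> t (zb t + \<Delta>) - \<phi> t (zb t)) + \<theta> k t * (g t (zb t + \<Delta>) - g t (zb t))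
    = HD k t \<Delta> + HD2 k t \<Delta> \<Delta> / 2 + (l $ k + adj k t \<bullet> f + \<theta> k t * h)"
    by (simp add: HD_def HD2_def l_def f_def h_def inner_diff_right algebra_simps)
  ultimately show ?thesis unfolding n_def by (simp add: algebra_simps)
qed

text \<open>The trial pair zb + \<epsilon> (x, u) + \<epsilon>^2 (0, w) misses the state equation
  and the prescribed constraint value by O(\<epsilon>^2), so \<open>feasible_correction\<close>
  moves it by O(\<epsilon>^2). In the cost, the state part of the move is absorbed by
  \<open>adjoint_by_parts\<close> and the control part by \<open>HD_i0\<close>; only w, e and the
  quadratic form of (x, u) survive at order \<epsilon>^2.\<close>

lemma expansion:
  assumes x: "continuous_on {0..1} x" and u: "u \<in> borel_measurable I01" and w: "w \<in> borel_measurable I01"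
    and e: "e \<in> borel_measurable I01" and N1: "1 \<le> N"
    and bd: "\<And>t. t \<in> {0..1} \<Longrightarrow> norm (x t) \<le> N" "\<And>t. norm (u t) \<le> N" "\<And>t. norm (w t) \<le> N" "\<And>t. \<bar>e t\<bar> \<le> N"
    and lin: "\<And>t. t \<in> {0..1} \<Longrightarrow> x t = (\<integral>s. indicator {0..t} s *\<^sub>R D\<phi> s (zb s) (x s, u s) \<partial>I01)"
  obtains C E where "E > 0" "C > 0" "\<And>\<epsilon>. \<lbrakk>0 < \<epsilon>; \<epsilon> \<le> E\<rbrakk> \<Longrightarrow> \<exists>xe ue. continuous_on {0..1} xe \<and> ue \<in> borel_measurable I01 \<and>
     (\<forall>t\<in>{0..1}. xe t = x0 + (\<integral>s. indicator {0..t} s *\<^sub>R \<phi> s (xe s, ue s) \<partial>I01)) \<and>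
     (\<forall>t\<in>G. norm (xe t, ue t) \<le> M) \<and>
     (\<forall>t\<in>G. g t (xe t, ue t) = g t (zb t) + \<epsilon> * Dg t (zb t) (x t, u t) + \<epsilon>\<^sup>2 * e t) \<and>
     (\<forall>t\<in>{0..1}. norm (xe t - xb t) \<le> C * \<epsilon> \<and> norm (ue t - ub t) \<le> C * \<epsilon>) \<and>
     (\<forall>k. (\<integral>t. L t (xe t, ue t) $ k \<partial>I01) - (\<integral>t. L t (zb t) $ k \<partial>I01)
        \<le> \<epsilon> * (\<integral>t. DL t (zb t) (x t, u t) $ k \<partial>I01) +
          \<epsilon>\<^sup>2 * ((\<integral>t. HD k t (0, w t) \<partial>I01) - (\<integral>t. \<theta> k t * e t \<partial>I01) + (\<integral>t. HD2 k t (x t, u t) (x t, u t) \<partial>I01) / 2) + C * \<epsilon> ^ 3)"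
proof -
  obtain Cc R where Cc: "Cc > 0" "R > 0" and corr:
    "\<And>x1 u1 v \<delta>. \<lbrakk>x1 \<in> borel_measurable I01; u1 \<in> borel_measurable I01; v \<in> borel_measurable I01;
        \<And>t. t \<in> G \<Longrightarrow> norm ((x1 t, u1 t) - zb t) \<le> R; 0 \<le> \<delta>; \<delta> \<le> R;
        \<And>t. t \<in> {0..1} \<Longrightarrow> norm (x0 + (\<integral>s. indicator {0..t} s *\<^sub>R \<phi> s (x1 s, u1 s) \<partial>I01) - x1 t) \<le> \<delta>;
        \<And>t. t \<in> G \<Longrightarrow> \<bar>g t (x1 t, u1 t) - v t\<bar> \<le> \<delta>\<rbrakk> \<Longrightarrow>
      \<exists>y s. y \<in> borel_measurable I01 \<and> s \<in> borel_measurable I01 \<and>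
        (\<forall>t\<in>{0..1}. x1 t + y t = x0 + (\<integral>r. indicator {0..t} r *\<^sub>R \<phi> r (x1 r + y r, u1 r + s r *\<^sub>R axis i0 1) \<partial>I01)) \<and>
        (\<forall>t\<in>G. g t (x1 t + y t, u1 t + s t *\<^sub>R axis i0 1) = v t) \<and>
        (\<forall>t. norm (y t) \<le> Cc * \<delta> \<and> \<bar>s t\<bar> \<le> Cc * \<delta>)"
    using feasible_correction by blast
  obtain Cm where Cm: "Cm \<ge> 1" "\<And>k t. norm (adj k t) \<le> Cm" "\<And>k t. \<bar>\<theta> k t\<bar> \<le> Cm"
    "\<And>k t d e. t \<in> G \<Longrightarrow> \<bar>HD2 k t d e\<bar> \<le> Cm * norm d * norm e" using multiplier_bounds by metis
  \<comment> \<open>\<open>D0 * \<epsilon>\<^sup>2\<close> bounds the residuals: 9 B N^2 is the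
    Taylor remainder for a step of size 3 N \<epsilon>, B N comes from w and N from e.
    \<open>P\<close> bounds the whole perturbation of order \<epsilon>^2 and \<open>S\<close> the
    displacement, each divided by its power of \<epsilon>. \<open>Q\<close> collects the cubic
    remainders: half the one of \<open>HD2_expand\<close> for a direction of norm at most 2 N, plus
    the one of \<open>lagrangian_taylor\<close>. \<open>E\<close> makes 3 N \<epsilon>, D0
    \<epsilon> and S \<epsilon> small at once.\<close>
  define D0 where "D0 = 9 * B * N\<^sup>2 + B * N + N"
  define P where "P = N + 2 * (Cc * D0)"
  define S where "S = 2 * N + P"
  define E where "E = min 1 (min R 1 / (3 * N + D0 + S))"
  define Q where "Q = Cm * (2 * (2 * N) * P + P\<^sup>2) / 2 + (B + 2 * Cm * B) * S ^ 3"
  have D00: "D0 \<ge> 0" unfolding D0_def using B1 N1 by simp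
  have P0: "P \<ge> 0" unfolding P_def using N1 Cc D00 by simp
  have S0: "S \<ge> 2" unfolding S_def using P0 N1 by simp
  have Q0: "Q \<ge> 0" unfolding Q_def using Cm(1) N1 P0 B1 S0 by simp
  have den: "3 * N + D0 + S > 0" using N1 D00 S0 by linarith
  have dm: "(\<lambda>t. (x t, u t)) \<in> borel_measurable I01" using continuous_on_measurable_I01[OF x] u by (rule borel_measurable_Pair)
  have dN: "norm (x t, u t) \<le> 2 * N" if "t \<in> {0..1}" for t
    using norm_fst_snd_le(3)[of "x t" "u t"] bd(1)[OF that] bd(2)[of t] by linarith
  have dNG: "norm (x t, u t) \<le> 2 * N" if "t \<in> G" for t using dN[OF G_subset[OF that]] .
  have wm: "(\<lambda>t. (0 :: real^'n, w t)) \<in> borel_measurable I01" and um: "(\<lambda>t. (0 :: real^'n, u t)) \<in> borel_measurable I01"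
    using w u by (auto intro!: borel_measurable_Pair)
  have wN: "norm (0 :: real^'n, w t) \<le> N" and uN: "norm (0 :: real^'n, u t) \<le> N" for t using bd(2,3) by (auto simp: norm_Pair)
  show ?thesis
  proof (rule that[of E "S + Q"])
    show "E > 0" using den Cc by (simp add: E_def)
    show "S + Q > 0" using S0 Q0 by linarith
    fix \<epsilon> :: real assume \<epsilon>0: "0 < \<epsilon>" and "\<epsilon> \<le> E"
    then have \<epsilon>1: "\<epsilon> \<le> 1" and "\<epsilon> \<le> min R 1 / (3 * N + D0 + S)" by (auto simp: E_def)
    then have "\<epsilon> * (3 * N + D0 + S) \<le> min R 1" using den by (simp add: pos_le_divide_eq)
    then have "3 * N * \<epsilon> + D0 * \<epsilon> + S * \<epsilon> \<le> min R 1" by (simp add: algebra_simps)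
    moreover have "0 \<le> 3 * N * \<epsilon>" "0 \<le> D0 * \<epsilon>" "0 \<le> S * \<epsilon>" using \<epsilon>0 N1 D00 S0 by auto
    ultimately have sm: "3 * N * \<epsilon> \<le> R" "D0 * \<epsilon> \<le> R" "3 * N * \<epsilon> \<le> 1" "S * \<epsilon> \<le> 1" by linarith+
    have \<epsilon>2: "\<epsilon>\<^sup>2 \<le> \<epsilon>" using \<epsilon>0 \<epsilon>1 by (simp add: power2_eq_square mult_left_le)
    define \<delta> where "\<delta> = D0 * \<epsilon>\<^sup>2"
    have \<delta>: "0 \<le> \<delta>" "\<delta> \<le> R" using D00 mult_left_mono[OF \<epsilon>2 D00] sm(2) by (auto simp: \<delta>_def)
    define x1 where "x1 t = xb t + \<epsilon> *\<^sub>R x t" for t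
    define u1 where "u1 t = ub t + \<epsilon> *\<^sub>R u t + \<epsilon>\<^sup>2 *\<^sub>R w t" for t
    define v where "v t = g t (zb t) + \<epsilon> * Dg t (zb t) (x t, u t) + \<epsilon>\<^sup>2 * e t" for t
    define \<Delta>1 where "\<Delta>1 t = \<epsilon> *\<^sub>R (x t, u t) + \<epsilon>\<^sup>2 *\<^sub>R (0, w t)" for t
    have z1: "(x1 t, u1 t) = zb t + \<Delta>1 t" for t by (simp add: x1_def u1_def zb_def \<Delta>1_def)
    have \<Delta>1N: "norm (\<Delta>1 t) \<le> 3 * N * \<epsilon>" if "t \<in> {0..1}" for t
    proof -
      have "norm (\<Delta>1 t) \<le> \<epsilon> * norm (x t, u t) + \<epsilon>\<^sup>2 * norm (0 :: real^'n, w t)"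
        unfolding \<Delta>1_def using \<epsilon>0 by (intro order_trans[OF norm_triangle_ineq]) (simp del: scaleR_Pair)
      also have "\<dots> \<le> \<epsilon> * (2 * N) + \<epsilon> * N"
        using dN[OF that] wN[of t] \<epsilon>0 \<epsilon>2 by (intro add_mono mult_mono) auto
      finally show ?thesis by (simp add: algebra_simps)
    qed
    have zM: "norm (zb t) \<le> M" "norm (zb t + \<Delta>1 t) \<le> M" if "t \<in> G" for t
      using zb_norm[OF that] \<Delta>1N[OF G_subset[OF that]] sm(3) norm_triangle_ineq[of "zb t" "\<Delta>1 t"] by linarith+
    have sq: "B * (norm (\<Delta>1 t))\<^sup>2 \<le> 9 * B * N\<^sup>2 * \<epsilon>\<^sup>2" if "t \<in> {0..1}" for t
      using mult_left_mono[OF power_mono[OF \<Delta>1N[OF that] norm_ge_zero, of 2], of B] B1 by (simp add: power_mult_distrib algebra_simps)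
    have Bw: "B * norm (0 :: real^'n, w t) * \<epsilon>\<^sup>2 \<le> B * N * \<epsilon>\<^sup>2" for t using wN[of t] B1 by (intro mult_right_mono mult_left_mono) auto
    have r1: "norm (\<phi> t (zb t + \<Delta>1 t) - \<phi> t (zb t) - \<epsilon> *\<^sub>R D\<phi> t (zb t) (x t, u t)) \<le> \<delta>" if t: "t \<in> G" for t
    proof -
      have "\<phi> t (zb t + \<Delta>1 t) - \<phi> t (zb t) - \<epsilon> *\<^sub>R D\<phi> t (zb t) (x t, u t)
        = (\<phi> t (zb t + \<Delta>1 t) - \<phi> t (zb t) - D\<phi> t (zb t) (\<Delta>1 t)) + \<epsilon>\<^sup>2 *\<^sub>R D\<phi> t (zb t) (0, w t)"
        unfolding \<Delta>1_def by (simp only: blinfun.add_right blinfun.scaleR_right) simp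
      also have "norm \<dots> \<le> B * (norm (\<Delta>1 t))\<^sup>2 + B * norm (0 :: real^'n, w t) * \<epsilon>\<^sup>2"
        using Ps.taylor1(1)[OF t zM[OF t]] mult_left_mono[OF D_bound(2)[OF t, of "(0, w t)"], of "\<epsilon>\<^sup>2"]
        by (intro order_trans[OF norm_triangle_ineq] add_mono) (auto simp: mult.commute)
      also have "\<dots> \<le> 9 * B * N\<^sup>2 * \<epsilon>\<^sup>2 + B * N * \<epsilon>\<^sup>2" using sq[OF G_subset[OF t]] Bw[of t] by linarith
      also have "\<dots> \<le> \<delta>" using N1 by (simp add: \<delta>_def D0_def algebra_simps)
      finally show ?thesis .
    qed
    have r2: "\<bar>g t (x1 t, u1 t) - v t\<bar> \<le> \<delta>" if t: "t \<in> G" for t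
    proof -
      have "g t (x1 t, u1 t) - v t = (g t (zb t + \<Delta>1 t) - g t (zb t) - Dg t (zb t) (\<Delta>1 t)) + \<epsilon>\<^sup>2 * Dg t (zb t) (0, w t) + - (\<epsilon>\<^sup>2 * e t)"
        unfolding z1 v_def \<Delta>1_def by (simp only: blinfun.add_right blinfun.scaleR_right) simp
      moreover have "\<bar>g t (zb t + \<Delta>1 t) - g t (zb t) - Dg t (zb t) (\<Delta>1 t)\<bar> \<le> 9 * B * N\<^sup>2 * \<epsilon>\<^sup>2"
        using Gs.taylor1(1)[OF t zM[OF t]] sq[OF G_subset[OF t]] by simp
      moreover have "\<bar>\<epsilon>\<^sup>2 * Dg t (zb t) (0, w t)\<bar> \<le> B * N * \<epsilon>\<^sup>2"
      proof -
        have "\<bar>\<epsilon>\<^sup>2 * Dg t (zb t) (0, w t)\<bar> = \<epsilon>\<^sup>2 * \<bar>Dg t (zb t) (0, w t)\<bar>" by (simp add: abs_mult)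
        also have "\<dots> \<le> \<epsilon>\<^sup>2 * (B * norm (0 :: real^'n, w t))" by (intro mult_left_mono D_bound(3)[OF t] zero_le_power2)
        finally show ?thesis using Bw[of t] by (simp add: mult.commute mult.left_commute)
      qed
      moreover have "\<bar>- (\<epsilon>\<^sup>2 * e t)\<bar> \<le> N * \<epsilon>\<^sup>2" using mult_left_mono[OF bd(4)[of t], of "\<epsilon>\<^sup>2"] by (simp add: abs_mult mult.commute)
      ultimately have "\<bar>g t (x1 t, u1 t) - v t\<bar> \<le> 9 * B * N\<^sup>2 * \<epsilon>\<^sup>2 + B * N * \<epsilon>\<^sup>2 + N * \<epsilon>\<^sup>2" by linarith
      then show ?thesis by (simp add: \<delta>_def D0_def algebra_simps)
    qed
    have x1m: "x1 \<in> borel_measurable I01" and u1m: "u1 \<in> borel_measurable I01"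
      unfolding x1_def u1_def using continuous_on_measurable_I01[OF x] continuous_on_measurable_I01[OF xb_cont] u w ub_meas by auto
    have gzm: "(\<lambda>t. g t (zb t)) \<in> borel_measurable I01" by (rule Gs.comp_measurable[OF zb_meas])
    have Dgm: "(\<lambda>t. Dg t (zb t) (x t, u t)) \<in> borel_measurable I01" by (rule Gs.D_measurable[OF zb_meas dm])
    have vm: "v \<in> borel_measurable I01" unfolding v_def using gzm Dgm e by auto
    have near: "norm ((x1 t, u1 t) - zb t) \<le> R" if "t \<in> G" for t
      unfolding z1 using \<Delta>1N[OF G_subset[OF that]] sm(1) by simp
    have D\<phi>m: "(\<lambda>t. D\<phi> t (zb t) (x t, u t)) \<in> borel_measurable I01" by (rule Ps.D_measurable[OF zb_meas dm])
    have i\<phi>b: "integrable I01 (\<lambda>t. \<phi> t (zb t))"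
      by (rule integrable_bounded_on_G[OF Ps.comp_measurable[OF zb_meas]]) (rule Ps.bound(1)[OF _ zb_norm(2)])
    have z1m: "(\<lambda>t. zb t + \<Delta>1 t) \<in> borel_measurable I01"
      using borel_measurable_Pair[OF x1m u1m] by (simp add: z1)
    have i\<phi>1: "integrable I01 (\<lambda>t. \<phi> t (zb t + \<Delta>1 t))"
      by (rule integrable_bounded_on_G[OF Ps.comp_measurable[OF z1m]]) (rule Ps.bound(1)[OF _ zM(2)])
    have iD\<phi>: "integrable I01 (\<lambda>t. D\<phi> t (zb t) (x t, u t))"
    proof (rule integrable_bounded_on_G[OF D\<phi>m])
      show "norm (D\<phi> t (zb t) (x t, u t)) \<le> B * (2 * N)" if "t \<in> G" for t
        using D_bound(2)[OF that, of "(x t, u t)"] mult_left_mono[OF dNG[OF that] order_trans[OF zero_le_one B1]] by linarith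
    qed
    have res1: "norm (x0 + (\<integral>s. indicator {0..t} s *\<^sub>R \<phi> s (x1 s, u1 s) \<partial>I01) - x1 t) \<le> \<delta>" if t: "t \<in> {0..1}" for t
    proof -
      have "x0 + (\<integral>s. indicator {0..t} s *\<^sub>R \<phi> s (x1 s, u1 s) \<partial>I01) - x1 t
        = (\<integral>s. indicator {0..t} s *\<^sub>R \<phi> s (zb s + \<Delta>1 s) \<partial>I01) - (\<integral>s. indicator {0..t} s *\<^sub>R \<phi> s (zb s) \<partial>I01)
          - \<epsilon> *\<^sub>R (\<integral>s. indicator {0..t} s *\<^sub>R D\<phi> s (zb s) (x s, u s) \<partial>I01)"
        unfolding x1_def[of t] z1 using xb_eq[OF t] lin[OF t] by (simp add: zb_def)
      also have "\<dots> = (\<integral>s. indicator {0..t} s *\<^sub>R (\<phi> s (zb s + \<Delta>1 s) - \<phi> s (zb s) - \<epsilon> *\<^sub>R D\<phi> s (zb s) (x s, u s)) \<partial>I01)"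
      proof -
        have "(\<lambda>s. indicator {0..t} s *\<^sub>R (\<phi> s (zb s + \<Delta>1 s) - \<phi> s (zb s) - \<epsilon> *\<^sub>R D\<phi> s (zb s) (x s, u s)))
          = (\<lambda>s. indicator {0..t} s *\<^sub>R \<phi> s (zb s + \<Delta>1 s) - indicator {0..t} s *\<^sub>R \<phi> s (zb s)
              - \<epsilon> *\<^sub>R (indicator {0..t} s *\<^sub>R D\<phi> s (zb s) (x s, u s)))"
          by (simp add: scaleR_diff_right mult.commute)
        then show ?thesis
          using integrable_I01_interval[OF i\<phi>1, of 0 t] integrable_I01_interval[OF i\<phi>b, of 0 t] integrable_I01_interval[OF iD\<phi>, of 0 t]
          by (simp del: scaleR_scaleR)
      qed
      also have "norm \<dots> \<le> \<delta>"
      proof (rule integral_I01_norm_le[OF _ \<delta>(1)])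
        show "AE s in I01. norm (indicator {0..t} s *\<^sub>R (\<phi> s (zb s + \<Delta>1 s) - \<phi> s (zb s) - \<epsilon> *\<^sub>R D\<phi> s (zb s) (x s, u s))) \<le> \<delta>"
          using Ls.G_AE by eventually_elim (use r1 \<delta> in \<open>auto simp: indicator_def\<close>)
      qed
      finally show ?thesis .
    qed
    obtain y s where ym: "y \<in> borel_measurable I01" and smeas: "s \<in> borel_measurable I01"
      and st: "\<And>t. t \<in> {0..1} \<Longrightarrow> x1 t + y t = x0 + (\<integral>r. indicator {0..t} r *\<^sub>R \<phi> r (x1 r + y r, u1 r + s r *\<^sub>R axis i0 1) \<partial>I01)"
      and gv: "\<And>t. t \<in> G \<Longrightarrow> g t (x1 t + y t, u1 t + s t *\<^sub>R axis i0 1) = v t"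
      and ys: "\<And>t. norm (y t) \<le> Cc * \<delta>" "\<And>t. \<bar>s t\<bar> \<le> Cc * \<delta>"
      using corr[OF x1m u1m vm near \<delta> res1 r2] by blast
    define xe where "xe t = x1 t + y t" for t
    define ue where "ue t = u1 t + s t *\<^sub>R axis i0 1" for t
    define \<rho> where "\<rho> t = \<epsilon>\<^sup>2 *\<^sub>R (0, w t) + (y t, s t *\<^sub>R axis i0 1)" for t
    define \<Delta> where "\<Delta> t = \<epsilon> *\<^sub>R (x t, u t) + \<rho> t" for t
    have ze: "(xe t, ue t) = zb t + \<Delta> t" for t
      by (simp add: xe_def ue_def x1_def u1_def zb_def \<Delta>_def \<rho>_def algebra_simps)
    have \<rho>N: "norm (\<rho> t) \<le> \<epsilon>\<^sup>2 * P" for t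
    proof -
      have "norm (\<rho> t) \<le> \<epsilon>\<^sup>2 * norm (0 :: real^'n, w t) + norm (y t, s t *\<^sub>R axis i0 1 :: real^'l)"
        unfolding \<rho>_def by (intro order_trans[OF norm_triangle_ineq]) (simp del: scaleR_Pair)
      also have "\<dots> \<le> \<epsilon>\<^sup>2 * N + (Cc * \<delta> + Cc * \<delta>)"
      proof (rule add_mono)
        show "\<epsilon>\<^sup>2 * norm (0 :: real^'n, w t) \<le> \<epsilon>\<^sup>2 * N" using wN[of t] by (intro mult_left_mono) auto
        show "norm (y t, s t *\<^sub>R axis i0 1 :: real^'l) \<le> Cc * \<delta> + Cc * \<delta>"
          using norm_fst_snd_le(3)[of "y t" "s t *\<^sub>R axis i0 1 :: real^'l"] ys(1)[of t] ys(2)[of t] by (simp add: norm_axis_one)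
      qed
      finally show ?thesis by (simp add: P_def \<delta>_def algebra_simps)
    qed
    have \<Delta>N: "norm (\<Delta> t) \<le> S * \<epsilon>" if "t \<in> {0..1}" for t
    proof -
      have "norm (\<Delta> t) \<le> \<epsilon> * norm (x t, u t) + norm (\<rho> t)"
        unfolding \<Delta>_def using \<epsilon>0 by (intro order_trans[OF norm_triangle_ineq]) (simp del: scaleR_Pair)
      also have "\<dots> \<le> \<epsilon> * (2 * N) + \<epsilon> * P"
        using dN[OF that] order_trans[OF \<rho>N[of t] mult_right_mono[OF \<epsilon>2 P0]] \<epsilon>0 by (intro add_mono mult_left_mono) auto
      finally show ?thesis by (simp add: S_def algebra_simps)
    qed
    have zeM: "norm (xe t, ue t) \<le> M" if "t \<in> G" for t
      unfolding ze using zb_norm(1)[OF that] \<Delta>N[OF G_subset[OF that]] sm(4) norm_triangle_ineq[of "zb t" "\<Delta> t"] by linarith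
    have xem: "xe \<in> borel_measurable I01" and uem: "ue \<in> borel_measurable I01"
      unfolding xe_def ue_def using x1m u1m ym smeas by auto
    have zem: "(\<lambda>t. (xe t, ue t)) \<in> borel_measurable I01" using xem uem by (rule borel_measurable_Pair)
    have xeq: "xe t = x0 + (\<integral>r. indicator {0..t} r *\<^sub>R \<phi> r (xe r, ue r) \<partial>I01)" if "t \<in> {0..1}" for t
      using st[OF that] by (simp add: xe_def ue_def)
    have \<phi>em: "(\<lambda>t. \<phi> t (xe t, ue t)) \<in> borel_measurable I01" by (rule Ps.comp_measurable[OF zem])
    have \<phi>eB: "norm (\<phi> t (xe t, ue t)) \<le> B" if "t \<in> G" for t using Ps.bound(1)[OF that zeM[OF that]] .
    have \<phi>eA: "AE t in I01. norm (\<phi> t (xe t, ue t)) \<le> B" using Ls.G_AE by eventually_elim (rule \<phi>eB)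
    have xec: "continuous_on {0..1} xe"
    proof -
      have "continuous_on {0..1} (\<lambda>t. x0 + (\<integral>r. indicator {0..t} r *\<^sub>R \<phi> r (xe r, ue r) \<partial>I01))"
        by (intro continuous_intros initial_integral_measurable(1)[OF \<phi>em \<phi>eA])
      then show ?thesis by (rule continuous_on_eq) (use xeq in auto)
    qed
    have cost: "(\<integral>t. L t (xe t, ue t) $ k \<partial>I01) - (\<integral>t. L t (zb t) $ k \<partial>I01)
        \<le> \<epsilon> * (\<integral>t. DL t (zb t) (x t, u t) $ k \<partial>I01) +
          \<epsilon>\<^sup>2 * ((\<integral>t. HD k t (0, w t) \<partial>I01) - (\<integral>t. \<theta> k t * e t \<partial>I01) + (\<integral>t. HD2 k t (x t, u t) (x t, u t) \<partial>I01) / 2) + Q * \<epsilon> ^ 3" for k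
    proof -
      \<comment> \<open>Pieces of the expanded cost. \<open>A1\<close>, the state part of the
        displacement, and \<open>A2\<close>, the adjoint state against the velocity difference, have
        equal integrals and cancel; \<open>A3\<close> integrates to the first variation and
        \<open>A4\<close> to the coefficient of \<epsilon>^2.\<close>
      define A1 where "A1 t = HD k t (xe t - xb t, 0)" for t
      define A2 where "A2 t = adj k t \<bullet> (\<phi> t (xe t, ue t) - \<phi> t (zb t))" for t
      define A3 where "A3 t = HD k t (0, u t) - \<theta> k t * Dg t (zb t) (x t, u t)" for t
      define A4 where "A4 t = HD k t (0, w t) - \<theta> k t * e t + HD2 k t (x t, u t) (x t, u t) / 2" for t
      have \<phi>dm: "(\<lambda>t. \<phi> t (xe t, ue t) - \<phi> t (zb t)) \<in> borel_measurable I01"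
        using \<phi>em Ps.comp_measurable[OF zb_meas] by auto
      have \<phi>dB: "norm (\<phi> t (xe t, ue t) - \<phi> t (zb t)) \<le> 2 * B" if "t \<in> G" for t
        using norm_triangle_ineq4[of "\<phi> t (xe t, ue t)" "\<phi> t (zb t)"] \<phi>eB[OF that] Ps.bound(1)[OF that zb_norm(2)[OF that]] by linarith
      have \<phi>dA: "AE t in I01. norm (\<phi> t (xe t, ue t) - \<phi> t (zb t)) \<le> 2 * B" using Ls.G_AE by eventually_elim (rule \<phi>dB)
      have i\<phi>e: "integrable I01 (\<lambda>t. \<phi> t (xe t, ue t))" using integrable_I01_bounded[OF \<phi>em \<phi>eA] .
      have \<Delta>x: "xe t - xb t = (\<integral>r. indicator {0..t} r *\<^sub>R (\<phi> r (xe r, ue r) - \<phi> r (zb r)) \<partial>I01)" if "t \<in> {0..1}" for t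
        using xeq[OF that] xb_eq[OF that] integrable_I01_interval[OF i\<phi>e, of 0 t] integrable_I01_interval[OF i\<phi>b, of 0 t]
        by (simp add: scaleR_diff_right zb_def)
      have I12: "(\<integral>t. A2 t \<partial>I01) = (\<integral>t. A1 t \<partial>I01)"
        unfolding A1_def A2_def by (rule adjoint_by_parts[OF \<phi>dm \<phi>dA \<Delta>x])
      have \<Delta>fs: "xe t - xb t = fst (\<Delta> t)" "ue t - ub t = snd (\<Delta> t)" for t
        using arg_cong[OF ze[of t], of fst] arg_cong[OF ze[of t], of snd] by (auto simp: zb_def)
      have i1: "integrable I01 A1" unfolding A1_def
      proof (rule integrable_HD)
        show "(\<lambda>t. (xe t - xb t, 0 :: real^'l)) \<in> borel_measurable I01"
          using xem continuous_on_measurable_I01[OF xb_cont] by (intro borel_measurable_Pair) auto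
        show "norm (xe t - xb t, 0 :: real^'l) \<le> S * \<epsilon>" if "t \<in> G" for t
          using norm_fst_snd_le(1)[of "\<Delta> t"] \<Delta>N[OF G_subset[OF that]] by (simp add: norm_Pair \<Delta>fs)
      qed
      have i2: "integrable I01 A2" unfolding A2_def by (rule integrable_adj[OF \<phi>dm \<phi>dB])
      have DgB: "\<bar>Dg t (zb t) (x t, u t)\<bar> \<le> B * (2 * N)" if "t \<in> G" for t
        using D_bound(3)[OF that, of "(x t, u t)"] mult_left_mono[OF dNG[OF that] order_trans[OF zero_le_one B1]] by linarith
      have i3: "integrable I01 A3" unfolding A3_def
        by (intro Bochner_Integration.integrable_diff integrable_HD[OF um uN] integrable_\<theta>[OF Dgm DgB])
      note i4' = integrable_HD[OF wm wN, of k] integrable_\<theta>[OF e bd(4), of k] integrable_HD2[OF dm dNG, of k]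
      have i4: "integrable I01 A4" unfolding A4_def using i4' by simp
      have I3: "(\<integral>t. A3 t \<partial>I01) = (\<integral>t. DL t (zb t) (x t, u t) $ k \<partial>I01)"
        unfolding A3_def by (rule first_variation[OF x u dNG lin])
      have I4: "(\<integral>t. A4 t \<partial>I01) = (\<integral>t. HD k t (0, w t) \<partial>I01) - (\<integral>t. \<theta> k t * e t \<partial>I01) + (\<integral>t. HD2 k t (x t, u t) (x t, u t) \<partial>I01) / 2"
        unfolding A4_def using i4' by simp
      have pw: "L t (xe t, ue t) $ k - L t (zb t) $ k \<le> A1 t - A2 t + \<epsilon> * A3 t + \<epsilon>\<^sup>2 * A4 t + Q * \<epsilon> ^ 3" if t: "t \<in> G" for t
      proof -
        have n1: "norm (\<Delta> t) \<le> 1" using \<Delta>N[OF G_subset[OF t]] sm(4) by linarith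
        have T: "(L t (zb t + \<Delta> t) - L t (zb t)) $ k + adj k t \<bullet> (\<phi> t (zb t + \<Delta> t) - \<phi> t (zb t)) + \<theta> k t * (g t (zb t + \<Delta> t) - g t (zb t))
           \<le> HD k t (\<Delta> t) + HD2 k t (\<Delta> t) (\<Delta> t) / 2 + (B + 2 * Cm * B) * norm (\<Delta> t) ^ 3"
          by (rule lagrangian_taylor[OF t n1 Cm(2) Cm(3)])
        have geq: "g t (zb t + \<Delta> t) - g t (zb t) = \<epsilon> * Dg t (zb t) (x t, u t) + \<epsilon>\<^sup>2 * e t"
          using gv[OF t] by (simp add: ze[symmetric] v_def xe_def ue_def)
        have HDeq: "HD k t (\<Delta> t) = A1 t + \<epsilon> * HD k t (0, u t) + \<epsilon>\<^sup>2 * HD k t (0, w t)"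
        proof -
          \<comment> \<open>The state displacement goes into \<open>A1\<close> as a whole, whatever
            the correction was; of the control correction only a multiple of axis \<open>i0\<close>
            is left, on which \<open>HD\<close> is 0.\<close>
          have "\<Delta> t = (xe t - xb t, 0) + (\<epsilon> *\<^sub>R (0, u t) + (\<epsilon>\<^sup>2 *\<^sub>R (0, w t) + s t *\<^sub>R (0, axis i0 1)))"
            unfolding \<Delta>fs by (simp add: \<Delta>_def \<rho>_def)
          then show ?thesis unfolding A1_def using HD_i0[OF t, of k] by (simp only: HD_add HD_scale)
        qed
        have "HD2 k t (\<Delta> t) (\<Delta> t) \<le> \<epsilon>\<^sup>2 * HD2 k t (x t, u t) (x t, u t) + Cm * (2 * (2 * N) * P + P\<^sup>2) * \<epsilon> ^ 3"
          unfolding \<Delta>_def using Cm(1) P0 \<epsilon>0 \<epsilon>1 by (intro HD2_expand[OF t Cm(4)[OF t] dNG[OF t] \<rho>N]) auto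
        moreover have "(B + 2 * Cm * B) * norm (\<Delta> t) ^ 3 \<le> (B + 2 * Cm * B) * S ^ 3 * \<epsilon> ^ 3"
        proof -
          have "norm (\<Delta> t) ^ 3 \<le> (S * \<epsilon>) ^ 3" using \<Delta>N[OF G_subset[OF t]] by (intro power_mono) auto
          then have "(B + 2 * Cm * B) * norm (\<Delta> t) ^ 3 \<le> (B + 2 * Cm * B) * (S * \<epsilon>) ^ 3"
            using B1 Cm(1) by (intro mult_left_mono) auto
          then show ?thesis by (simp add: power_mult_distrib mult.assoc)
        qed
        moreover have "A1 t - A2 t + \<epsilon> * A3 t + \<epsilon>\<^sup>2 * A4 t + Q * \<epsilon> ^ 3 = A1 t - A2 t + \<epsilon> * HD k t (0, u t) + \<epsilon>\<^sup>2 * HD k t (0, w t)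
            - \<theta> k t * (\<epsilon> * Dg t (zb t) (x t, u t) + \<epsilon>\<^sup>2 * e t)
            + (\<epsilon>\<^sup>2 * HD2 k t (x t, u t) (x t, u t) + Cm * (2 * (2 * N) * P + P\<^sup>2) * \<epsilon> ^ 3) / 2 + (B + 2 * Cm * B) * S ^ 3 * \<epsilon> ^ 3"
          unfolding A3_def A4_def Q_def by (simp add: algebra_simps add_divide_distrib)
        ultimately show ?thesis
          using T[unfolded geq HDeq, folded ze] unfolding A2_def vector_minus_component by argo
      qed
      have iL: "integrable I01 (\<lambda>t. L t (xe t, ue t) $ k)" "integrable I01 (\<lambda>t. L t (zb t) $ k)"
        using integrable_comp_L[OF zem zeM] integrable_comp_L[OF zb_meas zb_norm(2)] by auto
      have "(\<integral>t. L t (xe t, ue t) $ k \<partial>I01) - (\<integral>t. L t (zb t) $ k \<partial>I01) = (\<integral>t. L t (xe t, ue t) $ k - L t (zb t) $ k \<partial>I01)"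
        using iL by simp
      also have "\<dots> \<le> (\<integral>t. A1 t - A2 t + \<epsilon> * A3 t + \<epsilon>\<^sup>2 * A4 t + Q * \<epsilon> ^ 3 \<partial>I01)"
      proof (rule integral_mono_AE)
        show "AE t in I01. L t (xe t, ue t) $ k - L t (zb t) $ k \<le> A1 t - A2 t + \<epsilon> * A3 t + \<epsilon>\<^sup>2 * A4 t + Q * \<epsilon> ^ 3"
          using Ls.G_AE by eventually_elim (rule pw)
      qed (use iL i1 i2 i3 i4 in auto)
      also have "\<dots> = (\<integral>t. A1 t \<partial>I01) - (\<integral>t. A2 t \<partial>I01) + \<epsilon> * (\<integral>t. A3 t \<partial>I01) + \<epsilon>\<^sup>2 * (\<integral>t. A4 t \<partial>I01) + Q * \<epsilon> ^ 3"
        using i1 i2 i3 i4 by (simp add: measure_I01)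
      finally show ?thesis by (simp add: I12 I3 I4)
    qed
    show "\<exists>xe ue. continuous_on {0..1} xe \<and> ue \<in> borel_measurable I01 \<and>
     (\<forall>t\<in>{0..1}. xe t = x0 + (\<integral>s. indicator {0..t} s *\<^sub>R \<phi> s (xe s, ue s) \<partial>I01)) \<and>
     (\<forall>t\<in>G. norm (xe t, ue t) \<le> M) \<and>
     (\<forall>t\<in>G. g t (xe t, ue t) = g t (zb t) + \<epsilon> * Dg t (zb t) (x t, u t) + \<epsilon>\<^sup>2 * e t) \<and>
     (\<forall>t\<in>{0..1}. norm (xe t - xb t) \<le> (S + Q) * \<epsilon> \<and> norm (ue t - ub t) \<le> (S + Q) * \<epsilon>) \<and>
     (\<forall>k. (\<integral>t. L t (xe t, ue t) $ k \<partial>I01) - (\<integral>t. L t (zb t) $ k \<partial>I01)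
        \<le> \<epsilon> * (\<integral>t. DL t (zb t) (x t, u t) $ k \<partial>I01) +
          \<epsilon>\<^sup>2 * ((\<integral>t. HD k t (0, w t) \<partial>I01) - (\<integral>t. \<theta> k t * e t \<partial>I01) + (\<integral>t. HD2 k t (x t, u t) (x t, u t) \<partial>I01) / 2) + (S + Q) * \<epsilon> ^ 3)"
    proof (intro exI[of _ xe] exI[of _ ue] conjI ballI allI xec uem xeq zeM)
      show "g t (xe t, ue t) = g t (zb t) + \<epsilon> * Dg t (zb t) (x t, u t) + \<epsilon>\<^sup>2 * e t" if "t \<in> G" for t
        using gv[OF that] by (simp add: v_def xe_def ue_def)
      fix t :: real assume t: "t \<in> {0..1}"
      have \<Delta>fs: "xe t - xb t = fst (\<Delta> t)" "ue t - ub t = snd (\<Delta> t)"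
        using arg_cong[OF ze[of t], of fst] arg_cong[OF ze[of t], of snd] by (auto simp: zb_def)
      have "S * \<epsilon> \<le> (S + Q) * \<epsilon>" using Q0 \<epsilon>0 by (intro mult_right_mono) auto
      then show "norm (xe t - xb t) \<le> (S + Q) * \<epsilon>" "norm (ue t - ub t) \<le> (S + Q) * \<epsilon>"
        unfolding \<Delta>fs using norm_fst_snd_le(1,2)[of "\<Delta> t"] \<Delta>N[OF t] by linarith+
    next
      fix k
      have "Q * \<epsilon> ^ 3 \<le> (S + Q) * \<epsilon> ^ 3" using S0 \<epsilon>0 by (intro mult_right_mono) auto
      then show "(\<integral>t. L t (xe t, ue t) $ k \<partial>I01) - (\<integral>t. L t (zb t) $ k \<partial>I01)
        \<le> \<epsilon> * (\<integral>t. DL t (zb t) (x t, u t) $ k \<partial>I01) +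
          \<epsilon>\<^sup>2 * ((\<integral>t. HD k t (0, w t) \<partial>I01) - (\<integral>t. \<theta> k t * e t \<partial>I01) + (\<integral>t. HD2 k t (x t, u t) (x t, u t) \<partial>I01) / 2) + (S + Q) * \<epsilon> ^ 3"
        using cost[of k] by linarith
    qed auto
  qed
qed

end

section \<open>Separation\<close>

lemma interior_nonneg_orthant:
  fixes v :: "real^'k"
  assumes "\<And>j. 0 < v $ j"
  shows "v \<in> interior nonneg_orthant"
proof (rule interiorI)
  have "{v :: real^'k. \<forall>j. 0 < v $ j} = (\<Inter>j\<in>UNIV. {v. 0 < v $ j})" by auto
  moreover have "open \<dots>"
    by (intro open_INT ballI) (auto intro!: open_Collect_less continuous_intros)
  ultimately show "open {v :: real^'k. \<forall>j. 0 < v $ j}" by simp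
qed (use assms in \<open>auto simp: nonneg_orthant_def less_imp_le\<close>)

text \<open>Letting r grow turns an inequality with a fixed second-order constant into a sign
  condition on its linear part; this is how first-order conditions are read off.\<close>

lemma linear_nonneg_imp_nonpos:
  fixes A c :: real
  assumes "\<And>r. r > 0 \<Longrightarrow> 0 \<le> c - r * A"
  shows "A \<le> 0"
proof (rule ccontr)
  assume "\<not> A \<le> 0"
  then have "0 \<le> c - ((\<bar>c\<bar> + 1) / A) * A" by (intro assms) (auto intro: divide_pos_pos)
  then show False using \<open>\<not> A \<le> 0\<close> by simp
qed

lemma Linf_measurable: "Linf f \<Longrightarrow> f \<in> borel_measurable I01"
  by (simp add: Linf_def)

lemma Linf_zero: "Linf (\<lambda>t. 0)" by (auto simp: Linf_def intro!: exI[of _ 0])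

lemma Linf_lincomb:
  fixes f h :: "real \<Rightarrow> 'a::euclidean_space"
  assumes "Linf f" "Linf h"
  shows "Linf (\<lambda>t. a *\<^sub>R f t + b *\<^sub>R h t)"
proof -
  obtain C D where C: "AE t in I01. norm (f t) \<le> C" and D: "AE t in I01. norm (h t) \<le> D" using assms by (auto simp: Linf_def)
  have "AE t in I01. norm (a *\<^sub>R f t + b *\<^sub>R h t) \<le> \<bar>a\<bar> * C + \<bar>b\<bar> * D"
    using C D
  proof eventually_elim
    case (elim t)
    have "norm (a *\<^sub>R f t + b *\<^sub>R h t) \<le> \<bar>a\<bar> * norm (f t) + \<bar>b\<bar> * norm (h t)" by (intro order_trans[OF norm_triangle_ineq]) simp
    also have "\<dots> \<le> \<bar>a\<bar> * C + \<bar>b\<bar> * D" using elim by (intro add_mono mult_left_mono) auto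
    finally show ?case .
  qed
  moreover have "(\<lambda>t. a *\<^sub>R f t + b *\<^sub>R h t) \<in> borel_measurable I01" using assms by (auto simp: Linf_def)
  ultimately show ?thesis by (auto simp: Linf_def)
qed

context control_problem
begin

lemma integrable_HD_control:
  assumes "Linf w"
  shows "integrable I01 (\<lambda>t. HD k t (0, w t))"
proof -
  obtain C where C: "C \<ge> 1" "\<And>k t d. t \<in> G \<Longrightarrow> \<bar>HD k t d\<bar> \<le> C * norm d" using multiplier_bounds by metis
  obtain N where N: "AE t in I01. norm (w t) \<le> N" using assms by (auto simp: Linf_def)
  show ?thesis
  proof (rule integrable_I01_bounded)
    show "(\<lambda>t. HD k t (0, w t)) \<in> borel_measurable I01"
      using Linf_measurable[OF assms] by (intro HD_measurable borel_measurable_Pair) auto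
    show "AE t in I01. norm (HD k t (0, w t)) \<le> C * N"
      using N Ls.G_AE
    proof eventually_elim
      case (elim t)
      have "\<bar>HD k t (0, w t)\<bar> \<le> C * norm (w t)" using C(2)[OF elim(2), of k "(0, w t)"] by (simp add: norm_Pair)
      also have "\<dots> \<le> C * N" using elim C by (intro mult_left_mono) auto
      finally show ?case by simp
    qed
  qed
qed

lemma integrable_\<theta>_Linf:
  assumes "Linf e"
  shows "integrable I01 (\<lambda>t. \<theta> k t * e t)"
proof -
  obtain C where C: "C \<ge> 1" "\<And>k t. \<bar>\<theta> k t\<bar> \<le> C" using multiplier_bounds by metis
  obtain N where N: "AE t in I01. norm (e t) \<le> N" using assms by (auto simp: Linf_def)
  show ?thesis
  proof (rule integrable_I01_bounded)
    show "(\<lambda>t. \<theta> k t * e t) \<in> borel_measurable I01"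
      using Linf_measurable[OF assms] by (intro borel_measurable_times \<theta>_measurable)
    show "AE t in I01. norm (\<theta> k t * e t) \<le> C * N"
      using N
    proof eventually_elim
      case (elim t)
      show ?case unfolding norm_mult using elim C(2)[of k t] C(1) by (intro mult_mono) auto
    qed
  qed
qed

lemma g_zb_Linf: "Linf (\<lambda>t. g t (zb t))"
proof -
  have "AE t in I01. norm (g t (zb t)) \<le> B" using Ls.G_AE by eventually_elim (rule Gs.bound(1)[OF _ zb_norm(2)])
  then show ?thesis unfolding Linf_def using Gs.comp_measurable[OF zb_meas] by blast
qed

definition V :: "(real \<Rightarrow> real^'n) \<Rightarrow> (real \<Rightarrow> real^'l) \<Rightarrow> (real \<Rightarrow> real^'l) \<Rightarrow> (real \<Rightarrow> real) \<Rightarrow> 'm \<Rightarrow> real" where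
  "V x u w e k = (\<integral>t. HD k t (0, w t) \<partial>I01) - (\<integral>t. \<theta> k t * e t \<partial>I01) + (\<integral>t. HD2 k t (x t, u t) (x t, u t) \<partial>I01) / 2"

text \<open>For \<mu> > 0 the hypothesis on \<open>e\<close> means e = \<mu> (v - g) with v \<le> 0,
  so e is an admissible variation of the constraint value. If every component of V were negative,
  all costs would strictly decrease along the expanded pairs: the order \<epsilon> term is
  nonpositive by (c1) and the negative \<epsilon>^2 term beats the cubic remainder. These pairs are
  feasible by (c3) and the hypothesis on e.\<close>

lemma no_descent:
  assumes pareto: "loc_weak_pareto L x0 \<phi> g xb ub"
    and crit: "crit0 DL D\<phi> g Dg xb ub x u"
    and w: "Linf w" and e: "Linf e" and \<mu>: "0 \<le> \<mu>" and e\<mu>: "AE t in I01. e t + \<mu> * g t (zb t) \<le> 0"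
  shows "\<exists>k. 0 \<le> V x u w e k"
proof (rule ccontr)
  assume "\<not> ?thesis"
  then have neg: "V x u w e k < 0" for k by (auto simp: not_le)
  obtain \<epsilon>0 where \<epsilon>0: "\<epsilon>0 > 0" and opt: "\<forall>x u. feasible x0 \<phi> g x u \<and> supnorm (\<lambda>t. x t - xb t) \<le> \<epsilon>0 \<and>
        (AE t in I01. norm (u t - ub t) \<le> \<epsilon>0) \<longrightarrow> cost L x u - cost L xb ub \<notin> uminus ` interior nonneg_orthant"
    using pareto unfolding loc_weak_pareto_def by (elim conjE exE) simp
  have x: "continuous_on {0..1} x" and uL: "Linf u"
    and c1: "(\<chi> j. integral\<^sup>L I01 (\<lambda>t. DL t (zb t) (x t, u t) $ j)) \<in> uminus ` nonneg_orthant"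
    and c2: "\<And>t. t \<in> {0..1} \<Longrightarrow> x t = integral\<^sup>L (lebesgue_on {0..t}) (\<lambda>s. D\<phi> s (zb s) (x s, u s))"
    using crit by (auto simp: crit0_def zb_def)
  obtain \<mu>0 h where \<mu>0: "\<mu>0 > 0" and h: "h \<in> Qset" and c3: "AE t in I01. Dg t (zb t) (x t, u t) = \<mu>0 * (h t - g t (zb t))"
    using crit by (auto simp: crit0_def zb_def)
  have hle: "AE t in I01. h t \<le> 0" using h by (simp add: Qset_def)
  obtain Cu where Cu: "AE t in I01. norm (u t) \<le> Cu" using uL by (auto simp: Linf_def)
  obtain Cw where Cw: "AE t in I01. norm (w t) \<le> Cw" using w by (auto simp: Linf_def)
  obtain Ce where Ce: "AE t in I01. norm (e t) \<le> Ce" using e by (auto simp: Linf_def)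
  obtain Cx where Cx: "\<And>t. t \<in> {0..1} \<Longrightarrow> norm (x t) \<le> Cx"
    using compact_imp_bounded[OF compact_continuous_image[OF x]] unfolding bounded_iff by (metis compact_Icc image_eqI)
  \<comment> \<open>Membership in L-infinity bounds u, w and e almost everywhere, while
    \<open>expansion\<close> asks for bounds at every point. Values above \<open>N\<close> are
    replaced by 0; they occur on a null set, so no integral changes.\<close>
  define N where "N = 1 + \<bar>Cu\<bar> + \<bar>Cw\<bar> + \<bar>Ce\<bar> + \<bar>Cx\<bar>"
  define u' where "u' t = (if norm (u t) \<le> N then u t else 0)" for t
  define w' where "w' t = (if norm (w t) \<le> N then w t else 0)" for t
  define e' where "e' t = (if norm (e t) \<le> N then e t else 0)" for t
  note [measurable] = Linf_measurable[OF uL] Linf_measurable[OF w] Linf_measurable[OF e]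
  have um: "u' \<in> borel_measurable I01" and wm: "w' \<in> borel_measurable I01" and em: "e' \<in> borel_measurable I01"
    unfolding u'_def w'_def e'_def by measurable
  have uA: "AE t in I01. u' t = u t" using Cu by eventually_elim (auto simp: u'_def N_def)
  have wA: "AE t in I01. w' t = w t" using Cw by eventually_elim (auto simp: w'_def N_def)
  have eA: "AE t in I01. e' t = e t" using Ce by eventually_elim (auto simp: e'_def N_def)
  have N1: "1 \<le> N" by (simp add: N_def)
  have bd: "\<And>t. t \<in> {0..1} \<Longrightarrow> norm (x t) \<le> N" "\<And>t. norm (u' t) \<le> N" "\<And>t. norm (w' t) \<le> N" "\<And>t. \<bar>e' t\<bar> \<le> N"
    using Cx N1 by (force simp: N_def u'_def w'_def e'_def)+
  have xm: "x \<in> borel_measurable I01" using continuous_on_measurable_I01[OF x] .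
  have dm: "(\<lambda>t. (x t, u t)) \<in> borel_measurable I01" using xm Linf_measurable[OF uL] by (rule borel_measurable_Pair)
  have dm': "(\<lambda>t. (x t, u' t)) \<in> borel_measurable I01" using xm um by (rule borel_measurable_Pair)
  have lin: "x t = (\<integral>s. indicator {0..t} s *\<^sub>R D\<phi> s (zb s) (x s, u' s) \<partial>I01)" if t: "t \<in> {0..1}" for t
  proof -
    have "x t = (\<integral>s. indicator {0..t} s *\<^sub>R D\<phi> s (zb s) (x s, u s) \<partial>I01)"
      using c2[OF t] by (simp add: lebesgue_on_initial(1)[OF t])
    also have "\<dots> = (\<integral>s. indicator {0..t} s *\<^sub>R D\<phi> s (zb s) (x s, u' s) \<partial>I01)"
    proof (rule integral_cong_AE)
      note [measurable] = Ps.D_measurable[OF zb_meas dm] Ps.D_measurable[OF zb_meas dm']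
      show "(\<lambda>s. indicator {0..t} s *\<^sub>R D\<phi> s (zb s) (x s, u s)) \<in> borel_measurable I01"
        "(\<lambda>s. indicator {0..t} s *\<^sub>R D\<phi> s (zb s) (x s, u' s)) \<in> borel_measurable I01"
        unfolding indicator_def by measurable
      show "AE s in I01. indicator {0..t} s *\<^sub>R D\<phi> s (zb s) (x s, u s) = indicator {0..t} s *\<^sub>R D\<phi> s (zb s) (x s, u' s)"
        using uA by eventually_elim simp
    qed
    finally show ?thesis .
  qed
  have Veq: "(\<integral>t. HD k t (0, w' t) \<partial>I01) - (\<integral>t. \<theta> k t * e' t \<partial>I01) + (\<integral>t. HD2 k t (x t, u' t) (x t, u' t) \<partial>I01) / 2 = V x u w e k" for k
  proof -
    have "(\<integral>t. HD k t (0, w' t) \<partial>I01) = (\<integral>t. HD k t (0, w t) \<partial>I01)"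
      using wA wm Linf_measurable[OF w] by (intro integral_cong_AE HD_measurable borel_measurable_Pair) auto
    moreover have "(\<integral>t. \<theta> k t * e' t \<partial>I01) = (\<integral>t. \<theta> k t * e t \<partial>I01)"
      using eA em Linf_measurable[OF e] \<theta>_measurable by (intro integral_cong_AE borel_measurable_times) auto
    moreover have "(\<integral>t. HD2 k t (x t, u' t) (x t, u' t) \<partial>I01) = (\<integral>t. HD2 k t (x t, u t) (x t, u t) \<partial>I01)"
      using uA dm dm' by (intro integral_cong_AE HD2_measurable) auto
    ultimately show ?thesis by (simp add: V_def)
  qed
  have DL: "(\<integral>t. DL t (zb t) (x t, u' t) $ k \<partial>I01) \<le> 0" for k
  proof -
    have "(\<integral>t. DL t (zb t) (x t, u' t) $ k \<partial>I01) = (\<integral>t. DL t (zb t) (x t, u t) $ k \<partial>I01)"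
    proof (rule integral_cong_AE)
      have "(\<lambda>t. DL t (zb t) (x t, u t) \<bullet> axis k 1) \<in> borel_measurable I01" "(\<lambda>t. DL t (zb t) (x t, u' t) \<bullet> axis k 1) \<in> borel_measurable I01"
        by (intro borel_measurable_inner borel_measurable_const Ls.D_measurable[OF zb_meas] dm dm')+
      then show "(\<lambda>t. DL t (zb t) (x t, u' t) $ k) \<in> borel_measurable I01" "(\<lambda>t. DL t (zb t) (x t, u t) $ k) \<in> borel_measurable I01"
        by (simp_all add: inner_axis)
      show "AE t in I01. DL t (zb t) (x t, u' t) $ k = DL t (zb t) (x t, u t) $ k" using uA by eventually_elim simp
    qed
    also have "\<dots> \<le> 0"
    proof -
      obtain v where v: "\<And>j. 0 \<le> v $ j" "(\<chi> j. integral\<^sup>L I01 (\<lambda>t. DL t (zb t) (x t, u t) $ j)) = - v"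
        using c1 by (auto simp: nonneg_orthant_def)
      have "(\<integral>t. DL t (zb t) (x t, u t) $ k \<partial>I01) = (\<chi> j. integral\<^sup>L I01 (\<lambda>t. DL t (zb t) (x t, u t) $ j)) $ k" by simp
      also have "\<dots> = - (v $ k)" unfolding v(2) by simp
      finally have "(\<integral>t. DL t (zb t) (x t, u t) $ k \<partial>I01) = - (v $ k)" .
      then show ?thesis using v(1)[of k] by simp
    qed
    finally show ?thesis .
  qed
  obtain C E where E: "E > 0" "C > 0" and ex: "\<And>\<epsilon>. \<lbrakk>0 < \<epsilon>; \<epsilon> \<le> E\<rbrakk> \<Longrightarrow> \<exists>xe ue. continuous_on {0..1} xe \<and> ue \<in> borel_measurable I01 \<and>
     (\<forall>t\<in>{0..1}. xe t = x0 + (\<integral>s. indicator {0..t} s *\<^sub>R \<phi> s (xe s, ue s) \<partial>I01)) \<and>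
     (\<forall>t\<in>G. norm (xe t, ue t) \<le> M) \<and>
     (\<forall>t\<in>G. g t (xe t, ue t) = g t (zb t) + \<epsilon> * Dg t (zb t) (x t, u' t) + \<epsilon>\<^sup>2 * e' t) \<and>
     (\<forall>t\<in>{0..1}. norm (xe t - xb t) \<le> C * \<epsilon> \<and> norm (ue t - ub t) \<le> C * \<epsilon>) \<and>
     (\<forall>k. (\<integral>t. L t (xe t, ue t) $ k \<partial>I01) - (\<integral>t. L t (zb t) $ k \<partial>I01)
        \<le> \<epsilon> * (\<integral>t. DL t (zb t) (x t, u' t) $ k \<partial>I01) + \<epsilon>\<^sup>2 * V x u w e k + C * \<epsilon> ^ 3)"
    by (rule expansion[OF x um wm em N1 bd lin, unfolded Veq]) (assumption | rule that)+
  \<comment> \<open>A common margin for the finitely many objectives, so that one \<epsilon> serves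
    them all.\<close>
  define m where "m = Min (range (\<lambda>k. - V x u w e k))"
  have "m \<le> - V x u w e k" for k unfolding m_def by (intro Min_le) auto
  then have m: "m > 0" "\<And>k. V x u w e k \<le> - m"
    using neg by (auto simp: m_def le_minus_iff)
  \<comment> \<open>The entries ensure, in turn, \<epsilon>^2 \<le> \<epsilon>, validity of the
    expansion, closeness within \<open>\<epsilon>0\<close>, C \<epsilon>^3 < m \<epsilon>^2, and a
    nonnegative coefficient in front of g in the constraint value below.\<close>
  define \<epsilon> where "\<epsilon> = Min {1, E, \<epsilon>0 / C, m / (2 * C), 1 / (\<mu>0 + \<mu>)}"
  have "0 < \<mu>0 + \<mu>" using \<mu>0 \<mu> by linarith
  then have \<epsilon>: "0 < \<epsilon>" "\<epsilon> \<le> 1" "\<epsilon> \<le> E" "\<epsilon> \<le> \<epsilon>0 / C" "\<epsilon> \<le> m / (2 * C)" "\<epsilon> \<le> 1 / (\<mu>0 + \<mu>)"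
    unfolding \<epsilon>_def using E \<epsilon>0 m(1) by auto
  have \<epsilon>2: "C * \<epsilon> \<le> \<epsilon>0" "C * \<epsilon> < m" "\<epsilon> * (\<mu>0 + \<mu>) \<le> 1"
  proof -
    show "C * \<epsilon> \<le> \<epsilon>0" using \<epsilon>(4) E(2) by (simp add: pos_le_divide_eq mult.commute)
    have "2 * (C * \<epsilon>) \<le> m" using \<epsilon>(5) E(2) by (simp add: pos_le_divide_eq mult.commute mult.left_commute)
    then show "C * \<epsilon> < m" using m(1) by linarith
    show "\<epsilon> * (\<mu>0 + \<mu>) \<le> 1" using \<epsilon>(6) \<open>0 < \<mu>0 + \<mu>\<close> by (simp add: pos_le_divide_eq)
  qed
  obtain xe ue where xe: "continuous_on {0..1} xe" and ue: "ue \<in> borel_measurable I01"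
    and st: "\<And>t. t \<in> {0..1} \<Longrightarrow> xe t = x0 + (\<integral>s. indicator {0..t} s *\<^sub>R \<phi> s (xe s, ue s) \<partial>I01)"
    and zeM: "\<And>t. t \<in> G \<Longrightarrow> norm (xe t, ue t) \<le> M"
    and ge: "\<And>t. t \<in> G \<Longrightarrow> g t (xe t, ue t) = g t (zb t) + \<epsilon> * Dg t (zb t) (x t, u' t) + \<epsilon>\<^sup>2 * e' t"
    and near: "\<And>t. t \<in> {0..1} \<Longrightarrow> norm (xe t - xb t) \<le> C * \<epsilon>" "\<And>t. t \<in> {0..1} \<Longrightarrow> norm (ue t - ub t) \<le> C * \<epsilon>"
    and co: "\<And>k. (\<integral>t. L t (xe t, ue t) $ k \<partial>I01) - (\<integral>t. L t (zb t) $ k \<partial>I01)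
        \<le> \<epsilon> * (\<integral>t. DL t (zb t) (x t, u' t) $ k \<partial>I01) + \<epsilon>\<^sup>2 * V x u w e k + C * \<epsilon> ^ 3"
    using ex[OF \<epsilon>(1,3)] by blast
  have feas: "feasible x0 \<phi> g xe ue"
    unfolding feasible_def
  proof (intro conjI xe)
    have "AE t in I01. norm (ue t) \<le> M"
      using Ls.G_AE
    proof eventually_elim
      case (elim t)
      show ?case using norm_fst_snd_le(2)[of "(xe t, ue t)"] zeM[OF elim] by simp
    qed
    then show "Linf ue" using ue by (auto simp: Linf_def)
    have \<phi>m: "(\<lambda>s. \<phi> s (xe s, ue s)) \<in> borel_measurable I01"
      by (intro Ps.comp_measurable borel_measurable_Pair continuous_on_measurable_I01[OF xe] ue)
    have i: "integrable I01 (\<lambda>s. \<phi> s (xe s, ue s))"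
      using integrable_bounded_on_G[OF \<phi>m] Ps.bound(1)[OF _ zeM] by blast
    show "AE t in I01. integrable (lebesgue_on {0..t}) (\<lambda>s. \<phi> s (xe s, ue s)) \<and>
        xe t = x0 + integral\<^sup>L (lebesgue_on {0..t}) (\<lambda>s. \<phi> s (xe s, ue s))"
    proof (rule AE_I2)
      fix t :: real assume "t \<in> space I01"
      then have t: "t \<in> {0..1}" by simp
      show "integrable (lebesgue_on {0..t}) (\<lambda>s. \<phi> s (xe s, ue s)) \<and>
        xe t = x0 + integral\<^sup>L (lebesgue_on {0..t}) (\<lambda>s. \<phi> s (xe s, ue s))"
        unfolding lebesgue_on_initial[OF t] using integrable_I01_interval[OF i] st[OF t] by blast
    qed
    show "AE t in I01. g t (xe t, ue t) \<le> 0"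
      using Ls.G_AE uA eA c3 hle e\<mu>
    proof eventually_elim
      case (elim t)
      have g0: "g t (zb t) \<le> 0" using g_nonpos[OF elim(1)] by (simp add: zb_def)
      have "g t (xe t, ue t) = g t (zb t) + \<epsilon> * (\<mu>0 * (h t - g t (zb t))) + \<epsilon>\<^sup>2 * e t"
        using ge[OF elim(1)] elim(2,3,4) by simp
      \<comment> \<open>Regrouped so that each summand is nonpositive on its own; for the first this
        uses \<epsilon> (\<mu>0 + \<mu>) \<le> 1.\<close>
      also have "\<dots> = g t (zb t) * (1 - \<epsilon> * \<mu>0 - \<epsilon>\<^sup>2 * \<mu>) + \<epsilon> * \<mu>0 * h t + \<epsilon>\<^sup>2 * (e t + \<mu> * g t (zb t))"
        by (simp add: algebra_simps)
      also have "\<dots> \<le> 0"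
      proof -
        have "\<epsilon>\<^sup>2 * \<mu> \<le> \<epsilon> * \<mu>" using \<epsilon> \<mu> by (simp add: power2_eq_square mult_left_le_one_le mult_right_mono)
        then have "0 \<le> 1 - \<epsilon> * \<mu>0 - \<epsilon>\<^sup>2 * \<mu>" using \<epsilon>2(3) by (simp add: algebra_simps)
        then have "g t (zb t) * (1 - \<epsilon> * \<mu>0 - \<epsilon>\<^sup>2 * \<mu>) \<le> 0" using g0 by (rule mult_nonpos_nonneg[rotated])
        moreover have "\<epsilon> * \<mu>0 * h t \<le> 0" using elim(5) \<epsilon> \<mu>0 by (intro mult_nonneg_nonpos) auto
        moreover have "\<epsilon>\<^sup>2 * (e t + \<mu> * g t (zb t)) \<le> 0" using elim(6) by (intro mult_nonneg_nonpos) auto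
        ultimately show ?thesis by linarith
      qed
      finally show ?case .
    qed
  qed
  have sup: "supnorm (\<lambda>t. xe t - xb t) \<le> \<epsilon>0"
    unfolding supnorm_def using near(1) \<epsilon>2(1) by (intro cSup_least) force+
  have uae: "AE t in I01. norm (ue t - ub t) \<le> \<epsilon>0"
    using near(2) \<epsilon>2(1) by (intro AE_I2) force
  have lt: "(\<integral>t. L t (xe t, ue t) $ k \<partial>I01) - (\<integral>t. L t (zb t) $ k \<partial>I01) < 0" for k
  proof -
    have "\<epsilon> * (\<integral>t. DL t (zb t) (x t, u' t) $ k \<partial>I01) \<le> 0" using DL[of k] \<epsilon> by (intro mult_nonneg_nonpos) auto
    moreover have "\<epsilon>\<^sup>2 * V x u w e k \<le> \<epsilon>\<^sup>2 * - m" using m(2)[of k] by (intro mult_left_mono) auto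
    moreover have "C * \<epsilon> ^ 3 < \<epsilon>\<^sup>2 * m"
      using mult_strict_left_mono[OF \<epsilon>2(2), of "\<epsilon>\<^sup>2"] \<epsilon>(1) by (simp add: power2_eq_square power3_eq_cube mult.commute mult.left_commute)
    ultimately show ?thesis using co[of k] by simp
  qed
  have "cost L xb ub - cost L xe ue \<in> interior nonneg_orthant"
    using lt by (intro interior_nonneg_orthant) (simp add: cost_def zb_def)
  then have "cost L xe ue - cost L xb ub \<in> uminus ` interior nonneg_orthant"
    by (intro image_eqI[of _ _ "cost L xb ub - cost L xe ue"]) auto
  then show False using opt feas sup uae by blast
qed

text \<open>The separation takes place in the objective space, where disjointness of two nonempty
  convex sets suffices. The conditions are then extracted from \<lambda> \<bullet> V(w, e) \<ge> 0
  by three kinds of test pairs: (0, 0), large multiples of v - g in the place of e, and large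
  negative multiples of the control gradient in the place of w.\<close>

lemma multiplier_for_crit0:
  assumes pareto: "loc_weak_pareto L x0 \<phi> g xb ub" and crit: "crit0 DL D\<phi> g Dg xb ub x u"
  shows "\<exists>lam::real^'m. (\<forall>k. 0 \<le> lam $ k) \<and> norm lam = 1 \<and>
    (AE t in I01. \<forall>i. (\<Sum>k\<in>UNIV. lam $ k * HD k t (0, axis i 1)) = 0) \<and>
    (\<forall>v\<in>Qset. (\<Sum>k\<in>UNIV. lam $ k * (\<integral>t. \<theta> k t * (v t - g t (zb t)) \<partial>I01)) \<le> 0) \<and>
    0 \<le> (\<Sum>k\<in>UNIV. lam $ k * (\<integral>t. HD2 k t (x t, u t) (x t, u t) \<partial>I01))"
proof -
  define adm where "adm w e \<longleftrightarrow> Linf w \<and> Linf e \<and> (\<exists>\<mu>\<ge>0. AE t in I01. e t + \<mu> * g t (zb t) \<le> 0)" for w :: "real \<Rightarrow> real^'l" and e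
  define S where "S = {\<chi> k. V x u w e k |w e. adm w e}"
  define T where "T = {s::real^'m. \<forall>k. s $ k < 0}"
  have adm0: "adm (\<lambda>t. 0) (\<lambda>t. 0)" unfolding adm_def by (auto simp: Linf_zero intro!: exI[of _ 0])
  have "convex S"
    unfolding convex_def
  proof (intro ballI allI impI)
    fix s s' :: "real^'m" and a b :: real
    assume s: "s \<in> S" and s': "s' \<in> S" and ab: "0 \<le> a" "0 \<le> b" "a + b = 1"
    obtain w e where we: "s = (\<chi> k. V x u w e k)" "adm w e" using s by (auto simp: S_def)
    obtain w' e' where we': "s' = (\<chi> k. V x u w' e' k)" "adm w' e'" using s' by (auto simp: S_def)
    define w2 where "w2 t = a *\<^sub>R w t + b *\<^sub>R w' t" for t
    define e2 where "e2 t = a *\<^sub>R e t + b *\<^sub>R e' t" for t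
    have L: "Linf w" "Linf w'" "Linf e" "Linf e'" using we we' by (auto simp: adm_def)
    obtain \<mu> where \<mu>: "\<mu> \<ge> 0" "AE t in I01. e t + \<mu> * g t (zb t) \<le> 0" using we by (auto simp: adm_def)
    obtain \<mu>' where \<mu>': "\<mu>' \<ge> 0" "AE t in I01. e' t + \<mu>' * g t (zb t) \<le> 0" using we' by (auto simp: adm_def)
    have "adm w2 e2" unfolding adm_def
    proof (intro conjI exI[of _ "a * \<mu> + b * \<mu>'"])
      show "Linf w2" "Linf e2" unfolding w2_def e2_def by (intro Linf_lincomb L)+
      show "0 \<le> a * \<mu> + b * \<mu>'" using ab \<mu> \<mu>' by simp
      show "AE t in I01. e2 t + (a * \<mu> + b * \<mu>') * g t (zb t) \<le> 0"
        using \<mu>(2) \<mu>'(2)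
      proof eventually_elim
        case (elim t)
        have "e2 t + (a * \<mu> + b * \<mu>') * g t (zb t) = a * (e t + \<mu> * g t (zb t)) + b * (e' t + \<mu>' * g t (zb t))"
          by (simp add: e2_def algebra_simps)
        also have "\<dots> \<le> 0" by (rule add_nonpos_nonpos[OF mult_nonneg_nonpos[OF ab(1) elim(1)] mult_nonneg_nonpos[OF ab(2) elim(2)]])
        finally show ?case .
      qed
    qed
    moreover have "a *\<^sub>R s + b *\<^sub>R s' = (\<chi> k. V x u w2 e2 k)"
    proof (subst vec_eq_iff, intro allI)
      fix k
      have 1: "(\<integral>t. HD k t (0, w2 t) \<partial>I01) = a * (\<integral>t. HD k t (0, w t) \<partial>I01) + b * (\<integral>t. HD k t (0, w' t) \<partial>I01)"
      proof -
        have "HD k t (0, w2 t) = a * HD k t (0, w t) + b * HD k t (0, w' t)" for t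
          using HD_add[of k t "a *\<^sub>R (0, w t)" "b *\<^sub>R (0, w' t)"] HD_scale[of k t a "(0, w t)"] HD_scale[of k t b "(0, w' t)"]
          by (simp add: w2_def)
        then show ?thesis using integrable_HD_control[OF L(1)] integrable_HD_control[OF L(2)] by simp
      qed
      have 2: "(\<integral>t. \<theta> k t * e2 t \<partial>I01) = a * (\<integral>t. \<theta> k t * e t \<partial>I01) + b * (\<integral>t. \<theta> k t * e' t \<partial>I01)"
      proof -
        have "\<theta> k t * e2 t = a * (\<theta> k t * e t) + b * (\<theta> k t * e' t)" for t by (simp add: e2_def algebra_simps)
        then show ?thesis using integrable_\<theta>_Linf[OF L(3)] integrable_\<theta>_Linf[OF L(4)] by simp
      qed
      have "V x u w2 e2 k = a * V x u w e k + b * V x u w' e' k"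
      proof -
        define c where "c = (\<integral>t. HD2 k t (x t, u t) (x t, u t) \<partial>I01) / 2"
        have "c = a * c + b * c" using ab(3) by (simp add: distrib_right[symmetric])
        then show ?thesis unfolding V_def 1 2 c_def[symmetric] by (simp add: algebra_simps)
      qed
      then show "(a *\<^sub>R s + b *\<^sub>R s') $ k = (\<chi> k. V x u w2 e2 k) $ k" by (simp add: we we')
    qed
    ultimately show "a *\<^sub>R s + b *\<^sub>R s' \<in> S" by (auto simp: S_def)
  qed
  moreover have "convex T"
    unfolding convex_def T_def
  proof (intro ballI allI impI CollectI)
    fix s s' :: "real^'m" and a b :: real and k
    assume "s \<in> {s. \<forall>k. s $ k < 0}" "s' \<in> {s. \<forall>k. s $ k < 0}" "0 \<le> a" "0 \<le> b" "a + b = 1"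
    then show "(a *\<^sub>R s + b *\<^sub>R s') $ k < 0"
      using convex_bound_lt[of "s $ k" 0 "s' $ k" a b] by simp
  qed
  moreover have "S \<noteq> {}" using adm0 by (auto simp: S_def)
  moreover have "T \<noteq> {}" unfolding T_def by (auto intro!: exI[of _ "\<chi> k. -1"])
  moreover have "T \<inter> S = {}"
  proof -
    have "\<exists>k. 0 \<le> V x u w e k" if "adm w e" for w e
      using that no_descent[OF pareto crit] by (auto simp: adm_def)
    then show ?thesis unfolding S_def T_def
      by (intro equalityI subsetI) (simp_all, metis not_less vec_lambda_beta)
  qed
  ultimately obtain a b where a0: "a \<noteq> 0" and aT: "\<And>s. s \<in> T \<Longrightarrow> a \<bullet> s \<le> b" and aS: "\<And>s. s \<in> S \<Longrightarrow> b \<le> a \<bullet> s"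
    using separating_hyperplane_sets[of T S] by blast
  \<comment> \<open>0 lies in the closure of \<open>T\<close>: with b negative, the constant vector
    - r for this small r would violate \<open>aT\<close>.\<close>
  have b0: "0 \<le> b"
  proof (rule ccontr)
    assume "\<not> 0 \<le> b"
    define q where "q = (\<Sum>k\<in>UNIV. a $ k)"
    define r where "r = - b / (\<bar>q\<bar> + 1)"
    have "0 < r" using \<open>\<not> 0 \<le> b\<close> by (auto simp: r_def intro!: divide_neg_pos)
    then have "a \<bullet> (\<chi> k. - r) \<le> b" by (intro aT) (simp add: T_def)
    then have "- (r * q) \<le> b" by (simp add: inner_vec_def q_def sum_distrib_left sum_negf mult.commute)
    moreover have "r * q \<le> r * \<bar>q\<bar>" using \<open>0 < r\<close> by (intro mult_left_mono) auto
    moreover have "r * \<bar>q\<bar> < - b"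
    proof -
      have "r * (\<bar>q\<bar> + 1) = - b" by (simp add: r_def add_nonneg_pos less_imp_neq[symmetric])
      then show ?thesis using \<open>0 < r\<close> by (simp add: algebra_simps)
    qed
    ultimately show False by linarith
  qed
  \<comment> \<open>If \<open>a $ k\<close> were negative, sending coordinate k of a point of
    \<open>T\<close> to minus infinity would make the inner product with a unbounded above.\<close>
  have apos: "0 \<le> a $ k" for k
  proof -
    define q where "q = (\<Sum>j\<in>UNIV. a $ j)"
    have "- (a $ k) \<le> 0"
    proof (rule linear_nonneg_imp_nonpos)
      fix r :: real assume r: "r > 0"
      have "(\<chi> j. - 1 - (if j = k then r else 0)) \<in> T" using r by (auto simp: T_def)
      then have "a \<bullet> (\<chi> j. - 1 - (if j = k then r else 0)) \<le> b" by (rule aT)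
      moreover have "a \<bullet> (\<chi> j. - 1 - (if j = k then r else 0)) = - q - r * a $ k"
      proof -
        have "(\<chi> j. - 1 - (if j = k then r else 0)) = - (\<chi> j. 1) - r *\<^sub>R axis k 1" by (auto simp: vec_eq_iff axis_def)
        moreover have "a \<bullet> (\<chi> j. 1) = q" by (simp add: inner_vec_def q_def)
        ultimately show ?thesis by (simp add: inner_diff_right inner_axis)
      qed
      ultimately show "0 \<le> (b + q) - r * - (a $ k)" by simp
    qed
    then show ?thesis by simp
  qed
  define lam where "lam = (1 / norm a) *\<^sub>R a"
  have na: "norm a > 0" using a0 by simp
  have lV: "0 \<le> (\<Sum>k\<in>UNIV. lam $ k * V x u w e k)" if "adm w e" for w e
  proof -
    have "(\<chi> k. V x u w e k) \<in> S" using that by (auto simp: S_def)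
    then have "0 \<le> a \<bullet> (\<chi> k. V x u w e k)" using aS b0 by (meson order_trans)
    then have "0 \<le> lam \<bullet> (\<chi> k. V x u w e k)" using na by (simp add: lam_def)
    then show ?thesis by (simp add: inner_vec_def)
  qed
  define c where "c = (\<Sum>k\<in>UNIV. lam $ k * (\<integral>t. HD2 k t (x t, u t) (x t, u t) \<partial>I01))"
  have lV': "0 \<le> (\<Sum>k\<in>UNIV. lam $ k * (\<integral>t. HD k t (0, w t) \<partial>I01)) - (\<Sum>k\<in>UNIV. lam $ k * (\<integral>t. \<theta> k t * e t \<partial>I01)) + c / 2" if "adm w e" for w e
    using lV[OF that] by (simp add: V_def c_def algebra_simps sum.distrib sum_subtractf sum_divide_distrib)
  have HD0: "HD k t (0, 0) = 0" for k t using HD_scale[of k t 0 "(0,0)"] by simp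
  have c0: "0 \<le> c" using lV'[OF adm0] by (simp add: HD0)
  \<comment> \<open>r (v - g) is admissible for every r > 0, with \<mu> = r; the constant c / 2
    cannot compensate a positive slope as r grows.\<close>
  have N: "(\<Sum>k\<in>UNIV. lam $ k * (\<integral>t. \<theta> k t * (v t - g t (zb t)) \<partial>I01)) \<le> 0" if v: "v \<in> Qset" for v
  proof (rule linear_nonneg_imp_nonpos)
    fix r :: real assume r: "r > 0"
    have "adm (\<lambda>t. 0) (\<lambda>t. r * (v t - g t (zb t)))" unfolding adm_def
    proof (intro conjI exI[of _ r] Linf_zero)
      show "Linf (\<lambda>t. r * (v t - g t (zb t)))"
        using Linf_lincomb[OF _ g_zb_Linf, of v r "- r"] v by (simp add: Qset_def algebra_simps)
      have "AE t in I01. v t \<le> 0" using v by (simp add: Qset_def)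
      then show "AE t in I01. r * (v t - g t (zb t)) + r * g t (zb t) \<le> 0"
        by eventually_elim (use r in \<open>simp add: algebra_simps mult_nonneg_nonpos\<close>)
    qed (use r in auto)
    from lV'[OF this] show "0 \<le> c / 2 - r * (\<Sum>k\<in>UNIV. lam $ k * (\<integral>t. \<theta> k t * (v t - g t (zb t)) \<partial>I01))"
      by (simp add: HD0 mult.left_commute[of _ r] sum_distrib_left)
  qed
  \<comment> \<open>Control gradient of the weighted Hamiltonian. Testing with the control - r q for
    arbitrarily large r forces the integral of |q|^2 to vanish, so stationarity holds in all control
    directions simultaneously, almost everywhere.\<close>
  define q where "q t = (\<chi> i. \<Sum>k\<in>UNIV. lam $ k * HD k t (0, axis i 1))" for t
  have qm: "q \<in> borel_measurable I01"
  proof -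
    have "(\<lambda>t. \<Sum>i\<in>UNIV. (\<Sum>k\<in>UNIV. lam $ k * HD k t (0, axis i 1)) *\<^sub>R axis i 1 :: real^'l) \<in> borel_measurable I01"
      by (intro borel_measurable_sum borel_measurable_scaleR borel_measurable_times borel_measurable_const HD_measurable)
    moreover have "q = (\<lambda>t. \<Sum>i\<in>UNIV. (\<Sum>k\<in>UNIV. lam $ k * HD k t (0, axis i 1)) *\<^sub>R axis i 1)"
      by (auto simp: q_def fun_eq_iff vec_eq_iff axis_def if_distrib cong: if_cong)
    ultimately show ?thesis by simp
  qed
  obtain C where C: "C \<ge> 1" "\<And>k t d. t \<in> G \<Longrightarrow> \<bar>HD k t d\<bar> \<le> C * norm d" using multiplier_bounds by metis
  have qL: "Linf q"
  proof -
    have "AE t in I01. norm (q t) \<le> (\<Sum>i\<in>(UNIV::'l set). \<Sum>k\<in>UNIV. \<bar>lam $ k\<bar> * C)"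
      using Ls.G_AE
    proof eventually_elim
      case (elim t)
      have "norm (q t) \<le> (\<Sum>i\<in>UNIV. \<bar>q t $ i\<bar>)" by (rule norm_le_l1_cart)
      also have "\<dots> \<le> (\<Sum>i\<in>(UNIV::'l set). \<Sum>k\<in>UNIV. \<bar>lam $ k\<bar> * C)"
      proof (rule sum_mono)
        fix i
        have "\<bar>q t $ i\<bar> \<le> (\<Sum>k\<in>UNIV. \<bar>lam $ k * HD k t (0, axis i 1)\<bar>)" unfolding q_def by (simp add: sum_abs)
        also have "\<dots> \<le> (\<Sum>k\<in>UNIV. \<bar>lam $ k\<bar> * C)"
          using C(2)[OF elim, of _ "(0, axis i 1)"] unfolding abs_mult by (intro sum_mono mult_left_mono) (auto simp: norm_Pair norm_axis_one)
        finally show "\<bar>q t $ i\<bar> \<le> (\<Sum>k\<in>UNIV. \<bar>lam $ k\<bar> * C)" .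
      qed
      finally show ?case .
    qed
    then show ?thesis using qm by (auto simp: Linf_def)
  qed
  have HDq: "(\<Sum>k\<in>UNIV. lam $ k * HD k t (0, w)) = q t \<bullet> w" for t w
  proof -
    have "(\<Sum>k\<in>UNIV. lam $ k * HD k t (0, w)) = (\<Sum>k\<in>UNIV. \<Sum>i\<in>UNIV. lam $ k * (w $ i * HD k t (0, axis i 1)))"
      by (subst HD_control) (simp add: sum_distrib_left)
    also have "\<dots> = (\<Sum>i\<in>UNIV. \<Sum>k\<in>UNIV. lam $ k * (w $ i * HD k t (0, axis i 1)))" by (rule sum.swap)
    also have "\<dots> = q t \<bullet> w" by (simp add: q_def inner_vec_def sum_distrib_left sum_distrib_right mult.commute mult.left_commute)
    finally show ?thesis .
  qed
  have iq: "integrable I01 (\<lambda>t. q t \<bullet> q t)"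
  proof -
    have "integrable I01 (\<lambda>t. \<Sum>k\<in>UNIV. lam $ k * HD k t (0, q t))"
      using integrable_HD_control[OF qL] by (intro Bochner_Integration.integrable_sum integrable_mult_right)
    then show ?thesis by (simp add: HDq)
  qed
  have "(\<integral>t. q t \<bullet> q t \<partial>I01) \<le> 0"
  proof (rule linear_nonneg_imp_nonpos)
    fix r :: real assume r: "r > 0"
    have Lq: "Linf (\<lambda>t. - r *\<^sub>R q t)" using Linf_lincomb[OF qL qL, of "- r" 0] by simp
    have "adm (\<lambda>t. - r *\<^sub>R q t) (\<lambda>t. 0)" using Lq Linf_zero unfolding adm_def by (auto intro!: exI[of _ 0])
    from lV'[OF this] have "0 \<le> (\<Sum>k\<in>UNIV. lam $ k * (\<integral>t. HD k t (0, - r *\<^sub>R q t) \<partial>I01)) + c / 2" by simp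
    also have "(\<Sum>k\<in>UNIV. lam $ k * (\<integral>t. HD k t (0, - r *\<^sub>R q t) \<partial>I01)) = (\<integral>t. (\<Sum>k\<in>UNIV. lam $ k * HD k t (0, - r *\<^sub>R q t)) \<partial>I01)"
      using integrable_HD_control[OF Lq] by (simp add: Bochner_Integration.integral_sum)
    also have "\<dots> = - r * (\<integral>t. q t \<bullet> q t \<partial>I01)" unfolding HDq by simp
    finally show "0 \<le> c / 2 - r * (\<integral>t. q t \<bullet> q t \<partial>I01)" by simp
  qed
  moreover have "0 \<le> (\<integral>t. q t \<bullet> q t \<partial>I01)" by (intro Bochner_Integration.integral_nonneg) simp
  ultimately have "(\<integral>t. q t \<bullet> q t \<partial>I01) = 0" by simp
  then have q0: "AE t in I01. q t = 0"
    using integral_nonneg_eq_0_iff_AE[OF iq] by simp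
  show ?thesis
  proof (intro exI[of _ lam] conjI allI ballI N)
    show "0 \<le> lam $ k" for k using apos[of k] na by (simp add: lam_def)
    show "norm lam = 1" using na by (simp add: lam_def)
    show "AE t in I01. \<forall>i. (\<Sum>k\<in>UNIV. lam $ k * HD k t (0, axis i 1)) = 0"
      using q0 by eventually_elim (simp add: q_def vec_eq_iff)
    show "0 \<le> (\<Sum>k\<in>UNIV. lam $ k * (\<integral>t. HD2 k t (x t, u t) (x t, u t) \<partial>I01))" using c0 by (simp add: c_def)
  qed
qed

end

section \<open>Closure of the critical directions\<close>

context control_problem
begin

lemma lam_HD:
  fixes lam :: "real^'m"
  shows "lam \<bullet> DL t (zb t) d + (\<Sum>k\<in>UNIV. lam $ k *\<^sub>R adj k t) \<bullet> D\<phi> t (zb t) d + (\<Sum>k\<in>UNIV. lam $ k * \<theta> k t) * Dg t (zb t) d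
     = (\<Sum>k\<in>UNIV. lam $ k * HD k t d)"
  by (simp add: HD_def inner_vec_def[of lam] inner_sum_left sum_distrib_right distrib_left sum.distrib mult.assoc)

lemma lam_HD2:
  fixes lam :: "real^'m"
  shows "lam \<bullet> D2L t (zb t) d e + (\<Sum>k\<in>UNIV. lam $ k *\<^sub>R adj k t) \<bullet> D2\<phi> t (zb t) d e + (\<Sum>k\<in>UNIV. lam $ k * \<theta> k t) * D2g t (zb t) d e
     = (\<Sum>k\<in>UNIV. lam $ k * HD2 k t d e)"
  by (simp add: HD2_def inner_vec_def[of lam] inner_sum_left sum_distrib_right distrib_left sum.distrib mult.assoc)

lemma adj_lipschitz:
  obtains C where "\<And>k s t. \<lbrakk>0 \<le> s; s \<le> t; t \<le> 1\<rbrakk> \<Longrightarrow> norm (adj k t - adj k s) \<le> C * (t - s)"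
proof -
  obtain C where C: "\<And>k t. norm (Hx k t (adj k t)) \<le> C" using multiplier_bounds by metis
  have "norm (adj k t - adj k s) \<le> C * (t - s)" if "0 \<le> s" "s \<le> t" "t \<le> 1" for k s t
  proof -
    have "s \<in> {0..1}" "t \<in> {0..1}" using that by auto
    then show ?thesis
      unfolding adj_eq[OF \<open>s \<in> {0..1}\<close>] adj_eq[OF \<open>t \<in> {0..1}\<close>]
      using that C by (intro initial_integral_lipschitz(2) Hx_measurable adj_measurable AE_I2)
  qed
  then show ?thesis by (rule that)
qed

lemma adj_final: "adj k 1 = 0"
proof -
  have "AE s in I01. s \<notin> {1::real}"
  proof -
    have "AE s in lebesgue. s \<notin> {1::real}" by (intro AE_not_in) auto
    then show ?thesis by (subst AE_restrict_space_iff) auto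
  qed
  then have "AE s in I01. indicator {1..1} s *\<^sub>R Hx k s (adj k s) = 0" by eventually_elim auto
  then show ?thesis using adj_eq[of 1 k] by (simp add: integral_eq_zero_AE)
qed

lemma adj_derivative: "AE t in I01. (adj k has_vector_derivative - Hx k t (adj k t)) (at t)"
proof -
  obtain C where C: "\<And>t. norm (Hx k t (adj k t)) \<le> C" using multiplier_bounds by metis
  \<comment> \<open>\<open>adj_eq\<close> identifies \<open>adj k\<close> with the tail integral on
    [0,1]; without the endpoints this is agreement on a neighbourhood of t, which a two-sided
    derivative requires.\<close>
  have "AE s in lebesgue. s \<notin> {0, 1::real}" by (intro AE_not_in) auto
  then have "AE s in I01. s \<notin> {0, 1::real}" by (subst AE_restrict_space_iff) auto
  with has_vector_derivative_tail_integral_I01[OF Hx_measurable[OF adj_measurable] C] AE_space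
  show ?thesis
  proof eventually_elim
    case (elim t)
    then have t: "t \<in> {0<..<1}" by auto
    show ?case
      by (rule has_vector_derivative_transform_within_open[OF elim(1) _ t]) (auto simp: adj_eq[symmetric])
  qed
qed

text \<open>The bilinear form is changed one argument at a time; \<eta> \<le> 2 bounds the norm of
  d' by D + 2.\<close>

lemma HD2_diff:
  assumes C: "\<And>d e. \<bar>HD2 k t d e\<bar> \<le> C * norm d * norm e" "0 \<le> C"
    and d: "norm d \<le> D" "norm (d' - d) \<le> \<eta>" "\<eta> \<le> 2"
  shows "\<bar>HD2 k t d' d' - HD2 k t d d\<bar> \<le> C * (2 * D + 2) * \<eta>"
proof -
  have d': "norm d' \<le> D + 2" using d norm_triangle_sub[of d' d] by linarith
  have \<eta>0: "0 \<le> \<eta>" using d(2) by (rule order_trans[OF norm_ge_zero])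
  have "HD2 k t d' d' - HD2 k t d d = HD2 k t (d' - d) d' + HD2 k t d (d' - d)"
    by (simp add: HD2_def blinfun.diff_left blinfun.diff_right inner_diff_right algebra_simps)
  also have "\<bar>\<dots>\<bar> \<le> C * norm (d' - d) * norm d' + C * norm d * norm (d' - d)"
    using C(1)[of "d' - d" d'] C(1)[of d "d' - d"] by linarith
  also have "\<dots> \<le> C * \<eta> * (D + 2) + C * D * \<eta>"
    using d d' C(2) \<eta>0 order_trans[OF norm_ge_zero d(1)] by (intro add_mono mult_mono) auto
  finally show ?thesis by (simp add: algebra_simps)
qed

text \<open>\<open>adj k\<close> and \<open>\<theta> k\<close> depend neither on the direction nor
  on \<open>lam\<close>. The limit passage therefore concerns only unit vectors of the objective
  space and the quadratic integrals, whose integrands converge uniformly outside null sets; no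
  compactness of multiplier functions is involved.\<close>

lemma multiplier_for_crit:
  assumes pareto: "loc_weak_pareto L x0 \<phi> g xb ub" and crit: "crit DL D\<phi> g Dg xb ub x u"
  shows "\<exists>lam::real^'m. (\<forall>k. 0 \<le> lam $ k) \<and> norm lam = 1 \<and>
    (AE t in I01. \<forall>i. (\<Sum>k\<in>UNIV. lam $ k * HD k t (0, axis i 1)) = 0) \<and>
    (\<forall>v\<in>Qset. (\<Sum>k\<in>UNIV. lam $ k * (\<integral>t. \<theta> k t * (v t - g t (zb t)) \<partial>I01)) \<le> 0) \<and>
    0 \<le> (\<Sum>k\<in>UNIV. lam $ k * (\<integral>t. HD2 k t (x t, u t) (x t, u t) \<partial>I01))"
proof -
  have x: "continuous_on {0..1} x" and u: "Linf u" using crit by (auto simp: crit_def)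
  have ce: "\<forall>\<epsilon>>0. \<exists>x' u'. crit0 DL D\<phi> g Dg xb ub x' u' \<and> supnorm (\<lambda>t. x' t - x t) \<le> \<epsilon> \<and>
      (AE t in I01. norm (u' t - u t) \<le> \<epsilon>)"
    using crit unfolding crit_def by (elim conjE)
  have exq: "\<forall>n. \<exists>q. crit0 DL D\<phi> g Dg xb ub (fst q) (snd q) \<and> supnorm (\<lambda>t. fst q t - x t) \<le> 1 / real (Suc n) \<and>
      (AE t in I01. norm (snd q t - u t) \<le> 1 / real (Suc n))"
  proof
    fix n
    have "0 < 1 / real (Suc n)" by simp
    from ce[rule_format, OF this] obtain x' u' where "crit0 DL D\<phi> g Dg xb ub x' u' \<and> supnorm (\<lambda>t. x' t - x t) \<le> 1 / real (Suc n) \<and>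
      (AE t in I01. norm (u' t - u t) \<le> 1 / real (Suc n))" by (elim exE)
    then show "\<exists>q. crit0 DL D\<phi> g Dg xb ub (fst q) (snd q) \<and> supnorm (\<lambda>t. fst q t - x t) \<le> 1 / real (Suc n) \<and>
      (AE t in I01. norm (snd q t - u t) \<le> 1 / real (Suc n))" by (intro exI[of _ "(x', u')"]) simp
  qed
  obtain qs where qs: "\<forall>n. crit0 DL D\<phi> g Dg xb ub (fst (qs n)) (snd (qs n)) \<and> supnorm (\<lambda>t. fst (qs n) t - x t) \<le> 1 / real (Suc n) \<and>
      (AE t in I01. norm (snd (qs n) t - u t) \<le> 1 / real (Suc n))"
    using choice[OF exq] by (elim exE)
  define xs where "xs n = fst (qs n)" for n
  define us where "us n = snd (qs n)" for n
  have cr: "\<And>n. crit0 DL D\<phi> g Dg xb ub (xs n) (us n)"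
    and sx: "\<And>n. supnorm (\<lambda>t. xs n t - x t) \<le> 1 / real (Suc n)"
    and su: "\<And>n. AE t in I01. norm (us n t - u t) \<le> 1 / real (Suc n)"
    using qs unfolding xs_def us_def by blast+
  have "\<forall>n. \<exists>l::real^'m. (\<forall>k. 0 \<le> l $ k) \<and> norm (l) = 1 \<and>
    (AE t in I01. \<forall>i. (\<Sum>k\<in>UNIV. l $ k * HD k t (0, axis i 1)) = 0) \<and>
    (\<forall>v\<in>Qset. (\<Sum>k\<in>UNIV. l $ k * (\<integral>t. \<theta> k t * (v t - g t (zb t)) \<partial>I01)) \<le> 0) \<and>
    0 \<le> (\<Sum>k\<in>UNIV. l $ k * (\<integral>t. HD2 k t (xs n t, us n t) (xs n t, us n t) \<partial>I01))"
    using multiplier_for_crit0[OF pareto cr] by (intro allI)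
  from choice[OF this] obtain ls :: "nat \<Rightarrow> real^'m" where lsn: "\<forall>n. (\<forall>k. 0 \<le> ls n $ k) \<and> norm (ls n) = 1 \<and>
    (AE t in I01. \<forall>i. (\<Sum>k\<in>UNIV. ls n $ k * HD k t (0, axis i 1)) = 0) \<and>
    (\<forall>v\<in>Qset. (\<Sum>k\<in>UNIV. ls n $ k * (\<integral>t. \<theta> k t * (v t - g t (zb t)) \<partial>I01)) \<le> 0) \<and>
    0 \<le> (\<Sum>k\<in>UNIV. ls n $ k * (\<integral>t. HD2 k t (xs n t, us n t) (xs n t, us n t) \<partial>I01))"
    by (elim exE)
  have ls: "\<And>n k. 0 \<le> ls n $ k" "\<And>n. norm (ls n) = 1"
    and lsH: "\<And>n. AE t in I01. \<forall>i. (\<Sum>k\<in>UNIV. ls n $ k * HD k t (0, axis i 1)) = 0"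
    and lsN: "\<And>n v. v \<in> Qset \<Longrightarrow> (\<Sum>k\<in>UNIV. ls n $ k * (\<integral>t. \<theta> k t * (v t - g t (zb t)) \<partial>I01)) \<le> 0"
    and lsW: "\<And>n. 0 \<le> (\<Sum>k\<in>UNIV. ls n $ k * (\<integral>t. HD2 k t (xs n t, us n t) (xs n t, us n t) \<partial>I01))"
    using lsn by blast+
  have "compact (sphere (0::real^'m) 1)" by simp
  moreover have "\<forall>n. ls n \<in> sphere 0 1" using ls(2) by simp
  ultimately obtain lam r where lam: "lam \<in> sphere 0 1" and r: "strict_mono (r :: nat \<Rightarrow> nat)" and lim: "(ls \<circ> r) \<longlonglongrightarrow> lam"
    using seq_compactE[of "sphere (0::real^'m) 1" ls] by (metis compact_eq_seq_compact_metric)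
  have limk: "(\<lambda>n. ls (r n) $ k) \<longlonglongrightarrow> lam $ k" for k
    using tendsto_vec_nth[OF lim, of k] by (simp add: o_def)
  \<comment> \<open>\<open>supnorm\<close> is a bare \<open>Sup\<close>, which dominates the values
    once the set is bounded above; continuity on the compact interval provides this.\<close>
  have xn: "norm (xs n t - x t) \<le> 1 / real (Suc n)" if t: "t \<in> {0..1}" for n t
  proof -
    have "continuous_on {0..1} (\<lambda>t. norm (xs n t - x t))"
      using cr[of n] x by (intro continuous_intros) (auto simp: crit0_def)
    then have "bdd_above ((\<lambda>t. norm (xs n t - x t)) ` {0..1})"
      by (intro bounded_imp_bdd_above compact_imp_bounded compact_continuous_image) auto
    then have "norm (xs n t - x t) \<le> supnorm (\<lambda>t. xs n t - x t)"
      unfolding supnorm_def using t by (intro cSup_upper) auto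
    then show ?thesis using sx[of n] by linarith
  qed
  obtain Cu where Cu: "AE t in I01. norm (u t) \<le> Cu" using u by (auto simp: Linf_def)
  obtain Cx where Cx: "\<And>t. t \<in> {0..1} \<Longrightarrow> norm (x t) \<le> Cx"
    using compact_imp_bounded[OF compact_continuous_image[OF x]] unfolding bounded_iff by (metis compact_Icc image_eqI)
  obtain Cm where Cm: "Cm \<ge> 1" "\<And>k t d e. t \<in> G \<Longrightarrow> \<bar>HD2 k t d e\<bar> \<le> Cm * norm d * norm e" using multiplier_bounds by metis
  define D where "D = \<bar>Cx\<bar> + \<bar>Cu\<bar>"
  have dm: "(\<lambda>t. (x t, u t)) \<in> borel_measurable I01"
    using continuous_on_measurable_I01[OF x] Linf_measurable[OF u] by (rule borel_measurable_Pair)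
  have dsm: "(\<lambda>t. (xs n t, us n t)) \<in> borel_measurable I01" for n
    using cr[of n] by (intro borel_measurable_Pair continuous_on_measurable_I01 Linf_measurable) (auto simp: crit0_def)
  have dD: "AE t in I01. norm (x t, u t) \<le> D"
    using Cu AE_space
  proof eventually_elim
    case (elim t)
    then show ?case using norm_fst_snd_le(3)[of "x t" "u t"] Cx[of t] by (simp add: D_def)
  qed
  have dif: "AE t in I01. \<bar>HD2 k t (xs n t, us n t) (xs n t, us n t) - HD2 k t (x t, u t) (x t, u t)\<bar> \<le> Cm * (2 * D + 2) * (2 / real (Suc n))" for n k
    using dD su[of n] Ls.G_AE
  proof eventually_elim
    case (elim t)
    have n1: "norm ((xs n t, us n t) - (x t, u t)) \<le> 2 / real (Suc n)"
      using norm_fst_snd_le(3)[of "xs n t - x t" "us n t - u t"] elim(2) xn[OF G_subset[OF elim(3)], of n] by simp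
    have n2: "2 / real (Suc n) \<le> 2" by (simp add: field_simps)
    show ?case by (rule HD2_diff[OF Cm(2)[OF elim(3)] order_trans[OF zero_le_one Cm(1)] elim(1) n1 n2])
  qed
  have iW: "integrable I01 (\<lambda>t. HD2 k t (x t, u t) (x t, u t))" for k
  proof (rule integrable_I01_bounded[OF HD2_measurable[OF dm dm]])
    show "AE t in I01. norm (HD2 k t (x t, u t) (x t, u t)) \<le> Cm * D * D"
      using dD Ls.G_AE
    proof eventually_elim
      case (elim t)
      have "Cm * norm (x t, u t) * norm (x t, u t) \<le> Cm * D * D"
        using elim(1) Cm(1) by (intro mult_mono) (auto simp: D_def)
      then show ?case using Cm(2)[OF elim(2), of k "(x t, u t)" "(x t, u t)"] by simp
    qed
  qed
  have iWn: "integrable I01 (\<lambda>t. HD2 k t (xs n t, us n t) (xs n t, us n t))" for k n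
  proof -
    have "integrable I01 (\<lambda>t. HD2 k t (xs n t, us n t) (xs n t, us n t) - HD2 k t (x t, u t) (x t, u t))"
      using dif[of k n] HD2_measurable[OF dm dm, of k] HD2_measurable[OF dsm dsm, of k n]
      by (intro integrable_I01_bounded[where C="Cm * (2 * D + 2) * (2 / real (Suc n))"]) auto
    from Bochner_Integration.integrable_add[OF this iW[of k]] show ?thesis by simp
  qed
  have limW: "(\<lambda>n. \<integral>t. HD2 k t (xs n t, us n t) (xs n t, us n t) \<partial>I01) \<longlonglongrightarrow> (\<integral>t. HD2 k t (x t, u t) (x t, u t) \<partial>I01)" for k
  proof (rule LIM_zero_cancel, rule Lim_null_comparison)
    show "\<forall>\<^sub>F n in sequentially. norm ((\<integral>t. HD2 k t (xs n t, us n t) (xs n t, us n t) \<partial>I01) - (\<integral>t. HD2 k t (x t, u t) (x t, u t) \<partial>I01)) \<le> Cm * (2 * D + 2) * (2 / real (Suc n))"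
    proof (intro always_eventually allI)
      fix n
      have "(\<integral>t. HD2 k t (xs n t, us n t) (xs n t, us n t) \<partial>I01) - (\<integral>t. HD2 k t (x t, u t) (x t, u t) \<partial>I01)
         = (\<integral>t. HD2 k t (xs n t, us n t) (xs n t, us n t) - HD2 k t (x t, u t) (x t, u t) \<partial>I01)"
        using iW iWn by simp
      also have "norm \<dots> \<le> Cm * (2 * D + 2) * (2 / real (Suc n))"
        using dif[of k n] Cm(1) by (intro integral_I01_norm_le) (auto simp: D_def)
      finally show "norm ((\<integral>t. HD2 k t (xs n t, us n t) (xs n t, us n t) \<partial>I01) - (\<integral>t. HD2 k t (x t, u t) (x t, u t) \<partial>I01)) \<le> Cm * (2 * D + 2) * (2 / real (Suc n))" .
    qed
    have "(\<lambda>n. (Cm * (2 * D + 2) * 2) * inverse (real (Suc n))) \<longlonglongrightarrow> 0"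
      by (intro tendsto_mult_right_zero LIMSEQ_inverse_real_of_nat)
    then show "(\<lambda>n. Cm * (2 * D + 2) * (2 / real (Suc n))) \<longlonglongrightarrow> 0" by (simp add: field_simps)
  qed
  show ?thesis
  proof (intro exI[of _ lam] conjI allI ballI)
    show "0 \<le> lam $ k" for k using LIMSEQ_le_const[OF limk] ls(1) by blast
    show "norm lam = 1" using lam by simp
    have "AE t in I01. \<forall>n. \<forall>i. (\<Sum>k\<in>UNIV. ls n $ k * HD k t (0, axis i 1)) = 0"
      using lsH by (subst AE_all_countable) blast
    then show "AE t in I01. \<forall>i. (\<Sum>k\<in>UNIV. lam $ k * HD k t (0, axis i 1)) = 0"
    proof eventually_elim
      case (elim t)
      show ?case
      proof
        fix i
        have "(\<lambda>n. \<Sum>k\<in>UNIV. ls (r n) $ k * HD k t (0, axis i 1)) \<longlonglongrightarrow> (\<Sum>k\<in>UNIV. lam $ k * HD k t (0, axis i 1))"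
          by (intro tendsto_sum tendsto_mult limk tendsto_const)
        moreover have "(\<lambda>n. \<Sum>k\<in>UNIV. ls (r n) $ k * HD k t (0, axis i 1)) = (\<lambda>n. 0)" using elim by (intro ext) blast
        ultimately have "(\<lambda>n::nat. 0) \<longlonglongrightarrow> (\<Sum>k\<in>UNIV. lam $ k * HD k t (0, axis i 1))" by (simp only:)
        then show "(\<Sum>k\<in>UNIV. lam $ k * HD k t (0, axis i 1)) = 0" by (simp only: LIMSEQ_const_iff)
      qed
    qed
    show "(\<Sum>k\<in>UNIV. lam $ k * (\<integral>t. \<theta> k t * (v t - g t (zb t)) \<partial>I01)) \<le> 0" if "v \<in> Qset" for v
    proof (rule LIMSEQ_le_const2)
      show "(\<lambda>n. \<Sum>k\<in>UNIV. ls (r n) $ k * (\<integral>t. \<theta> k t * (v t - g t (zb t)) \<partial>I01)) \<longlonglongrightarrow> (\<Sum>k\<in>UNIV. lam $ k * (\<integral>t. \<theta> k t * (v t - g t (zb t)) \<partial>I01))"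
        by (intro tendsto_sum tendsto_mult limk tendsto_const)
    qed (use lsN[OF that] in auto)
    show "0 \<le> (\<Sum>k\<in>UNIV. lam $ k * (\<integral>t. HD2 k t (x t, u t) (x t, u t) \<partial>I01))"
    proof (rule LIMSEQ_le_const)
      show "(\<lambda>n. \<Sum>k\<in>UNIV. ls (r n) $ k * (\<integral>t. HD2 k t (xs (r n) t, us (r n) t) (xs (r n) t, us (r n) t) \<partial>I01))
         \<longlonglongrightarrow> (\<Sum>k\<in>UNIV. lam $ k * (\<integral>t. HD2 k t (x t, u t) (x t, u t) \<partial>I01))"
        using LIMSEQ_subseq_LIMSEQ[OF limW r] by (intro tendsto_sum tendsto_mult limk) (simp add: o_def)
    qed (use lsW in auto)
  qed
qed

lemma multipliers_exist:
  assumes pareto: "loc_weak_pareto L x0 \<phi> g xb ub" and crit: "crit DL D\<phi> g Dg xb ub x u"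
  shows "\<exists>(lam::real^'m) (p::real \<Rightarrow> real^'n) (\<theta>::real \<Rightarrow> real).
     (\<forall>j. 0 \<le> lam $ j) \<and> norm lam = 1 \<and> abs_cont_01 p \<and> integrable I01 \<theta> \<and>
     (\<forall>v\<in>Qset. integral\<^sup>L I01 (\<lambda>t. \<theta> t * (v t - g t (xb t, ub t))) \<le> 0) \<and>
     (AE t in I01. (p has_vector_derivative
        (\<chi> i. - inner lam (blinfun_apply (DL t (xb t, ub t)) (axis i 1, 0))
              - inner (p t) (blinfun_apply (D\<phi> t (xb t, ub t)) (axis i 1, 0))
              - \<theta> t * blinfun_apply (Dg t (xb t, ub t)) (axis i 1, 0))) (at t)) \<and>
     p 1 = 0 \<and>
     (AE t in I01. \<forall>i.
        inner lam (blinfun_apply (DL t (xb t, ub t)) (0, axis i 1))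
        + inner (p t) (blinfun_apply (D\<phi> t (xb t, ub t)) (0, axis i 1))
        + \<theta> t * blinfun_apply (Dg t (xb t, ub t)) (0, axis i 1) = 0) \<and>
     integral\<^sup>L I01 (\<lambda>t. inner lam
          (blinfun_apply (blinfun_apply (D2L t (xb t, ub t)) (x t, u t)) (x t, u t)))
     + integral\<^sup>L I01 (\<lambda>t. inner (p t)
          (blinfun_apply (blinfun_apply (D2\<phi> t (xb t, ub t)) (x t, u t)) (x t, u t)))
     + integral\<^sup>L I01 (\<lambda>t. \<theta> t *
          blinfun_apply (blinfun_apply (D2g t (xb t, ub t)) (x t, u t)) (x t, u t))
     \<ge> 0"
proof -
  obtain lam :: "real^'m" where lam: "\<And>k. 0 \<le> lam $ k" "norm lam = 1"
    and H: "AE t in I01. \<forall>i. (\<Sum>k\<in>UNIV. lam $ k * HD k t (0, axis i 1)) = 0"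
    and N: "\<And>v. v \<in> Qset \<Longrightarrow> (\<Sum>k\<in>UNIV. lam $ k * (\<integral>t. \<theta> k t * (v t - g t (zb t)) \<partial>I01)) \<le> 0"
    and W: "0 \<le> (\<Sum>k\<in>UNIV. lam $ k * (\<integral>t. HD2 k t (x t, u t) (x t, u t) \<partial>I01))"
    using multiplier_for_crit[OF pareto crit] by blast
  \<comment> \<open>For fixed t, the first and second derivatives of the Lagrangian are linear in
    the triple (lam, p, \<theta>), so weighted sums of the single-objective multipliers satisfy the
    adjoint equation and inherit the other conditions.\<close>
  define p where "p t = (\<Sum>k\<in>UNIV. lam $ k *\<^sub>R adj k t)" for t
  define \<Theta> where "\<Theta> t = (\<Sum>k\<in>UNIV. lam $ k * \<theta> k t)" for t
  have x: "continuous_on {0..1} x" and u: "Linf u" using crit by (auto simp: crit_def)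
  have dm: "(\<lambda>t. (x t, u t)) \<in> borel_measurable I01"
    using continuous_on_measurable_I01[OF x] Linf_measurable[OF u] by (rule borel_measurable_Pair)
  obtain Cu where Cu: "AE t in I01. norm (u t) \<le> Cu" using u by (auto simp: Linf_def)
  obtain Cx where Cx: "\<And>t. t \<in> {0..1} \<Longrightarrow> norm (x t) \<le> Cx"
    using compact_imp_bounded[OF compact_continuous_image[OF x]] unfolding bounded_iff by (metis compact_Icc image_eqI)
  define D where "D = \<bar>Cx\<bar> + \<bar>Cu\<bar>"
  have dD: "AE t in I01. norm (x t, u t) \<le> D"
    using Cu AE_space
  proof eventually_elim
    case (elim t)
    then show ?case using norm_fst_snd_le(3)[of "x t" "u t"] Cx[of t] by (simp add: D_def)
  qed
  obtain Cm where Cm: "Cm \<ge> 1" "\<And>k t. norm (adj k t) \<le> Cm" "\<And>k t. \<bar>\<theta> k t\<bar> \<le> Cm"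
    "\<And>k t d e. t \<in> G \<Longrightarrow> \<bar>HD2 k t d e\<bar> \<le> Cm * norm d * norm e" using multiplier_bounds by metis
  have B2: "AE t in I01. B * norm (x t, u t) * norm (x t, u t) \<le> B * D * D \<and> Cm * norm (x t, u t) * norm (x t, u t) \<le> Cm * D * D"
    using dD by eventually_elim (use B1 Cm(1) in \<open>auto simp: D_def intro!: mult_mono\<close>)
  \<comment> \<open>The second-order conclusion consists of three separate integrals, whereas the
    quadratic form is integrated as a whole; splitting it uses integrability of each term.\<close>
  have iL: "integrable I01 (\<lambda>t. lam \<bullet> D2L t (zb t) (x t, u t) (x t, u t))"
  proof (intro integrable_inner_right integrable_I01_bounded[where C="B * D * D"])
    show "(\<lambda>t. D2L t (zb t) (x t, u t) (x t, u t)) \<in> borel_measurable I01" by (rule Ls.D2_measurable[OF zb_meas dm dm])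
    show "AE t in I01. norm (D2L t (zb t) (x t, u t) (x t, u t)) \<le> B * D * D"
      using B2 Ls.G_AE
    proof eventually_elim
      case (elim t)
      show ?case using D_bound(4)[OF elim(2)] elim(1) by (meson order_trans)
    qed
  qed
  have pb: "norm (p t) \<le> (\<Sum>k\<in>(UNIV::'m set). \<bar>lam $ k\<bar> * Cm)" and \<Theta>b: "\<bar>\<Theta> t\<bar> \<le> (\<Sum>k\<in>(UNIV::'m set). \<bar>lam $ k\<bar> * Cm)" for t
    unfolding p_def \<Theta>_def using Cm(2,3)[of _ t]
    by (auto intro!: order_trans[OF norm_sum] order_trans[OF sum_abs] sum_mono mult_left_mono simp: abs_mult)
  define Cp where "Cp = (\<Sum>k\<in>(UNIV::'m set). \<bar>lam $ k\<bar> * Cm)"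
  have Cp0: "0 \<le> Cp" using order_trans[OF norm_ge_zero pb] by (simp add: Cp_def)
  have pm: "p \<in> borel_measurable I01" and \<Theta>m: "\<Theta> \<in> borel_measurable I01"
    unfolding p_def \<Theta>_def by (intro borel_measurable_sum borel_measurable_scaleR borel_measurable_times borel_measurable_const adj_measurable \<theta>_measurable)+
  have iP: "integrable I01 (\<lambda>t. p t \<bullet> D2\<phi> t (zb t) (x t, u t) (x t, u t))"
  proof (rule integrable_I01_bounded)
    show "(\<lambda>t. p t \<bullet> D2\<phi> t (zb t) (x t, u t) (x t, u t)) \<in> borel_measurable I01"
      by (intro borel_measurable_inner pm Ps.D2_measurable[OF zb_meas dm dm])
    show "AE t in I01. norm (p t \<bullet> D2\<phi> t (zb t) (x t, u t) (x t, u t)) \<le> Cp * (B * D * D)"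
      using B2 Ls.G_AE
    proof eventually_elim
      case (elim t)
      have "norm (D2\<phi> t (zb t) (x t, u t) (x t, u t)) \<le> B * D * D" using D_bound(5)[OF elim(2)] elim(1) by (meson order_trans)
      then have "norm (p t) * norm (D2\<phi> t (zb t) (x t, u t) (x t, u t)) \<le> Cp * (B * D * D)"
        using pb[of t] Cp0 by (intro mult_mono) (auto simp: Cp_def)
      then show ?case using Cauchy_Schwarz_ineq2[of "p t" "D2\<phi> t (zb t) (x t, u t) (x t, u t)"] by simp
    qed
  qed
  have iG: "integrable I01 (\<lambda>t. \<Theta> t * D2g t (zb t) (x t, u t) (x t, u t))"
  proof (rule integrable_I01_bounded)
    show "(\<lambda>t. \<Theta> t * D2g t (zb t) (x t, u t) (x t, u t)) \<in> borel_measurable I01"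
      by (intro borel_measurable_times \<Theta>m Gs.D2_measurable[OF zb_meas dm dm])
    show "AE t in I01. norm (\<Theta> t * D2g t (zb t) (x t, u t) (x t, u t)) \<le> Cp * (B * D * D)"
      using B2 Ls.G_AE
    proof eventually_elim
      case (elim t)
      have "\<bar>D2g t (zb t) (x t, u t) (x t, u t)\<bar> \<le> B * D * D" using D_bound(6)[OF elim(2)] elim(1) by (meson order_trans)
      then show ?case unfolding real_norm_def abs_mult
        using \<Theta>b[of t] Cp0 by (intro mult_mono) (auto simp: Cp_def)
    qed
  qed
  have iW: "integrable I01 (\<lambda>t. HD2 k t (x t, u t) (x t, u t))" for k
  proof (rule integrable_I01_bounded[OF HD2_measurable[OF dm dm]])
    show "AE t in I01. norm (HD2 k t (x t, u t) (x t, u t)) \<le> Cm * D * D"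
      using B2 Ls.G_AE
    proof eventually_elim
      case (elim t)
      show ?case unfolding real_norm_def using Cm(4)[OF elim(2)] elim(1) by (meson order_trans)
    qed
  qed
  have "0 \<le> (\<integral>t. (\<Sum>k\<in>UNIV. lam $ k * HD2 k t (x t, u t) (x t, u t)) \<partial>I01)"
    using W iW by (simp add: Bochner_Integration.integral_sum)
  also have "\<dots> = (\<integral>t. lam \<bullet> D2L t (zb t) (x t, u t) (x t, u t) + p t \<bullet> D2\<phi> t (zb t) (x t, u t) (x t, u t)
      + \<Theta> t * D2g t (zb t) (x t, u t) (x t, u t) \<partial>I01)"
    unfolding p_def \<Theta>_def lam_HD2 ..
  also have "\<dots> = (\<integral>t. lam \<bullet> D2L t (zb t) (x t, u t) (x t, u t) \<partial>I01) + (\<integral>t. p t \<bullet> D2\<phi> t (zb t) (x t, u t) (x t, u t) \<partial>I01)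
      + (\<integral>t. \<Theta> t * D2g t (zb t) (x t, u t) (x t, u t) \<partial>I01)"
    using iL iP iG by simp
  finally have second: "0 \<le> \<dots>" .
  show ?thesis
    unfolding zb_def[symmetric]
  proof (intro exI[of _ lam] exI[of _ p] exI[of _ \<Theta>] conjI allI ballI)
    show "0 \<le> lam $ j" for j by (rule lam)
    show "norm lam = 1" by (rule lam)
    show "abs_cont_01 p"
    proof -
      obtain C where C: "\<And>k s t. \<lbrakk>0 \<le> s; s \<le> t; t \<le> 1\<rbrakk> \<Longrightarrow> norm (adj k t - adj k s) \<le> C * (t - s)" using adj_lipschitz by metis
      have "norm (p t - p s) \<le> (\<Sum>k\<in>(UNIV::'m set). \<bar>lam $ k\<bar> * C) * (t - s)" if "0 \<le> s" "s \<le> t" "t \<le> 1" for s t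
      proof -
        have "p t - p s = (\<Sum>k\<in>UNIV. lam $ k *\<^sub>R (adj k t - adj k s))" by (simp add: p_def sum_subtractf scaleR_diff_right)
        also have "norm \<dots> \<le> (\<Sum>k\<in>UNIV. \<bar>lam $ k\<bar> * (C * (t - s)))"
          using C[OF that] by (intro order_trans[OF norm_sum] sum_mono) (simp add: mult_left_mono)
        finally show ?thesis by (simp add: sum_distrib_right mult.assoc)
      qed
      then show ?thesis by (rule abs_cont_01_lipschitz)
    qed
    show "integrable I01 \<Theta>" using \<Theta>m \<Theta>b by (intro integrable_I01_bounded) auto
    show "integral\<^sup>L I01 (\<lambda>t. \<Theta> t * (v t - g t (zb t))) \<le> 0" if v: "v \<in> Qset" for v
    proof -
      have "Linf (\<lambda>t. v t - g t (zb t))"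
        using Linf_lincomb[OF _ g_zb_Linf, of v 1 "- 1"] v by (simp add: Qset_def)
      note i = integrable_\<theta>_Linf[OF this]
      have "(\<integral>t. \<Theta> t * (v t - g t (zb t)) \<partial>I01) = (\<integral>t. (\<Sum>k\<in>UNIV. lam $ k * (\<theta> k t * (v t - g t (zb t)))) \<partial>I01)"
        by (simp add: \<Theta>_def sum_distrib_right mult.assoc)
      also have "\<dots> = (\<Sum>k\<in>UNIV. lam $ k * (\<integral>t. \<theta> k t * (v t - g t (zb t)) \<partial>I01))"
        using i by (simp add: Bochner_Integration.integral_sum)
      finally show ?thesis using N[OF v] by simp
    qed
    have "AE t in I01. \<forall>k. (adj k has_vector_derivative - Hx k t (adj k t)) (at t)"
      using adj_derivative by (subst AE_all_countable) blast
    then show "AE t in I01. (p has_vector_derivative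
        (\<chi> i. - inner lam (DL t (zb t) (axis i 1, 0)) - inner (p t) (D\<phi> t (zb t) (axis i 1, 0)) - \<Theta> t * Dg t (zb t) (axis i 1, 0))) (at t)"
      using Ls.G_AE
    proof eventually_elim
      case (elim t)
      have "(p has_vector_derivative (\<Sum>k\<in>UNIV. lam $ k *\<^sub>R - Hx k t (adj k t))) (at t)"
        unfolding p_def using elim(1)
        by (intro has_vector_derivative_sum bounded_linear.has_vector_derivative[OF bounded_linear_scaleR_right]) auto
      moreover have "(\<Sum>k\<in>UNIV. lam $ k *\<^sub>R - Hx k t (adj k t)) =
         (\<chi> i. - inner lam (DL t (zb t) (axis i 1, 0)) - inner (p t) (D\<phi> t (zb t) (axis i 1, 0)) - \<Theta> t * Dg t (zb t) (axis i 1, 0))"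
      proof (subst vec_eq_iff, intro allI)
        fix i
        have "(\<Sum>k\<in>UNIV. lam $ k *\<^sub>R - Hx k t (adj k t)) $ i = - (\<Sum>k\<in>UNIV. lam $ k * HD k t (axis i 1, 0))"
          using elim(2) by (simp add: Hx_def HD_eq sum_negf)
        then show "(\<Sum>k\<in>UNIV. lam $ k *\<^sub>R - Hx k t (adj k t)) $ i =
          (\<chi> i. - inner lam (DL t (zb t) (axis i 1, 0)) - inner (p t) (D\<phi> t (zb t) (axis i 1, 0)) - \<Theta> t * Dg t (zb t) (axis i 1, 0)) $ i"
          unfolding lam_HD[symmetric] p_def \<Theta>_def by simp
      qed
      ultimately show ?case by simp
    qed
    show "p 1 = 0" by (simp add: p_def adj_final)
    show "AE t in I01. \<forall>i. inner lam (DL t (zb t) (0, axis i 1)) + inner (p t) (D\<phi> t (zb t) (0, axis i 1)) + \<Theta> t * Dg t (zb t) (0, axis i 1) = 0"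
      using H unfolding p_def \<Theta>_def lam_HD .
    show "0 \<le> (\<integral>t. lam \<bullet> D2L t (zb t) (x t, u t) (x t, u t) \<partial>I01) + (\<integral>t. p t \<bullet> D2\<phi> t (zb t) (x t, u t) (x t, u t) \<partial>I01)
      + (\<integral>t. \<Theta> t * D2g t (zb t) (x t, u t) (x t, u t) \<partial>I01)" by (rule second)
  qed
qed

end

section \<open>From the hypotheses of the theorem to the pointwise setting\<close>

lemma continuous_AE_eq:
  fixes f h :: "real \<Rightarrow> 'a::euclidean_space"
  assumes "continuous_on {0..1} f" "continuous_on {0..1} h" and ae: "AE t in I01. f t = h t" and t: "t \<in> {0..1}"
  shows "f t = h t"
proof -
  have c: "continuous_on {0..1} (\<lambda>t. norm (f t - h t))" using assms by (intro continuous_intros)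
  have i: "integrable I01 (\<lambda>t. norm (f t - h t))" using continuous_imp_integrable_real[OF c] .
  have "(\<integral>t. norm (f t - h t) \<partial>I01) = 0" by (rule integral_eq_zero_AE) (use ae in auto)
  then have "integral {0..1} (\<lambda>t. norm (f t - h t)) = 0" using lebesgue_integral_eq_integral[OF i] by simp
  then have "norm (f t - h t) = 0" using integral_eq_0_iff[OF c] t by simp
  then show ?thesis by simp
qed

text \<open>The hypotheses measure distance by |x1 - x2| + |u1 - u2|, which is at most twice the
  norm of the difference of the pairs; hence 2 k. On the ball, values are bounded by the value at 0
  plus 2 k M.\<close>

lemma smooth_familyI:
  fixes f :: "real \<Rightarrow> ((real^'n) \<times> (real^'l)) \<Rightarrow> 'b::euclidean_space"
  assumes G: "G \<in> sets I01" "AE t in I01. t \<in> G" and m: "\<And>z. (\<lambda>t. f t z) \<in> borel_measurable I01"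
    and D1: "\<And>t z. t \<in> G \<Longrightarrow> (f t has_derivative blinfun_apply (Df t z)) (at z)"
    and D2: "\<And>t z. t \<in> G \<Longrightarrow> (Df t has_derivative blinfun_apply (D2f t z)) (at z)"
    and lip: "\<And>t x1 u1 x2 u2. \<lbrakk>t \<in> G; norm x1 \<le> M; norm u1 \<le> M; norm x2 \<le> M; norm u2 \<le> M\<rbrakk> \<Longrightarrow>
        norm (f t (x1, u1) - f t (x2, u2)) \<le> k * (norm (x1 - x2) + norm (u1 - u2)) \<and>
        norm (Df t (x1, u1) - Df t (x2, u2)) \<le> k * (norm (x1 - x2) + norm (u1 - u2)) \<and>
        norm (D2f t (x1, u1) - D2f t (x2, u2)) \<le> k * (norm (x1 - x2) + norm (u1 - u2))"
    and zero: "\<And>t. t \<in> G \<Longrightarrow> norm (f t 0) \<le> C \<and> norm (Df t 0) \<le> C \<and> norm (D2f t 0) \<le> C"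
    and const: "0 \<le> M" "0 \<le> k" "2 * k \<le> B" "C + 2 * k * M \<le> B"
  shows "smooth_family G M B f Df D2f"
proof -
  have le: "norm (f t z - f t z') \<le> 2 * k * norm (z - z') \<and> norm (Df t z - Df t z') \<le> 2 * k * norm (z - z') \<and>
      norm (D2f t z - D2f t z') \<le> 2 * k * norm (z - z')" if "t \<in> G" "norm z \<le> M" "norm z' \<le> M" for t z z'
  proof -
    have n: "norm (fst z) \<le> M" "norm (snd z) \<le> M" "norm (fst z') \<le> M" "norm (snd z') \<le> M"
      using norm_fst_snd_le(1,2)[of z] norm_fst_snd_le(1,2)[of z'] that by linarith+
    have "norm (fst z - fst z') + norm (snd z - snd z') \<le> 2 * norm (z - z')"
      using norm_fst_snd_le(1,2)[of "z - z'"] by simp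
    then have "k * (norm (fst z - fst z') + norm (snd z - snd z')) \<le> 2 * k * norm (z - z')"
      using mult_left_mono[OF _ const(2)] by fastforce
    then show ?thesis using lip[OF that(1) n] by simp
  qed
  have lB: "2 * k * norm (z - z') \<le> B * norm (z - z')" for z z' :: "(real^'n) \<times> (real^'l)" using const by (intro mult_right_mono) auto
  have bound: "norm (f t z) \<le> B" "norm (Df t z) \<le> B" "norm (D2f t z) \<le> B" if t: "t \<in> G" "norm z \<le> M" for t z
  proof -
    have "2 * k * norm (z - 0) \<le> 2 * k * M" using that const by (intro mult_left_mono) auto
    then show "norm (f t z) \<le> B" "norm (Df t z) \<le> B" "norm (D2f t z) \<le> B"
      using le[OF t, of 0] zero[OF t(1)] const norm_triangle_sub[of "f t z" "f t 0"] norm_triangle_sub[of "Df t z" "Df t 0"]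
        norm_triangle_sub[of "D2f t z" "D2f t 0"] by auto
  qed
  show ?thesis
  proof unfold_locales
    fix t and z z' :: "(real^'n) \<times> (real^'l)" assume t: "t \<in> G" and z: "norm z \<le> M" "norm z' \<le> M"
    show "norm (Df t z - Df t z') \<le> B * norm (z - z')" "norm (D2f t z - D2f t z') \<le> B * norm (z - z')"
      using le[OF t z] lB[of z z'] by linarith+
  qed (use G m D1 D2 bound in auto)
qed

lemma continuous_slice_measurable:
  fixes f :: "real \<Rightarrow> 'a::euclidean_space \<Rightarrow> 'b::euclidean_space"
  assumes "continuous_on ({0..1} \<times> UNIV) (\<lambda>(t,z). f t z)"
  shows "(\<lambda>t. f t z) \<in> borel_measurable I01"
proof (rule continuous_on_measurable_I01)
  have "continuous_on {0..1} (\<lambda>t. (\<lambda>(t,z). f t z) (t, z))"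
    by (rule continuous_on_compose2[OF assms]) (auto intro!: continuous_intros)
  then show "continuous_on {0..1} (\<lambda>t. f t z)" by simp
qed

theorem theorem2p1:
  fixes L :: "real \<Rightarrow> ((real^'n) \<times> (real^'l)) \<Rightarrow> real^'m"
    and \<phi> :: "real \<Rightarrow> ((real^'n) \<times> (real^'l)) \<Rightarrow> real^'n"
    and g :: "real \<Rightarrow> ((real^'n) \<times> (real^'l)) \<Rightarrow> real"
    and DL :: "real \<Rightarrow> ((real^'n) \<times> (real^'l)) \<Rightarrow> ((real^'n) \<times> (real^'l)) \<Rightarrow>\<^sub>L (real^'m)"
    and D2L :: "real \<Rightarrow> ((real^'n) \<times> (real^'l)) \<Rightarrow> ((real^'n) \<times> (real^'l)) \<Rightarrow>\<^sub>L (((real^'n) \<times> (real^'l)) \<Rightarrow>\<^sub>L (real^'m))"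
    and D\<phi> :: "real \<Rightarrow> ((real^'n) \<times> (real^'l)) \<Rightarrow> ((real^'n) \<times> (real^'l)) \<Rightarrow>\<^sub>L (real^'n)"
    and D2\<phi> :: "real \<Rightarrow> ((real^'n) \<times> (real^'l)) \<Rightarrow> ((real^'n) \<times> (real^'l)) \<Rightarrow>\<^sub>L (((real^'n) \<times> (real^'l)) \<Rightarrow>\<^sub>L (real^'n))"
    and Dg :: "real \<Rightarrow> ((real^'n) \<times> (real^'l)) \<Rightarrow> ((real^'n) \<times> (real^'l)) \<Rightarrow>\<^sub>L real"
    and D2g :: "real \<Rightarrow> ((real^'n) \<times> (real^'l)) \<Rightarrow> ((real^'n) \<times> (real^'l)) \<Rightarrow>\<^sub>L (((real^'n) \<times> (real^'l)) \<Rightarrow>\<^sub>L real)"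
    and x0 :: "real^'n"
    and xb x :: "real \<Rightarrow> real^'n"
    and ub u :: "real \<Rightarrow> real^'l"
  \<comment> \<open>(H1): L is Caratheodory\<close>
  assumes L_meas: "\<And>z. (\<lambda>t. L t z) \<in> borel_measurable I01"
    and L_cont: "AE t in I01. continuous_on UNIV (L t)"
  \<comment> \<open>(H1): (phi,g) is continuous\<close>
    and \<phi>_cont: "continuous_on ({0..1} \<times> UNIV) (\<lambda>(t,z). \<phi> t z)"
    and g_cont: "continuous_on ({0..1} \<times> UNIV) (\<lambda>(t,z). g t z)"
  \<comment> \<open>(H1): L(t,.,.) is C^2 for a.e. t, with first/second derivatives DL, D2L\<close>
    and L_C2: "AE t in I01. \<forall>z.
         (L t has_derivative blinfun_apply (DL t z)) (at z) \<and>
         (DL t has_derivative blinfun_apply (D2L t z)) (at z) \<and> continuous_on UNIV (D2L t)"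
  \<comment> \<open>(H1): phi(t,.,.), g(t,.,.) are C^2 for all t\<close>
    and \<phi>_C2: "\<forall>t\<in>{0..1}. \<forall>z.
         (\<phi> t has_derivative blinfun_apply (D\<phi> t z)) (at z) \<and>
         (D\<phi> t has_derivative blinfun_apply (D2\<phi> t z)) (at z) \<and> continuous_on UNIV (D2\<phi> t)"
    and g_C2: "\<forall>t\<in>{0..1}. \<forall>z.
         (g t has_derivative blinfun_apply (Dg t z)) (at z) \<and>
         (Dg t has_derivative blinfun_apply (D2g t z)) (at z) \<and> continuous_on UNIV (D2g t)"
  \<comment> \<open>(H1): local Lipschitz conditions\<close>
    and L_lip: "\<forall>M>0. \<exists>k>0. AE t in I01. \<forall>x1 u1 x2 u2.
         norm x1 \<le> M \<and> norm u1 \<le> M \<and> norm x2 \<le> M \<and> norm u2 \<le> M \<longrightarrow>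
         norm (L t (x1, u1) - L t (x2, u2)) + norm (DL t (x1, u1) - DL t (x2, u2))
           + norm (D2L t (x1, u1) - D2L t (x2, u2)) \<le> k * (norm (x1 - x2) + norm (u1 - u2))"
    and \<phi>g_lip: "\<forall>M>0. \<exists>k>0. \<forall>t\<in>{0..1}. \<forall>x1 u1 x2 u2.
         norm x1 \<le> M \<and> norm u1 \<le> M \<and> norm x2 \<le> M \<and> norm u2 \<le> M \<longrightarrow>
         norm (\<phi> t (x1, u1) - \<phi> t (x2, u2)) + \<bar>g t (x1, u1) - g t (x2, u2)\<bar>
           + norm (D\<phi> t (x1, u1) - D\<phi> t (x2, u2)) + norm (Dg t (x1, u1) - Dg t (x2, u2))
           + norm (D2\<phi> t (x1, u1) - D2\<phi> t (x2, u2)) + norm (D2g t (x1, u1) - D2g t (x2, u2))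
           \<le> k * (norm (x1 - x2) + norm (u1 - u2))"
  \<comment> \<open>(H1): values at (x,u) = (0,0) are in L-infinity\<close>
    and L0_bd: "Linf (\<lambda>t. L t 0)" "Linf (\<lambda>t. norm (DL t 0))" "Linf (\<lambda>t. norm (D2L t 0))"
    and \<phi>0_bd: "Linf (\<lambda>t. \<phi> t 0)" "Linf (\<lambda>t. norm (D\<phi> t 0))" "Linf (\<lambda>t. norm (D2\<phi> t 0))"
    and g0_bd: "Linf (\<lambda>t. g t 0)" "Linf (\<lambda>t. norm (Dg t 0))" "Linf (\<lambda>t. norm (D2g t 0))"
  \<comment> \<open>(H2)\<close>
    and H2: "\<exists>i0 \<alpha>. \<alpha> > 0 \<and>
         (AE t in I01. \<bar>blinfun_apply (Dg t (xb t, ub t)) (0, axis i0 1)\<bar> \<ge> \<alpha>)"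
  \<comment> \<open>zbar is a locally weak Pareto solution\<close>
    and pareto: "loc_weak_pareto L x0 \<phi> g xb ub"
  \<comment> \<open>z = (x,u) is in the critical cone\<close>
    and crit_z: "crit DL D\<phi> g Dg xb ub x u"
  shows "\<exists>(lam::real^'m) (p::real \<Rightarrow> real^'n) (\<theta>::real \<Rightarrow> real).
     (\<forall>j. 0 \<le> lam $ j) \<and> norm lam = 1 \<and> abs_cont_01 p \<and> integrable I01 \<theta> \<and>
     (\<forall>v\<in>Qset. integral\<^sup>L I01 (\<lambda>t. \<theta> t * (v t - g t (xb t, ub t))) \<le> 0) \<and>
     (AE t in I01. (p has_vector_derivative
        (\<chi> i. - inner lam (blinfun_apply (DL t (xb t, ub t)) (axis i 1, 0))
              - inner (p t) (blinfun_apply (D\<phi> t (xb t, ub t)) (axis i 1, 0))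
              - \<theta> t * blinfun_apply (Dg t (xb t, ub t)) (axis i 1, 0))) (at t)) \<and>
     p 1 = 0 \<and>
     (AE t in I01. \<forall>i.
        inner lam (blinfun_apply (DL t (xb t, ub t)) (0, axis i 1))
        + inner (p t) (blinfun_apply (D\<phi> t (xb t, ub t)) (0, axis i 1))
        + \<theta> t * blinfun_apply (Dg t (xb t, ub t)) (0, axis i 1) = 0) \<and>
     integral\<^sup>L I01 (\<lambda>t. inner lam
          (blinfun_apply (blinfun_apply (D2L t (xb t, ub t)) (x t, u t)) (x t, u t)))
     + integral\<^sup>L I01 (\<lambda>t. inner (p t)
          (blinfun_apply (blinfun_apply (D2\<phi> t (xb t, ub t)) (x t, u t)) (x t, u t)))
     + integral\<^sup>L I01 (\<lambda>t. \<theta> t *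
          blinfun_apply (blinfun_apply (D2g t (xb t, ub t)) (x t, u t)) (x t, u t))
     \<ge> 0"
proof -
  have feas: "feasible x0 \<phi> g xb ub" using pareto by (simp add: loc_weak_pareto_def)
  then have xc: "continuous_on {0..1} xb" and uL: "Linf ub"
    and st: "AE t in I01. xb t = x0 + integral\<^sup>L (lebesgue_on {0..t}) (\<lambda>s. \<phi> s (xb s, ub s))"
    and gle: "AE t in I01. g t (xb t, ub t) \<le> 0"
    by (auto simp: feasible_def)
  obtain Cx where Cx: "\<And>t. t \<in> {0..1} \<Longrightarrow> norm (xb t) \<le> Cx"
    using compact_imp_bounded[OF compact_continuous_image[OF xc]] unfolding bounded_iff by (metis compact_Icc image_eqI)
  obtain Cu where Cu: "AE t in I01. norm (ub t) \<le> Cu" using uL by (auto simp: Linf_def)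
  obtain i0 \<alpha> where \<alpha>: "\<alpha> > 0" and nd: "AE t in I01. \<bar>Dg t (xb t, ub t) (0, axis i0 1)\<bar> \<ge> \<alpha>" using H2 by blast
  \<comment> \<open>The ball must contain the reference pair with margin 1, as required by
    \<open>zb_bound\<close>.\<close>
  define M where "M = \<bar>Cx\<bar> + \<bar>Cu\<bar> + 1"
  have M: "M > 0" by (simp add: M_def)
  obtain kL where kL: "kL > 0" and lipL: "AE t in I01. \<forall>x1 u1 x2 u2.
         norm x1 \<le> M \<and> norm u1 \<le> M \<and> norm x2 \<le> M \<and> norm u2 \<le> M \<longrightarrow>
         norm (L t (x1, u1) - L t (x2, u2)) + norm (DL t (x1, u1) - DL t (x2, u2))
           + norm (D2L t (x1, u1) - D2L t (x2, u2)) \<le> kL * (norm (x1 - x2) + norm (u1 - u2))"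
    using L_lip M by blast
  obtain kp where kp: "kp > 0" and lipp: "\<forall>t\<in>{0..1}. \<forall>x1 u1 x2 u2.
         norm x1 \<le> M \<and> norm u1 \<le> M \<and> norm x2 \<le> M \<and> norm u2 \<le> M \<longrightarrow>
         norm (\<phi> t (x1, u1) - \<phi> t (x2, u2)) + \<bar>g t (x1, u1) - g t (x2, u2)\<bar>
           + norm (D\<phi> t (x1, u1) - D\<phi> t (x2, u2)) + norm (Dg t (x1, u1) - Dg t (x2, u2))
           + norm (D2\<phi> t (x1, u1) - D2\<phi> t (x2, u2)) + norm (D2g t (x1, u1) - D2g t (x2, u2))
           \<le> kp * (norm (x1 - x2) + norm (u1 - u2))"
    using \<phi>g_lip M by blast
  have combine: "\<exists>C. AE t in I01. norm (a t) \<le> C \<and> norm (b t) \<le> C \<and> norm (c t) \<le> C"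
    if lin: "Linf a" "Linf (\<lambda>t. norm (b t))" "Linf (\<lambda>t. norm (c t))"
    for a :: "real \<Rightarrow> 'p::real_normed_vector" and b :: "real \<Rightarrow> 'q::real_normed_vector" and c :: "real \<Rightarrow> 'r::real_normed_vector"
  proof -
    obtain A1 A2 A3 where A: "AE t in I01. norm (a t) \<le> A1" "AE t in I01. norm (norm (b t)) \<le> A2" "AE t in I01. norm (norm (c t)) \<le> A3"
      using lin by (auto simp: Linf_def)
    have "AE t in I01. norm (a t) \<le> max A1 (max A2 A3) \<and> norm (b t) \<le> max A1 (max A2 A3) \<and> norm (c t) \<le> max A1 (max A2 A3)"
      using A by eventually_elim auto
    then show ?thesis by blast
  qed
  obtain C1 where C1: "AE t in I01. norm (L t 0) \<le> C1 \<and> norm (DL t 0) \<le> C1 \<and> norm (D2L t 0) \<le> C1" using combine[OF L0_bd] by blast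
  obtain C2 where C2: "AE t in I01. norm (\<phi> t 0) \<le> C2 \<and> norm (D\<phi> t 0) \<le> C2 \<and> norm (D2\<phi> t 0) \<le> C2" using combine[OF \<phi>0_bd] by blast
  obtain C3 where C3: "AE t in I01. norm (g t 0) \<le> C3 \<and> norm (Dg t 0) \<le> C3 \<and> norm (D2g t 0) \<le> C3" using combine[OF g0_bd] by blast
  define good where "good t \<longleftrightarrow> t \<in> {0..1} \<and> norm (ub t) \<le> Cu \<and> g t (xb t, ub t) \<le> 0 \<and> \<bar>Dg t (xb t, ub t) (0, axis i0 1)\<bar> \<ge> \<alpha> \<and>
     (\<forall>x1 u1 x2 u2.
         norm x1 \<le> M \<and> norm u1 \<le> M \<and> norm x2 \<le> M \<and> norm u2 \<le> M \<longrightarrow>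
         norm (L t (x1, u1) - L t (x2, u2)) + norm (DL t (x1, u1) - DL t (x2, u2))
           + norm (D2L t (x1, u1) - D2L t (x2, u2)) \<le> kL * (norm (x1 - x2) + norm (u1 - u2))) \<and>
     (norm (L t 0) \<le> C1 \<and> norm (DL t 0) \<le> C1 \<and> norm (D2L t 0) \<le> C1) \<and>
     (norm (\<phi> t 0) \<le> C2 \<and> norm (D\<phi> t 0) \<le> C2 \<and> norm (D2\<phi> t 0) \<le> C2) \<and>
     (norm (g t 0) \<le> C3 \<and> norm (Dg t 0) \<le> C3 \<and> norm (D2g t 0) \<le> C3) \<and>
     (\<forall>z. (L t has_derivative blinfun_apply (DL t z)) (at z) \<and>
         (DL t has_derivative blinfun_apply (D2L t z)) (at z) \<and> continuous_on UNIV (D2L t))" for t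
  have "AE t in I01. good t"
    using AE_space Cu gle nd lipL C1 C2 C3 L_C2
    by eventually_elim (unfold good_def, intro conjI, simp_all)
  \<comment> \<open>All failures of \<open>good\<close> lie in a null set \<open>N\<close>; removing
    it gives a measurable set of full measure on which every hypothesis holds pointwise.\<close>
  then obtain N where N: "{t \<in> space I01. \<not> good t} \<subseteq> N" "N \<in> null_sets I01"
    by (rule AE_E) (rule that, auto simp: null_sets_def)
  define G where "G = {0..1} - N"
  have Gg: "good t" if "t \<in> G" for t using that N(1) by (auto simp: G_def)
  have G01: "t \<in> {0..1}" if "t \<in> G" for t using that by (simp add: G_def)
  have Gs: "G \<in> sets I01" using N(2) unfolding G_def by (intro sets.Diff) auto
  have GA: "AE t in I01. t \<in> G" using AE_not_in[OF N(2)] AE_space by eventually_elim (simp add: G_def)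
  \<comment> \<open>One constant for all three families: it exceeds twice each Lipschitz constant,
    each bound at 0 increased by 2 k M, and 1.\<close>
  define B where "B = 1 + 2 * kL + 2 * kp + \<bar>C1\<bar> + \<bar>C2\<bar> + \<bar>C3\<bar> + 2 * kL * M + 2 * kp * M"
  have pos: "0 < kL * M" "0 < kp * M" using kL kp M by auto
  have Bc: "2 * kL \<le> B" "2 * kp \<le> B" "C1 + 2 * kL * M \<le> B" "C2 + 2 * kp * M \<le> B" "C3 + 2 * kp * M \<le> B"
    using pos kL kp abs_ge_self[of C1] abs_ge_self[of C2] abs_ge_self[of C3] abs_ge_zero[of C1] abs_ge_zero[of C2] abs_ge_zero[of C3]
    unfolding B_def mult.assoc by linarith+
  have GL: "(L t has_derivative blinfun_apply (DL t z)) (at z)" "(DL t has_derivative blinfun_apply (D2L t z)) (at z)"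
      "norm (L t 0) \<le> C1" "norm (DL t 0) \<le> C1" "norm (D2L t 0) \<le> C1" if "t \<in> G" for t z
    using Gg[OF that] unfolding good_def by blast+
  have Gz: "norm (\<phi> t 0) \<le> C2" "norm (D\<phi> t 0) \<le> C2" "norm (D2\<phi> t 0) \<le> C2"
      "norm (g t 0) \<le> C3" "norm (Dg t 0) \<le> C3" "norm (D2g t 0) \<le> C3" if "t \<in> G" for t
    using Gg[OF that] unfolding good_def by blast+
  have Gb: "norm (ub t) \<le> Cu" "g t (xb t, ub t) \<le> 0" "\<alpha> \<le> \<bar>Dg t (xb t, ub t) (0, axis i0 1)\<bar>" if "t \<in> G" for t
    using Gg[OF that] unfolding good_def by blast+
  have lipp': "norm (\<phi> t (x1, u1) - \<phi> t (x2, u2)) \<le> kp * (norm (x1 - x2) + norm (u1 - u2))"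
      "\<bar>g t (x1, u1) - g t (x2, u2)\<bar> \<le> kp * (norm (x1 - x2) + norm (u1 - u2))"
      "norm (D\<phi> t (x1, u1) - D\<phi> t (x2, u2)) \<le> kp * (norm (x1 - x2) + norm (u1 - u2))"
      "norm (Dg t (x1, u1) - Dg t (x2, u2)) \<le> kp * (norm (x1 - x2) + norm (u1 - u2))"
      "norm (D2\<phi> t (x1, u1) - D2\<phi> t (x2, u2)) \<le> kp * (norm (x1 - x2) + norm (u1 - u2))"
      "norm (D2g t (x1, u1) - D2g t (x2, u2)) \<le> kp * (norm (x1 - x2) + norm (u1 - u2))"
    if "t \<in> {0..1}" "norm x1 \<le> M" "norm u1 \<le> M" "norm x2 \<le> M" "norm u2 \<le> M" for t x1 u1 x2 u2
  proof -
    have *: "norm (\<phi> t (x1, u1) - \<phi> t (x2, u2)) + \<bar>g t (x1, u1) - g t (x2, u2)\<bar>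
           + norm (D\<phi> t (x1, u1) - D\<phi> t (x2, u2)) + norm (Dg t (x1, u1) - Dg t (x2, u2))
           + norm (D2\<phi> t (x1, u1) - D2\<phi> t (x2, u2)) + norm (D2g t (x1, u1) - D2g t (x2, u2))
           \<le> kp * (norm (x1 - x2) + norm (u1 - u2))" using lipp that by blast
    note nn = norm_ge_zero[of "\<phi> t (x1, u1) - \<phi> t (x2, u2)"] norm_ge_zero[of "D\<phi> t (x1, u1) - D\<phi> t (x2, u2)"]
      norm_ge_zero[of "Dg t (x1, u1) - Dg t (x2, u2)"] norm_ge_zero[of "D2\<phi> t (x1, u1) - D2\<phi> t (x2, u2)"]
      norm_ge_zero[of "D2g t (x1, u1) - D2g t (x2, u2)"] abs_ge_zero[of "g t (x1, u1) - g t (x2, u2)"]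
    show "norm (\<phi> t (x1, u1) - \<phi> t (x2, u2)) \<le> kp * (norm (x1 - x2) + norm (u1 - u2))"
      "\<bar>g t (x1, u1) - g t (x2, u2)\<bar> \<le> kp * (norm (x1 - x2) + norm (u1 - u2))"
      "norm (D\<phi> t (x1, u1) - D\<phi> t (x2, u2)) \<le> kp * (norm (x1 - x2) + norm (u1 - u2))"
      "norm (Dg t (x1, u1) - Dg t (x2, u2)) \<le> kp * (norm (x1 - x2) + norm (u1 - u2))"
      "norm (D2\<phi> t (x1, u1) - D2\<phi> t (x2, u2)) \<le> kp * (norm (x1 - x2) + norm (u1 - u2))"
      "norm (D2g t (x1, u1) - D2g t (x2, u2)) \<le> kp * (norm (x1 - x2) + norm (u1 - u2))"
      using * nn by linarith+
  qed
  interpret Ls: smooth_family G M B L DL D2L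
  proof (rule smooth_familyI[where k=kL and C=C1, OF Gs GA L_meas])
    fix t x1 u1 x2 u2 assume t: "t \<in> G" and n: "norm (x1::real^'n) \<le> M" "norm (u1::real^'l) \<le> M" "norm (x2::real^'n) \<le> M" "norm (u2::real^'l) \<le> M"
    have *: "norm (L t (x1, u1) - L t (x2, u2)) + norm (DL t (x1, u1) - DL t (x2, u2))
           + norm (D2L t (x1, u1) - D2L t (x2, u2)) \<le> kL * (norm (x1 - x2) + norm (u1 - u2))"
      using Gg[OF t] n unfolding good_def by blast
    note nn = norm_ge_zero[of "L t (x1, u1) - L t (x2, u2)"] norm_ge_zero[of "DL t (x1, u1) - DL t (x2, u2)"]
      norm_ge_zero[of "D2L t (x1, u1) - D2L t (x2, u2)"]
    show "norm (L t (x1, u1) - L t (x2, u2)) \<le> kL * (norm (x1 - x2) + norm (u1 - u2)) \<and>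
        norm (DL t (x1, u1) - DL t (x2, u2)) \<le> kL * (norm (x1 - x2) + norm (u1 - u2)) \<and>
        norm (D2L t (x1, u1) - D2L t (x2, u2)) \<le> kL * (norm (x1 - x2) + norm (u1 - u2))"
      using * nn by linarith
  qed (use GL kL M Bc in auto)
  interpret Ps: smooth_family G M B \<phi> D\<phi> D2\<phi>
    by (rule smooth_familyI[where k=kp and C=C2, OF Gs GA continuous_slice_measurable[OF \<phi>_cont]])
      (use Gz G01 \<phi>_C2 lipp' kp M Bc in auto)
  interpret Gs: smooth_family G M B g Dg D2g
    by (rule smooth_familyI[where k=kp and C=C3, OF Gs GA continuous_slice_measurable[OF g_cont]])
      (use Gz G01 g_C2 lipp' kp M Bc in auto)
  have zb: "norm (xb t, ub t) + 1 \<le> M" if "t \<in> G" for t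
    using norm_fst_snd_le(3)[of "xb t" "ub t"] Cx[OF G01[OF that]] Gb(1)[OF that] by (simp add: M_def)
  have zm: "(\<lambda>t. (xb t, ub t)) \<in> borel_measurable I01"
    using continuous_on_measurable_I01[OF xc] Linf_measurable[OF uL] by (rule borel_measurable_Pair)
  have \<phi>m: "(\<lambda>t. \<phi> t (xb t, ub t)) \<in> borel_measurable I01" by (rule Ps.comp_measurable[OF zm])
  have \<phi>B: "AE t in I01. norm (\<phi> t (xb t, ub t)) \<le> B"
    using GA
  proof eventually_elim
    case (elim t)
    show ?case using Ps.bound(1)[OF elim] zb[OF elim] by simp
  qed
  \<comment> \<open>Feasibility gives the state equation almost everywhere. Both sides are
    continuous on [0,1], so it holds at every t, as the pointwise setting demands.\<close>
  have eq: "xb t = x0 + (\<integral>s. indicator {0..t} s *\<^sub>R \<phi> s (xb s, ub s) \<partial>I01)" if "t \<in> {0..1}" for t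
  proof (rule continuous_AE_eq[OF xc _ _ that])
    show "continuous_on {0..1} (\<lambda>t. x0 + (\<integral>s. indicator {0..t} s *\<^sub>R \<phi> s (xb s, ub s) \<partial>I01))"
      by (intro continuous_intros initial_integral_measurable(1)[OF \<phi>m \<phi>B])
    show "AE t in I01. xb t = x0 + (\<integral>s. indicator {0..t} s *\<^sub>R \<phi> s (xb s, ub s) \<partial>I01)"
      using st AE_space
    proof eventually_elim
      case (elim t)
      then have "t \<in> {0..1}" by simp
      from elim(1)[unfolded lebesgue_on_initial(1)[OF this]] show ?case .
    qed
  qed
  interpret control_problem G M B L DL D2L \<phi> D\<phi> D2\<phi> g Dg D2g x0 xb ub i0 \<alpha>
  proof unfold_locales
    show "1 \<le> B" using kL kp pos by (simp add: B_def)
    show "xb t = x0 + (\<integral>s. indicator {0..t} s *\<^sub>R \<phi> s (xb s, ub s) \<partial>I01)" if "t \<in> {0..1}" for t using eq[OF that] .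
  qed (use \<alpha> xc Linf_measurable[OF uL] zb Gb in auto)
  show ?thesis by (rule multipliers_exist[OF pareto crit_z])
qed

end
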